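(* Let $T$ be an unrooted tree (serving as the communication network) and let $r\in V(T)$ be an arbitrary node, where each node knows whether it is $r$. There is a deterministic $\tilde O(1)$-round Minor-Aggregation algorithm that constructs a heavy-light decomposition of $T$ rooted at $r$; specifically, upon termination each node learns its HL-info.
   Context: Minor-Aggregation model. The communication network is a connected undirected graph $G=(V,E)$ with $n=|V|$ nodes; both nodes and edges are computational units with private memory. Initially nodes know only their unique $\tilde O(1)$-bit ID (and inputs) and edges know the IDs of their endpoints. Computation proceeds in synchronous rounds, each of three steps: (i) Contraction: each edge $e$ chooses $c_e\in\{\bot,\top\}$, defining the minor $G'=G/\{e:c_e=\top\}$ (self-loops removed), whose vertices (supernodes) are identified with the sets of nodes they contain. (ii) Consensus: each node $v$ chooses an $\tilde O(1)$-bit value $x_v$; for each supernode $s$ all nodes of $s$ learn $y_s=\bigoplus_{v\in s}x_v$ for a predefined aggregation operator $\bigoplus$. (iii) Aggregation: each edge $e$ of $G'$ joining supernodes $a,b$ learns $y_a,y_b$ and chooses $\tilde O(1)$-bit values $z_{e,a},z_{e,b}$; all nodes of each supernode $s$ learn the same aggregate $\bigotimes_{e \text{ incident to } s} z_{e,s}$ for a predefined aggregation operator $\bigotimes$. An aggregation operator maps two $B$-bit messages ($B=\tilde O(1)$) to one $B$-bit message, applied pairwise in arbitrary order to aggregate several messages. $\tilde O(\cdot)$ hides $\mathrm{poly}(\log n)$ factors. Heavy-light decomposition of a tree rooted at $r$: letting $S(v)$ be the number of descendants of $v$ (including $v$), for each non-leaf node $u$ the edge to a child $v$ maximizing $S(v)$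 (ties broken arbitrarily) is labeled heavy and all other edges light. The HL-info of a node $v$ consists of the depth of $v$ in $T$ and the list of all light edges on the root-to-$v$ path, with, for each, the depths and IDs of both endpoints. *)

theory Defs
  imports Complex_Main "HOL-Library.Multiset" "HOL-Library.Landau_Symbols"
begin

section \<open>Polylogarithmic bounds\<close>

definition soft_O1 :: "(nat \<Rightarrow> nat) set" where
  "soft_O1 = {f. \<exists>k::nat. (\<lambda>n. real (f n)) \<in> O(\<lambda>n. ln (real n) ^ k)}"

section \<open>Graphs and trees\<close>

text \<open>Nodes are identified with their unique IDs, which are bit strings.\<close>

type_synonym bits = "bool list"
type_synonym node = bits
type_synonym edge = "node set"

definition graph :: "node set \<Rightarrow> edge set \<Rightarrow> bool" where
  "graph V E \<longleftrightarrow> finite V \<and> V \<noteq> {} \<and>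
     (\<forall>e\<in>E. \<exists>u\<in>V. \<exists>v\<in>V. u \<noteq> v \<and> e = {u, v})"

definition path :: "edge set \<Rightarrow> node \<Rightarrow> node list \<Rightarrow> node \<Rightarrow> bool" where
  "path E u p v \<longleftrightarrow> p \<noteq> [] \<and> hd p = u \<and> last p = v \<and> distinct p \<and>
     successively (\<lambda>a b. {a, b} \<in> E) p"

definition cycle :: "edge set \<Rightarrow> node list \<Rightarrow> bool" where
  "cycle E p \<longleftrightarrow> 3 \<le> length p \<and> distinct p \<and>
     successively (\<lambda>a b. {a, b} \<in> E) p \<and> {last p, hd p} \<in> E"

definition connected_graph :: "node set \<Rightarrow> edge set \<Rightarrow> bool" where
  "connected_graph V E \<longleftrightarrow> graph V E \<and> (\<forall>u\<in>V. \<forall>v\<in>V. \<exists>p. path E u p v)"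

definition tree :: "node set \<Rightarrow> edge set \<Rightarrow> bool" where
  "tree V E \<longleftrightarrow> connected_graph V E \<and> (\<nexists>p. cycle E p)"

section \<open>Heavy-light decompositions\<close>

text \<open>The definitions of this section are meant for a tree with node set \<open>V\<close>, edge set \<open>E\<close> and
  root \<open>r\<close>, where the path between two nodes is unique.\<close>

definition root_path :: "edge set \<Rightarrow> node \<Rightarrow> node \<Rightarrow> node list" where
  "root_path E r v = (THE p. path E r p v)"

definition depth :: "edge set \<Rightarrow> node \<Rightarrow> node \<Rightarrow> nat" where
  "depth E r v = length (root_path E r v) - 1"

definition descendants :: "node set \<Rightarrow> edge set \<Rightarrow> node \<Rightarrow> node \<Rightarrow> node set" where
  "descendants V E r v = {w \<in> V. v \<in> set (root_path E r w)}"

definition subtree_size :: "node set \<Rightarrow> edge set \<Rightarrow> node \<Rightarrow> node \<Rightarrow> nat" where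
  "subtree_size V E r v = card (descendants V E r v)"

definition children :: "node set \<Rightarrow> edge set \<Rightarrow> node \<Rightarrow> node \<Rightarrow> node set" where
  "children V E r u = {v \<in> V. {u, v} \<in> E \<and> u \<in> set (root_path E r v)}"

text \<open>A decomposition is represented by its set \<open>H\<close> of heavy edges; the light edges are \<open>E - H\<close>.\<close>

definition heavy_light :: "node set \<Rightarrow> edge set \<Rightarrow> node \<Rightarrow> edge set \<Rightarrow> bool" where
  "heavy_light V E r H \<longleftrightarrow> H \<subseteq> E \<and>
     (\<forall>u\<in>V. children V E r u \<noteq> {} \<longrightarrow>
       (\<exists>v\<in>children V E r u.
          (\<forall>w\<in>children V E r u. subtree_size V E r w \<le> subtree_size V E r v) \<and>
          (\<forall>w\<in>children V E r u. {u, w} \<in> H \<longleftrightarrow> w = v)))"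

text \<open>The depth of the node, and the light edges on its root path in order from the root; each edge
  is given by the depth and ID of its upper and of its lower endpoint.\<close>

type_synonym hl_info = "nat \<times> ((nat \<times> node) \<times> (nat \<times> node)) list"

definition hl_info_of :: "edge set \<Rightarrow> node \<Rightarrow> edge set \<Rightarrow> node \<Rightarrow> hl_info" where
  "hl_info_of E r H v =
     (let p = root_path E r v in
      (depth E r v,
       [((depth E r a, a), (depth E r b, b)). (a, b) \<leftarrow> zip p (tl p), {a, b} \<in> E - H]))"

section \<open>The Minor-Aggregation model\<close>

type_synonym msg = bits

definition aggregation_operator :: "nat \<Rightarrow> (msg \<Rightarrow> msg \<Rightarrow> msg) \<Rightarrow> bool" where
  "aggregation_operator B f \<longleftrightarrow>
     (\<forall>x y. length x \<le> B \<longrightarrow> length y \<le> B \<longrightarrow> length (f x y) \<le> B)"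

text \<open>\<open>aggregates f M y\<close>: combining the messages \<open>M\<close> pairwise in some order can yield \<open>y\<close>.
  Operators need not be associative or commutative, so \<open>y\<close> need not be unique.\<close>

inductive aggregates :: "(msg \<Rightarrow> msg \<Rightarrow> msg) \<Rightarrow> msg multiset \<Rightarrow> msg \<Rightarrow> bool"
  for f where
  single: "aggregates f {#x#} x"
| combine: "aggregates f M x \<Longrightarrow> aggregates f N y \<Longrightarrow> aggregates f (M + N) (f x y)"

text \<open>A supernode without incident edges learns nothing in the aggregation step.\<close>

definition aggregates_opt ::
  "(msg \<Rightarrow> msg \<Rightarrow> msg) \<Rightarrow> msg multiset \<Rightarrow> msg option \<Rightarrow> bool" where
  "aggregates_opt f M z \<longleftrightarrow>
     (if M = {#} then z = None else (\<exists>y. z = Some y \<and> aggregates f M y))"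

text \<open>Private memory and local computation are unrestricted, so a deterministic unit may be taken to
  act as a function of everything it has learned. A node knows its ID, its input, and for each past
  round the consensus value and the aggregate of its supernode. An edge knows, for each of its two
  endpoints, the ID and for each past round the consensus value of the supernode of that endpoint,
  or \<open>None\<close> if the edge was not present in the minor.\<close>

type_synonym 'i node_view = "node \<times> 'i \<times> (msg \<times> msg option) list"
type_synonym edge_view = "(node \<times> msg option list) set"

text \<open>The second argument of \<open>edge_value\<close> is the endpoint whose supernode receives the value. No
  component depends on the network or its size. A node terminates when \<open>node_output\<close> is not \<open>None\<close>.\<close>

record ('i, 'o) ma_algorithm =
  consensus_op :: "msg \<Rightarrow> msg \<Rightarrow> msg"
  aggregation_op :: "msg \<Rightarrow> msg \<Rightarrow> msg"
  contract :: "edge_view \<Rightarrow> bool"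
  node_value :: "'i node_view \<Rightarrow> msg"
  edge_value :: "edge_view \<Rightarrow> node \<Rightarrow> msg"
  node_output :: "'i node_view \<Rightarrow> 'o option"

record config =
  node_hist :: "node \<Rightarrow> (msg \<times> msg option) list"
  edge_hist :: "edge \<Rightarrow> node \<Rightarrow> msg option list"

definition init_config :: config where
  "init_config = \<lparr>node_hist = (\<lambda>_. []), edge_hist = (\<lambda>_ _. [])\<rparr>"

definition node_view :: "(node \<Rightarrow> 'i) \<Rightarrow> config \<Rightarrow> node \<Rightarrow> 'i node_view" where
  "node_view inp c v = (v, inp v, node_hist c v)"

definition edge_view :: "config \<Rightarrow> edge \<Rightarrow> edge_view" where
  "edge_view c e = (\<lambda>v. (v, edge_hist c e v)) ` e"

definition contracted :: "('i, 'o) ma_algorithm \<Rightarrow> edge set \<Rightarrow> config \<Rightarrow> edge set" where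
  "contracted A E c = {e \<in> E. contract A (edge_view c e)}"

text \<open>The minor obtained by contracting the edges \<open>F\<close>.\<close>

definition supernode :: "edge set \<Rightarrow> node \<Rightarrow> node set" where
  "supernode F v = {u. (v, u) \<in> {(a, b). {a, b} \<in> F}\<^sup>*}"

definition supernodes :: "node set \<Rightarrow> edge set \<Rightarrow> node set set" where
  "supernodes V F = supernode F ` V"

definition minor_edges :: "node set \<Rightarrow> edge set \<Rightarrow> edge set \<Rightarrow> edge set" where
  "minor_edges V E F = {e \<in> E. \<forall>s\<in>supernodes V F. \<not> e \<subseteq> s}"

definition incident_edges :: "node set \<Rightarrow> edge set \<Rightarrow> edge set \<Rightarrow> node set \<Rightarrow> edge set" where
  "incident_edges V E F s = {e \<in> minor_edges V E F. e \<inter> s \<noteq> {}}"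

text \<open>One round. The values \<open>z\<^sub>e\<^sub>,\<^sub>s\<close> are chosen after the edge has learned the consensus values of
  the current round, hence they are computed from the edge views in \<open>c'\<close>.\<close>

definition ma_round ::
  "('i, 'o) ma_algorithm \<Rightarrow> node set \<Rightarrow> edge set \<Rightarrow> (node \<Rightarrow> 'i) \<Rightarrow> config \<Rightarrow> config \<Rightarrow> bool" where
  "ma_round A V E inp c c' \<longleftrightarrow>
     (let F = contracted A E c in
      \<exists>(y :: node set \<Rightarrow> msg) (z :: node set \<Rightarrow> msg option).
        (\<forall>s\<in>supernodes V F.
           aggregates (consensus_op A)
             (image_mset (\<lambda>v. node_value A (node_view inp c v)) (mset_set s)) (y s)) \<and>
        (\<forall>e\<in>E. \<forall>v\<in>e. edge_hist c' e v =
           edge_hist c e v @ [if e \<in> minor_edges V E F then Some (y (supernode F v)) else None]) \<and>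
        (\<forall>s\<in>supernodes V F.
           aggregates_opt (aggregation_op A)
             (image_mset (\<lambda>e. edge_value A (edge_view c' e) (the_elem (e \<inter> s)))
                (mset_set (incident_edges V E F s))) (z s)) \<and>
        (\<forall>v\<in>V. node_hist c' v =
           node_hist c v @ [(y (supernode F v), z (supernode F v))]))"

definition execution ::
  "('i, 'o) ma_algorithm \<Rightarrow> node set \<Rightarrow> edge set \<Rightarrow> (node \<Rightarrow> 'i) \<Rightarrow> (nat \<Rightarrow> config) \<Rightarrow> bool" where
  "execution A V E inp c \<longleftrightarrow>
     c 0 = init_config \<and> (\<forall>t. ma_round A V E inp (c t) (c (Suc t)))"

definition within_bandwidth ::
  "('i, 'o) ma_algorithm \<Rightarrow> node set \<Rightarrow> edge set \<Rightarrow> (node \<Rightarrow> 'i) \<Rightarrow> nat \<Rightarrow> (nat \<Rightarrow> config) \<Rightarrow> nat \<Rightarrow> bool"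
where
  "within_bandwidth A V E inp B c t \<longleftrightarrow>
     (\<forall>v\<in>V. length (node_value A (node_view inp (c t) v)) \<le> B) \<and>
     (\<forall>e\<in>minor_edges V E (contracted A E (c t)). \<forall>v\<in>e.
        length (edge_value A (edge_view (c (Suc t)) e) v) \<le> B)"

text \<open>With \<open>B\<close>-bit messages, whatever the order in which messages are aggregated, the algorithm
  terminates within \<open>R\<close> rounds, at which point the outputs of the nodes satisfy \<open>P\<close>.\<close>

definition ma_solves ::
  "('i, 'o) ma_algorithm \<Rightarrow> node set \<Rightarrow> edge set \<Rightarrow> (node \<Rightarrow> 'i) \<Rightarrow> nat \<Rightarrow> nat \<Rightarrow>
   ((node \<Rightarrow> 'o) \<Rightarrow> bool) \<Rightarrow> bool" where
  "ma_solves A V E inp B R P \<longleftrightarrow>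
     aggregation_operator B (consensus_op A) \<and>
     aggregation_operator B (aggregation_op A) \<and>
     (\<forall>c. execution A V E inp c \<longrightarrow>
       (\<exists>t\<le>R. \<exists>out.
          (\<forall>v\<in>V. node_output A (node_view inp (c t) v) = Some (out v)) \<and> P out \<and>
          (\<forall>s<t. (\<forall>v\<in>V. node_output A (node_view inp (c s) v) = None) \<and>
                 within_bandwidth A V E inp B c s)))"

text \<open>Executions always exist, so the universal quantifier above is never vacuous.\<close>

lemma aggregates_exists: "M \<noteq> {#} \<Longrightarrow> \<exists>y. aggregates f M y"
proof (induction M)
  case (add x M)
  show ?case
  proof (cases "M = {#}")
    case True
    then show ?thesis using aggregates.single[of f x] by auto
  next
    case False
    then obtain y where "aggregates f M y" using add.IH by blast
    then have "aggregates f ({#x#} + M) (f x y)"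
      by (rule aggregates.combine[OF aggregates.single])
    then show ?thesis by auto
  qed
qed simp

lemma supernode_subset:
  assumes "graph V E" "F \<subseteq> E" "v \<in> V"
  shows "supernode F v \<subseteq> V"
proof
  fix u assume "u \<in> supernode F v"
  then have "(v, u) \<in> {(a, b). {a, b} \<in> F}\<^sup>*" by (simp add: supernode_def)
  then show "u \<in> V"
  proof induction
    case (step a b)
    then have "{a, b} \<in> E" using assms by auto
    then obtain x y where "x \<in> V" "y \<in> V" "{a, b} = {x, y}"
      using assms(1) unfolding graph_def by blast
    then show ?case by (auto simp: doubleton_eq_iff)
  qed (use assms in simp)
qed

lemma ma_round_exists:
  assumes "graph V E"
  shows "\<exists>c'. ma_round A V E inp c c'"
proof -
  define F where "F = contracted A E c"
  have "\<exists>y. aggregates (consensus_op A)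
      (image_mset (\<lambda>v. node_value A (node_view inp c v)) (mset_set s)) y"
    if "s \<in> supernodes V F" for s
  proof (rule aggregates_exists)
    obtain v where v: "v \<in> V" "s = supernode F v"
      using \<open>s \<in> supernodes V F\<close> by (auto simp: supernodes_def)
    have "F \<subseteq> E" by (auto simp: F_def contracted_def)
    from supernode_subset[OF assms this v(1)] have "s \<subseteq> V" by (simp add: v(2))
    moreover have "finite V" using assms by (simp add: graph_def)
    ultimately have "finite s" by (rule finite_subset)
    moreover have "v \<in> s" by (simp add: v(2) supernode_def)
    ultimately show "image_mset (\<lambda>v. node_value A (node_view inp c v)) (mset_set s) \<noteq> {#}"
      by (auto simp: mset_set_empty_iff)
  qed
  then obtain y where y: "\<And>s. s \<in> supernodes V F \<Longrightarrow> aggregates (consensus_op A)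
      (image_mset (\<lambda>v. node_value A (node_view inp c v)) (mset_set s)) (y s)"
    by metis
  define eh where "eh = (\<lambda>e v. edge_hist c e v @
    [if e \<in> minor_edges V E F then Some (y (supernode F v)) else None])"
  define c0 where "c0 = \<lparr>node_hist = (\<lambda>_. []), edge_hist = eh\<rparr>"
  have "\<exists>z. aggregates_opt f M z" for f M
    using aggregates_exists[of M f] by (auto simp: aggregates_opt_def)
  then have "\<forall>s. \<exists>z. aggregates_opt (aggregation_op A)
      (image_mset (\<lambda>e. edge_value A (edge_view c0 e) (the_elem (e \<inter> s)))
         (mset_set (incident_edges V E F s))) z"
    by blast
  from choice[OF this] obtain z where z: "\<And>s. aggregates_opt (aggregation_op A)
      (image_mset (\<lambda>e. edge_value A (edge_view c0 e) (the_elem (e \<inter> s)))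
         (mset_set (incident_edges V E F s))) (z s)"
    by blast
  define c' where "c' = c0\<lparr>node_hist :=
    \<lambda>v. node_hist c v @ [(y (supernode F v), z (supernode F v))]\<rparr>"
  have "edge_view c' = edge_view c0" by (simp add: c'_def edge_view_def fun_eq_iff)
  then have "ma_round A V E inp c c'"
    unfolding ma_round_def Let_def F_def[symmetric]
    using y z by (intro exI[of _ y] exI[of _ z]) (auto simp: c'_def c0_def eh_def)
  then show ?thesis ..
qed

lemma execution_exists:
  assumes "graph V E"
  shows "\<exists>c. execution A V E inp c"
proof -
  have "\<forall>c. \<exists>c'. ma_round A V E inp c c'"
    using ma_round_exists[OF assms] by blast
  from choice[OF this] obtain g where g: "\<And>c. ma_round A V E inp c (g c)"
    by blast
  have "execution A V E inp (\<lambda>t. (g ^^ t) init_config)"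
    by (simp add: execution_def g)
  then show ?thesis by blast
qed

end

theory Submission
  imports Defs
begin

text \<open>Clusters of nodes are merged in rounds: a cluster with at most two neighbouring clusters is
  absorbed by one of them whose label has the other value at some fixed bit. Cycling through all bits
  and both values removes a constant fraction of the clusters, since at least half of the clusters
  have degree at most two and one of them only survives if one of its neighbours is absorbed. Undoing
  the merging steps in reverse order, an absorbed cluster knows everything behind its other incident
  edge, and therefore the number of nodes on both sides of the edge along which it was absorbed and
  which side contains the root. At the end every edge knows the subtree size of its lower endpoint,
  which determines the heavy edges. Subtree sizes strictly decrease along a heavy path, so contracting
  heavy edges between nodes whose sizes have a common binary prefix yields the positions on heavy
  paths, and at most logarithmically many jumps over light edges yield the rest of the HL-info.\<close>

section \<open>Rooted trees\<close>

text \<open>Two features of the model shape the construction. A supernode learns one sum, and one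
  sum or maximum, formed in an arbitrary order; hence several quantities are packed as digits to the
  base \<open>base l = 2 ^ (l + 1)\<close>. Only edges see the announcements of two neighbours side
  by side; hence contraction and comparison are decided by edges from remembered announcements. As
  distinct IDs of length at most \<open>l\<close> allow fewer than \<open>base l\<close> nodes,
  \<open>l\<close> replaces knowledge of the number of nodes. Bits break symmetry without
  randomness, since distinct labels differ in some bit. The degree bound two limits how many
  survivors can depend on one absorbed cluster, which is what makes a constant fraction disappear in
  a sweep. The root weighs an extra \<open>base l\<close>, more than all nodes together, so
  comparing a side with \<open>base l\<close> tells whether it contains the root. A position is the
  number of larger sizes on the heavy path. It varies from node to node, whereas a supernode learns
  a single number; grouping the larger sizes by the highest differing bit makes each partial count
  common to a whole class.\<close>

lemma path_from_same: "path E u p u \<Longrightarrow> p = [u]"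
  unfolding path_def by (cases p) (auto split: if_splits)

lemma successively_rev_sym:
  assumes "successively (\<lambda>a b. {a, b} \<in> E) p"
  shows "successively (\<lambda>a b. {a, b} \<in> E) (rev p)"
  using assms by (simp add: insert_commute)

text \<open>From \<open>u\<close> follow the first path to its first vertex \<open>x\<close> on the
  second one and return along the second. The choice of \<open>x\<close> keeps the vertices
  distinct, and \<open>hd p \<noteq> hd q\<close> prevents both arms from being empty, so there are
  at least three vertices.\<close>

lemma distinct_paths_cycle:
  assumes p: "path E u (u # p) v" and q: "path E u (u # q) v"
    and ne: "p \<noteq> []" "q \<noteq> []" and hd: "hd p \<noteq> hd q"
  shows "\<exists>c. cycle E c"
proof -
  have "last p = v" "last q = v" using p q ne by (auto simp: path_def)
  then have "\<exists>x\<in>set p. x \<in> set q" using ne by (metis last_in_set)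
  then obtain xs x xs' where px: "p = xs @ x # xs'" and xq: "x \<in> set q"
    and disj: "\<forall>y\<in>set xs. y \<notin> set q"
    using split_list_first_prop[of p "\<lambda>x. x \<in> set q"] by blast
  from xq obtain ys ys' where qx: "q = ys @ x # ys'" by (meson split_list)
  let ?c = "u # xs @ x # rev ys"
  have "xs \<noteq> [] \<or> ys \<noteq> []" using hd px qx by auto
  then have "3 \<le> length ?c" by (cases xs; cases ys) auto
  moreover have "distinct ?c" using p q disj px qx by (auto simp: path_def)
  moreover have "successively (\<lambda>a b. {a, b} \<in> E) ?c"
  proof -
    have sp: "successively (\<lambda>a b. {a, b} \<in> E) (u # xs @ [x])"
      using p px by (auto simp: path_def successively_append_iff simp flip: append_Cons)
    have sq: "successively (\<lambda>a b. {a, b} \<in> E) (ys @ [x])"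
      using q qx by (auto simp: path_def successively_append_iff successively_Cons)
    then have "successively (\<lambda>a b. {a, b} \<in> E) (x # rev ys)"
      using successively_rev_sym[OF sq] by simp
    with sp show ?thesis
      by (auto simp: successively_append_iff successively_Cons simp flip: append_Cons split: if_splits)
  qed
  moreover have "{last ?c, hd ?c} \<in> E"
  proof (cases ys)
    case Nil
    then show ?thesis using q qx by (auto simp: path_def successively_Cons insert_commute)
  next
    case (Cons y ys2)
    then show ?thesis using q qx by (auto simp: path_def successively_Cons insert_commute)
  qed
  ultimately show ?thesis unfolding cycle_def by blast
qed

lemma tree_path_unique:
  assumes "\<nexists>c. cycle E c"
  shows "path E u p v \<Longrightarrow> path E u q v \<Longrightarrow> p = q"
proof (induction p arbitrary: u q)
  case Nil
  then show ?case by (simp add: path_def)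
next
  case (Cons a p)
  have a: "a = u" using Cons.prems by (simp add: path_def)
  obtain q' where q: "q = u # q'" using Cons.prems(2) by (cases q) (auto simp: path_def)
  show ?case
  proof (cases "u = v")
    case True
    then show ?thesis using Cons.prems path_from_same by blast
  next
    case False
    then have ne: "p \<noteq> []" "q' \<noteq> []" using Cons.prems q a by (auto simp: path_def)
    have "hd p = hd q'"
      using distinct_paths_cycle[of E u p v q'] Cons.prems a q ne assms by blast
    moreover have "path E (hd p) p v" "path E (hd q') q' v"
      using Cons.prems a q ne by (auto simp: path_def successively_Cons)
    ultimately show ?thesis using Cons.IH a q by metis
  qed
qed

locale rooted_tree =
  fixes V :: "node set" and E :: "edge set" and r :: node
  assumes tree: "tree V E" and root: "r \<in> V"
begin

definition rp :: "node \<Rightarrow> node list" where "rp = root_path E r"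
definition par :: "node \<Rightarrow> node" where "par v = last (butlast (rp v))"
definition dep :: "node \<Rightarrow> nat" where "dep = depth E r"
definition desc :: "node \<Rightarrow> node set" where "desc = descendants V E r"

lemma graph: "graph V E" and acyclic: "\<nexists>c. cycle E c"
  using tree by (auto simp: tree_def connected_graph_def)

lemma finite_V: "finite V" using graph by (simp add: graph_def)

lemma edge_nodes: "{u, w} \<in> E \<Longrightarrow> u \<in> V \<and> w \<in> V \<and> u \<noteq> w"
  using graph unfolding graph_def by (metis doubleton_eq_iff)

lemma edge_cases: "e \<in> E \<Longrightarrow> \<exists>u w. e = {u, w} \<and> u \<in> V \<and> w \<in> V \<and> u \<noteq> w"
  using graph unfolding graph_def by blast

lemma rp_eqI: "path E r p v \<Longrightarrow> rp v = p"
  unfolding rp_def root_path_def using tree_path_unique[OF acyclic] by blast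

lemma rp_path: "v \<in> V \<Longrightarrow> path E r (rp v) v"
  using tree root rp_eqI unfolding tree_def connected_graph_def by metis

lemma rp_root [simp]: "rp r = [r]"
  by (rule rp_eqI) (simp add: path_def)

lemma set_rp: assumes "v \<in> V" shows "set (rp v) \<subseteq> V"
proof
  fix x assume "x \<in> set (rp v)"
  then obtain as bs where s: "rp v = as @ x # bs" by (meson split_list)
  show "x \<in> V"
  proof (cases as rule: rev_cases)
    case Nil
    then show ?thesis using s rp_path[OF assms] root by (auto simp: path_def)
  next
    case (snoc as' y)
    then have "{y, x} \<in> E" using s rp_path[OF assms] by (auto simp: path_def successively_append_iff)
    then show ?thesis using edge_nodes by blast
  qed
qed

lemma rp_snoc:
  assumes "v \<in> V" "v \<noteq> r"
  shows "rp v = rp (par v) @ [v]" and "par v \<in> V" and "{v, par v} \<in> E"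
proof -
  have p: "path E r (rp v) v" using rp_path assms by blast
  obtain q where q: "rp v = q @ [v]" using p by (metis append_butlast_last_id path_def)
  have "q \<noteq> []" using p q assms by (auto simp: path_def)
  then obtain q' where q': "q = q' @ [par v]" unfolding par_def q by (metis append_butlast_last_id butlast_snoc)
  show par: "par v \<in> V" using set_rp[OF assms(1)] q q' by auto
  show "{v, par v} \<in> E" using p q q' by (auto simp: path_def successively_append_iff insert_commute)
  have "path E r q (par v)" using p q q' by (auto simp: path_def successively_append_iff hd_append split: if_splits)
  then show "rp v = rp (par v) @ [v]" using rp_eqI q by simp
qed

lemma rp_last: "v \<in> V \<Longrightarrow> last (rp v) = v"
  and rp_nonempty: "v \<in> V \<Longrightarrow> rp v \<noteq> []" and self_in_rp: "v \<in> V \<Longrightarrow> v \<in> set (rp v)"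
  using rp_path[of v] last_in_set[of "rp v"] by (auto simp: path_def)

lemma dep_root [simp]: "dep r = 0"
  by (simp add: dep_def depth_def flip: rp_def)

lemma dep_par: "v \<in> V \<Longrightarrow> v \<noteq> r \<Longrightarrow> dep v = Suc (dep (par v))"
  using rp_snoc[of v] rp_nonempty[of "par v"] by (simp add: dep_def depth_def flip: rp_def)

lemma tree_induct [consumes 1, case_names root par]:
  assumes "v \<in> V" "P r" "\<And>v. v \<in> V \<Longrightarrow> v \<noteq> r \<Longrightarrow> par v \<in> V \<Longrightarrow> P (par v) \<Longrightarrow> P v"
  shows "P v"
  using assms(1)
proof (induction "dep v" arbitrary: v rule: less_induct)
  case less
  show ?case
  proof (cases "v = r")
    case False
    then show ?thesis using less assms(3)[of v] rp_snoc(2)[of v] dep_par[of v] by simp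
  qed (simp add: assms(2))
qed

text \<open>If \<open>y\<close> is off the root path of \<open>x\<close>, appending it yields the
  root path of \<open>y\<close>. Otherwise the end of that path from \<open>y\<close> to
  \<open>x\<close> closes to a cycle unless it has only two vertices.\<close>

lemma edge_par:
  assumes "{x, y} \<in> E"
  shows "(x \<noteq> r \<and> y = par x) \<or> (y \<noteq> r \<and> x = par y)"
proof -
  have V: "x \<in> V" "y \<in> V" "x \<noteq> y" using edge_nodes assms by auto
  have px: "path E r (rp x) x" using rp_path V by blast
  show ?thesis
  proof (cases "y \<in> set (rp x)")
    case False
    then have "path E r (rp x @ [y]) y"
      using px assms by (auto simp: path_def successively_append_iff)
    then have ry: "rp y = rp x @ [y]" by (rule rp_eqI)
    then have "par y = x" using px by (simp add: par_def path_def)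
    moreover have "y \<noteq> r" using ry px by (auto simp: path_def)
    ultimately show ?thesis by simp
  next
    case True
    then obtain as bs where s: "rp x = as @ y # bs" by (meson split_list)
    have lb: "bs \<noteq> []" "last bs = x" using s V px by (auto simp: path_def split: if_splits)
    have "length bs < 2"
    proof (rule ccontr)
      assume "\<not> length bs < 2"
      then have "cycle E (y # bs)"
        using s px lb assms unfolding cycle_def path_def by (auto simp: successively_append_iff)
      then show False using acyclic by blast
    qed
    then have "bs = [x]" using lb by (cases bs) auto
    then have "par x = y" "x \<noteq> r" using s by (auto simp: par_def butlast_append)
    then show ?thesis by simp
  qed
qed

lemma par_ne: "v \<in> V \<Longrightarrow> v \<noteq> r \<Longrightarrow> par v \<noteq> v"
  using dep_par by fastforce

lemma parent_edge_inj:
  assumes "x \<in> V" "x \<noteq> r" "y \<in> V" "y \<noteq> r" "{x, par x} = {y, par y}"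
  shows "x = y"
  using assms dep_par[of x] dep_par[of y] by (metis doubleton_eq_iff Suc_n_not_le_n le_SucI order_refl)

lemma set_rp_par: "v \<in> V \<Longrightarrow> v \<noteq> r \<Longrightarrow> set (rp v) = insert v (set (rp (par v)))"
  using rp_snoc(1) by simp

lemma mem_desc: "w \<in> desc v \<longleftrightarrow> w \<in> V \<and> v \<in> set (rp w)"
  by (simp add: desc_def descendants_def rp_def)

lemma finite_desc [simp]: "finite (desc v)" using finite_V by (simp add: desc_def descendants_def)
lemma desc_subset: "desc v \<subseteq> V" by (auto simp: mem_desc)
lemma desc_root: "desc r = V"
proof -
  have "r \<in> set (rp w)" if "w \<in> V" for w using that by (induction rule: tree_induct) (auto simp: set_rp_par)
  then show ?thesis by (auto simp: mem_desc)
qed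

lemma anc_trans: "w \<in> V \<Longrightarrow> u \<in> set (rp v) \<Longrightarrow> v \<in> set (rp w) \<Longrightarrow> u \<in> set (rp w)"
  by (induction rule: tree_induct) (auto simp: set_rp_par)

lemma anc_dep: "v \<in> V \<Longrightarrow> u \<in> set (rp v) \<Longrightarrow> dep u \<le> dep v \<and> (dep u = dep v \<longrightarrow> u = v)"
  by (induction rule: tree_induct) (auto simp: set_rp_par dep_par)

lemma anc_linear:
  "w \<in> V \<Longrightarrow> u \<in> set (rp w) \<Longrightarrow> v \<in> set (rp w) \<Longrightarrow> u \<in> set (rp v) \<or> v \<in> set (rp u)"
  by (induction rule: tree_induct) (auto simp: set_rp_par self_in_rp)

lemma children_eq: "u \<in> V \<Longrightarrow> children V E r u = {v \<in> V. v \<noteq> r \<and> par v = u}"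
proof (intro set_eqI iffI)
  fix v assume u: "u \<in> V" and "v \<in> children V E r u"
  then have v: "v \<in> V" "{u, v} \<in> E" "u \<in> set (rp v)" by (auto simp: children_def rp_def)
  have "u \<noteq> v" using edge_nodes v by blast
  then have "dep u < dep v" using anc_dep v by (meson le_neq_implies_less)
  then have "\<not> (u \<noteq> r \<and> v = par u)" using dep_par u by auto
  then show "v \<in> {v \<in> V. v \<noteq> r \<and> par v = u}" using edge_par[OF v(2)] v(1) by auto
next
  fix v assume "u \<in> V" "v \<in> {v \<in> V. v \<noteq> r \<and> par v = u}"
  then show "v \<in> children V E r u" using rp_snoc[of v] set_rp_par[of v] self_in_rp[of u]
    by (auto simp: children_def rp_def[symmetric] insert_commute)
qed

end

section \<open>Connected node classes\<close>

text \<open>Pairs point outwards: the number an edge delivers depends on the endpoint that receives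
  it, which is the first component.\<close>

definition cut :: "edge set \<Rightarrow> node set \<Rightarrow> (node \<times> node) set" where
  "cut E s = {(u, w). u \<in> s \<and> w \<notin> s \<and> {u, w} \<in> E}"

definition inner :: "edge set \<Rightarrow> (node \<Rightarrow> 'a) \<Rightarrow> edge set" where
  "inner E f = {e \<in> E. \<forall>u\<in>e. \<forall>w\<in>e. f u = f w}"

context rooted_tree
begin

definition cls :: "(node \<Rightarrow> 'a) \<Rightarrow> node \<Rightarrow> node set" where
  "cls f v = {u \<in> V. f u = f v}"

definition tops :: "(node \<Rightarrow> 'a) \<Rightarrow> node set" where
  "tops f = {x \<in> V. x = r \<or> f (par x) \<noteq> f x}"

text \<open>Every class of \<open>f\<close> has at least one top, so this says that the classes induce subtrees.\<close>

definition connected_classes :: "(node \<Rightarrow> 'a) \<Rightarrow> bool" where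
  "connected_classes f \<longleftrightarrow> inj_on f (tops f)"

definition apex :: "(node \<Rightarrow> 'a) \<Rightarrow> node \<Rightarrow> node" where
  "apex f v = (THE x. x \<in> tops f \<and> f x = f v)"

lemma finite_cls [simp]: "finite (cls f v)" using finite_V by (simp add: cls_def)

lemma finite_cut: "finite (cut E s)"
proof (rule finite_subset)
  show "cut E s \<subseteq> V \<times> V" using edge_nodes unfolding cut_def by blast
qed (simp add: finite_V)

lemma tops_subset: "tops f \<subseteq> V" by (auto simp: tops_def)
lemma finite_tops: "finite (tops f)" using finite_V by (simp add: tops_def)
lemma root_tops: "r \<in> tops f" by (simp add: tops_def root)

lemma apex_exists: "v \<in> V \<Longrightarrow> \<exists>x\<in>tops f. f x = f v \<and> x \<in> set (rp v)"
proof (induction rule: tree_induct)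
  case root
  then show ?case by (auto simp: root_tops intro!: bexI[of _ r])
next
  case (par v)
  then show ?case by (cases "v \<in> tops f") (auto simp: set_rp_par tops_def)
qed

lemma apex_unique:
  assumes "connected_classes f" "x \<in> tops f" "f x = f v"
  shows "apex f v = x"
  unfolding apex_def using assms by (intro the_equality) (auto simp: connected_classes_def inj_on_def)

lemma apex:
  assumes "connected_classes f" "v \<in> V"
  shows "apex f v \<in> tops f" "f (apex f v) = f v" "apex f v \<in> set (rp v)" "apex f v \<in> V"
    "dep (apex f v) \<le> dep v"
proof -
  obtain x where x: "x \<in> tops f" "f x = f v" "x \<in> set (rp v)" using apex_exists assms(2) by blast
  moreover have "apex f v = x" using apex_unique[OF assms(1)] x by blast
  ultimately show "apex f v \<in> tops f" "f (apex f v) = f v" "apex f v \<in> set (rp v)" "apex f v \<in> V"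
    "dep (apex f v) \<le> dep v"
    using tops_subset anc_dep[OF assms(2)] by auto
qed

lemma apex_cong: "f u = f v \<Longrightarrow> apex f u = apex f v" by (simp add: apex_def)

text \<open>Parent edges inside a class lead every member up to a top, and
  \<open>connected_classes\<close> makes this top common to the class. Conversely, contracted edges
  preserve \<open>f\<close>.\<close>

lemma supernode_inner:
  assumes "connected_classes f" "v \<in> V"
  shows "supernode (inner E f) v = cls f v"
proof
  let ?R = "{(a, b). {a, b} \<in> inner E f}"
  have sym: "sym (?R\<^sup>*)" by (rule sym_rtrancl, rule symI) (simp add: doubleton_eq_iff insert_commute)
  show "supernode (inner E f) v \<subseteq> cls f v"
  proof
    fix u assume "u \<in> supernode (inner E f) v"
    then have "(v, u) \<in> ?R\<^sup>*" by (simp add: supernode_def)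
    then show "u \<in> cls f v"
    proof (induction rule: rtrancl_induct)
      case (step a b)
      have "{a, b} \<in> inner E f" using step.hyps(2) by simp
      then have "{a, b} \<in> E" "f a = f b" unfolding inner_def by blast+
      then show ?case using step.IH edge_nodes[of a b] by (simp add: cls_def)
    qed (simp add: cls_def assms)
  qed
  have up: "(u, apex f u) \<in> ?R\<^sup>*" if "u \<in> V" for u
    using that
  proof (induction rule: tree_induct)
    case root
    then show ?case using apex_unique[OF assms(1) root_tops, of r] by simp
  next
    case (par u)
    show ?case
    proof (cases "u \<in> tops f")
      case True
      then show ?thesis using apex_unique[OF assms(1) True, of u] by simp
    next
      case False
      then have "f (par u) = f u" using par by (simp add: tops_def)
      then have "(u, par u) \<in> ?R" "apex f (par u) = apex f u"
        using rp_snoc(3)[of u] par by (auto simp: inner_def apex_def)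
      then show ?thesis using converse_rtrancl_into_rtrancl[OF _ par.IH, of u] by simp
    qed
  qed
  show "cls f v \<subseteq> supernode (inner E f) v"
  proof
    fix u assume "u \<in> cls f v"
    then have "u \<in> V" "apex f u = apex f v" by (simp_all add: cls_def apex_def)
    then have "(apex f v, u) \<in> ?R\<^sup>*" using symD[OF sym up[of u]] by simp
    with up[OF assms(2)] have "(v, u) \<in> ?R\<^sup>*" by (rule rtrancl_trans)
    then show "u \<in> supernode (inner E f) v" by (simp add: supernode_def)
  qed
qed

text \<open>Of two adjacent classes the one with the deeper top hangs below the other one by the parent
  edge of its top, so adjacent classes are joined by a single edge and no three classes are pairwise
  adjacent.\<close>

lemma cross_edge:
  assumes "connected_classes f" "{u, w} \<in> E" "f u \<noteq> f w" "dep (apex f w) \<le> dep (apex f u)"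
  shows "u = apex f u" "u \<noteq> r" "w = par u"
proof -
  have V: "u \<in> V" "w \<in> V" using edge_nodes assms by auto
  have "w = par u \<and> u \<noteq> r"
  proof (rule ccontr)
    assume "\<not> ?thesis"
    then have w: "w \<noteq> r" "u = par w" using edge_par[OF assms(2)] by auto
    then have "apex f w = w" using V assms by (intro apex_unique) (auto simp: tops_def)
    then show False using assms(4) dep_par[of w] w V apex(5)[OF assms(1) V(1)] by auto
  qed
  then show "w = par u" "u \<noteq> r" by auto
  then have "u \<in> tops f" using V assms by (auto simp: tops_def)
  then show "u = apex f u" using apex_unique[OF assms(1)] by metis
qed

lemma cross_edge_unique:
  assumes cc: "connected_classes f" and e: "{u, w} \<in> E" "{u', w'} \<in> E"
    and f: "f u \<noteq> f w" "f u' = f u" "f w' = f w"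
  shows "u' = u \<and> w' = w"
proof -
  have t: "apex f u' = apex f u" "apex f w' = apex f w" using f by (simp_all add: apex_def)
  show ?thesis
  proof (cases "dep (apex f w) \<le> dep (apex f u)")
    case True
    then show ?thesis using cross_edge[OF cc e(1)] cross_edge[OF cc e(2)] f t by metis
  next
    case False
    then have "dep (apex f u) \<le> dep (apex f w)" by simp
    then show ?thesis
      using cross_edge[OF cc, of w u] cross_edge[OF cc, of w' u'] e f t by (metis insert_commute)
  qed
qed

lemma no_triangle:
  assumes cc: "connected_classes f"
    and e: "{a, b} \<in> E" "{b', c} \<in> E" "{c', a'} \<in> E"
    and f: "f a' = f a" "f b' = f b" "f c' = f c" "f a \<noteq> f b" "f b \<noteq> f c" "f c \<noteq> f a"
  shows False
proof -
  have key: False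
    if "{x, y} \<in> E" "{x', z} \<in> E" "f x' = f x" "f x \<noteq> f y" "f y \<noteq> f z" "f z \<noteq> f x"
      "dep (apex f y) \<le> dep (apex f x)" "dep (apex f z) \<le> dep (apex f x)" for x x' y z
  proof -
    have "apex f x' = apex f x" using that by (simp_all add: apex_def)
    then have "y = z" using cross_edge[OF cc, of x y] cross_edge[OF cc, of x' z] that by metis
    then show False using that by simp
  qed
  have t: "apex f a' = apex f a" "apex f b' = apex f b" "apex f c' = apex f c"
    using f by (simp_all add: apex_def)
  have e': "{b, a} \<in> E" "{c, b'} \<in> E" "{a', c'} \<in> E" using e by (auto simp: insert_commute)
  consider "dep (apex f b) \<le> dep (apex f a) \<and> dep (apex f c) \<le> dep (apex f a)"
    | "dep (apex f a) \<le> dep (apex f b) \<and> dep (apex f c) \<le> dep (apex f b)"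
    | "dep (apex f a) \<le> dep (apex f c) \<and> dep (apex f b) \<le> dep (apex f c)" by linarith
  then show False
  proof cases
    case 1 then show False using key[of a b a' c'] e e' f t by auto
  next
    case 2 then show False using key[of b a b' c] e e' f t by auto
  next
    case 3 then show False using key[of c b' c' a'] e e' f t by auto
  qed
qed

section \<open>Boundaries of classes and the weight behind each boundary edge\<close>

definition lower :: "(node \<Rightarrow> 'a) \<Rightarrow> 'a \<Rightarrow> node set" where
  "lower f c = {x \<in> tops f - {r}. f (par x) = c}"

definition upper :: "(node \<Rightarrow> 'a) \<Rightarrow> 'a \<Rightarrow> node set" where
  "upper f c = {x \<in> tops f - {r}. f x = c}"

text \<open>By \<open>edge_par\<close> a boundary edge joins a vertex to its parent. It is named by
  its lower endpoint, which lies outside the class for \<open>lower\<close> and inside it for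
  \<open>upper\<close>.\<close>

lemma cut_cls:
  assumes "v \<in> V"
  shows "cut E (cls f v) = (\<lambda>x. (par x, x)) ` lower f (f v) \<union> (\<lambda>x. (x, par x)) ` upper f (f v)"
proof (intro set_eqI iffI)
  fix z assume "z \<in> cut E (cls f v)"
  then obtain u w where z: "z = (u, w)" "u \<in> V" "f u = f v" "f w \<noteq> f v" "{u, w} \<in> E"
    using edge_nodes by (auto simp: cut_def cls_def)
  then have "w \<in> V" using edge_nodes by blast
  then show "z \<in> (\<lambda>x. (par x, x)) ` lower f (f v) \<union> (\<lambda>x. (x, par x)) ` upper f (f v)"
    using edge_par[OF z(5)] z by (auto simp: lower_def upper_def tops_def image_iff)
next
  fix z assume "z \<in> (\<lambda>x. (par x, x)) ` lower f (f v) \<union> (\<lambda>x. (x, par x)) ` upper f (f v)"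
  then show "z \<in> cut E (cls f v)"
    using rp_snoc by (auto simp: cut_def cls_def lower_def upper_def tops_def insert_commute)
qed

lemma par_par_ne: "x \<in> V \<Longrightarrow> x \<noteq> r \<Longrightarrow> par x \<noteq> r \<Longrightarrow> par (par x) \<noteq> x"
  using dep_par[of x] dep_par[of "par x"] rp_snoc(2)[of x] by fastforce

lemma finite_lower [simp]: "finite (lower f c)" and finite_upper [simp]: "finite (upper f c)"
  using finite_tops[of f] by (auto simp: lower_def upper_def)

lemma upper_apex:
  assumes "connected_classes f" "v \<in> V"
  shows "upper f (f v) = {apex f v} - {r}"
proof
  show "upper f (f v) \<subseteq> {apex f v} - {r}"
  proof
    fix x assume "x \<in> upper f (f v)"
    then have "x \<in> tops f" "x \<noteq> r" "f x = f v" by (auto simp: upper_def)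
    then show "x \<in> {apex f v} - {r}" using apex_unique[OF assms(1), of x v] by simp
  qed
qed (use apex[OF assms] in \<open>auto simp: upper_def\<close>)

lemma sum_cut_cls:
  assumes "v \<in> V"
  shows "(\<Sum>p\<in>cut E (cls f v). g p) =
    (\<Sum>x\<in>lower f (f v). g (par x, x)) + (\<Sum>x\<in>upper f (f v). g (x, par x))"
proof -
  have dis: "(\<lambda>x. (par x, x)) ` lower f (f v) \<inter> (\<lambda>x. (x, par x)) ` upper f (f v) = {}"
    using par_par_ne by (fastforce simp: lower_def upper_def tops_def)
  show ?thesis
    unfolding cut_cls[OF assms] using dis
    by (subst sum.union_disjoint) (auto simp: sum.reindex inj_on_def)
qed

text \<open>Classes are convex along root paths: climbing from \<open>y\<close>, the class can only
  be left at one of its tops, and its only top is \<open>apex f v\<close>.\<close>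

lemma anc_in_cls:
  assumes cc: "connected_classes f" and v: "v \<in> V"
  shows "y \<in> V \<Longrightarrow> f y = f v \<Longrightarrow> z \<in> set (rp y) \<Longrightarrow> apex f v \<in> set (rp z) \<Longrightarrow> f z = f v"
proof (induction rule: tree_induct)
  case (par y)
  show ?case
  proof (cases "z = y")
    case False
    then have z: "z \<in> set (rp (par y))" using par by (simp add: set_rp_par)
    have "y \<notin> tops f"
    proof
      assume "y \<in> tops f"
      then have "apex f v = y" using apex_unique[OF cc] par by metis
      then have "y \<in> set (rp (par y))" using anc_trans[of "par y" y z] z par by simp
      then show False using anc_dep[of "par y" y] dep_par[of y] par by simp
    qed
    then have "f (par y) = f y" using par by (simp add: tops_def)
    then show ?thesis using par z by simp
  qed (use par in simp)
qed auto

lemma desc_apex: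
  assumes cc: "connected_classes f" and v: "v \<in> V"
  shows "desc (apex f v) = cls f v \<union> (\<Union>x\<in>lower f (f v). desc x)" (is "?l = ?r")
proof
  have par_in: "par x \<in> V \<and> f (par x) = f v \<and> x \<in> V \<and> x \<noteq> r" if "x \<in> lower f (f v)" for x
    using that rp_snoc by (auto simp: lower_def tops_def)
  have "w \<in> ?r" if "w \<in> V" "apex f v \<in> set (rp w)" for w
    using that
  proof (induction rule: tree_induct)
    case root
    then show ?case using apex[OF cc v] root by (auto simp: cls_def)
  next
    case (par w)
    show ?case
    proof (cases "w = apex f v \<or> f w = f v")
      case True
      then show ?thesis using par apex[OF cc v] by (auto simp: cls_def)
    next
      case False
      then have "apex f v \<in> set (rp (par w))" using par.prems par.hyps by (auto simp: set_rp_par)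
      then have "par w \<in> ?r" by (rule par.IH)
      then show ?thesis
      proof
        assume "par w \<in> cls f v"
        then have "w \<in> lower f (f v)" using False par by (auto simp: lower_def tops_def cls_def)
        moreover have "w \<in> desc w" using par self_in_rp by (simp add: mem_desc)
        ultimately show ?thesis by blast
      next
        assume "par w \<in> (\<Union>x\<in>lower f (f v). desc x)"
        then show ?thesis using par by (auto simp: mem_desc set_rp_par)
      qed
    qed
  qed
  then show "?l \<subseteq> ?r" unfolding subset_iff mem_desc[of _ "apex f v"] by blast
  have c: "w \<in> ?l" if "w \<in> V" "f w = f v" for w
    using apex(3)[OF cc that(1)] apex_cong[of f w v] that by (simp add: mem_desc)
  have "w \<in> ?l" if "x \<in> lower f (f v)" "w \<in> desc x" for x w
  proof -
    have "par x \<in> ?l" using par_in[OF that(1)] c by blast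
    then have "apex f v \<in> set (rp x)" using par_in[OF that(1)] by (simp add: mem_desc set_rp_par)
    then show ?thesis using that anc_trans by (auto simp: mem_desc)
  qed
  then show "?r \<subseteq> ?l" using c by (auto simp: cls_def)
qed

text \<open>Subtrees below distinct \<open>lower\<close> vertices are disjoint: if one contained
  another, it would contain the parent of the latter, a member of the class, against
  convexity.\<close>

lemma sum_desc_apex:
  fixes wt :: "node \<Rightarrow> nat"
  assumes cc: "connected_classes f" and v: "v \<in> V"
  shows "sum wt (desc (apex f v)) = sum wt (cls f v) + (\<Sum>x\<in>lower f (f v). sum wt (desc x))"
proof -
  have par_in: "par x \<in> V \<and> f (par x) = f v \<and> x \<in> V \<and> x \<noteq> r \<and> f x \<noteq> f v"
    if "x \<in> lower f (f v)" for x
    using that rp_snoc by (auto simp: lower_def tops_def)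
  have out: "f y \<noteq> f v" if "x \<in> lower f (f v)" "y \<in> desc x" for x y
  proof
    assume y: "f y = f v"
    have "apex f v \<in> set (rp x)" using desc_apex[OF cc v] that(1) par_in[OF that(1)] self_in_rp
      by (auto simp: mem_desc set_eq_iff)
    then have "f x = f v" using anc_in_cls[OF cc v, of y x] that y by (simp add: mem_desc)
    then show False using par_in[OF that(1)] by simp
  qed
  have dis: "desc x \<inter> desc y = {}" if "x \<in> lower f (f v)" "y \<in> lower f (f v)" "x \<noteq> y" for x y
  proof -
    have no: "\<not> x \<in> set (rp y)" if "x \<in> lower f (f v)" "y \<in> lower f (f v)" "x \<noteq> y" for x y
    proof
      assume "x \<in> set (rp y)"
      then have "par y \<in> desc x" using that par_in[OF that(2)] by (auto simp: mem_desc set_rp_par)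
      then show False using out[OF that(1)] par_in[OF that(2)] by blast
    qed
    show ?thesis using no[OF that] no[OF that(2,1)] that(3) anc_linear by (metis disjoint_iff mem_desc)
  qed
  have "cls f v \<inter> (\<Union>x\<in>lower f (f v). desc x) = {}" using out by (auto simp: cls_def)
  then have "sum wt (desc (apex f v)) = sum wt (cls f v) + sum wt (\<Union>x\<in>lower f (f v). desc x)"
    unfolding desc_apex[OF cc v] by (intro sum.union_disjoint) auto
  also have "sum wt (\<Union>x\<in>lower f (f v). desc x) = (\<Sum>x\<in>lower f (f v). sum wt (desc x))"
    using dis by (intro sum.UNION_disjoint) auto
  finally show ?thesis .
qed

text \<open>\<open>side wt u w\<close> is the weight of the component of \<open>u\<close> after deleting the edge \<open>{u, w}\<close>.\<close>

definition side :: "(node \<Rightarrow> nat) \<Rightarrow> node \<Rightarrow> node \<Rightarrow> nat" where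
  "side wt u w = (if u \<noteq> r \<and> par u = w then sum wt (desc u) else sum wt V - sum wt (desc w))"

lemma sum_desc_le: "sum wt (desc u) \<le> (sum wt V :: nat)"
  using sum_mono2[OF finite_V desc_subset, of u wt] by simp

lemma side_opposite:
  assumes "{u, w} \<in> E"
  shows "side wt u w + side wt w u = sum wt V"
proof -
  have "\<not> (u \<noteq> r \<and> w = par u \<and> w \<noteq> r \<and> u = par w)"
    using edge_nodes[OF assms] dep_par[of u] dep_par[of w] by auto
  then show ?thesis using edge_par[OF assms] sum_desc_le[of wt] by (auto simp: side_def)
qed

text \<open>Deleting the boundary edges leaves the class and one component per boundary edge. Thus
  the weight behind one boundary edge follows from those behind the others.\<close>

lemma sum_side_cut:
  assumes cc: "connected_classes f" and v: "v \<in> V"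
  shows "sum wt (cls f v) + (\<Sum>(u, w)\<in>cut E (cls f v). side wt w u) = sum wt V"
proof -
  have l: "side wt x (par x) = sum wt (desc x)" if "x \<in> lower f (f v)" for x
    using that by (auto simp: side_def lower_def)
  have u: "side wt (par x) x = sum wt V - sum wt (desc x)" if "x \<in> V" "x \<noteq> r" for x
  proof -
    have "\<not> (par x \<noteq> r \<and> par (par x) = x)" using par_par_ne that by blast
    then show ?thesis by (auto simp: side_def)
  qed
  have "(\<Sum>x\<in>upper f (f v). side wt (par x) x) = sum wt V - sum wt (desc (apex f v))"
    using u[of "apex f v"] apex(4)[OF cc v] by (auto simp: upper_apex[OF cc v] desc_root insert_Diff_if)
  moreover have "(\<Sum>x\<in>lower f (f v). side wt x (par x)) = (\<Sum>x\<in>lower f (f v). sum wt (desc x))"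
    using l by (intro sum.cong) auto
  ultimately have "(\<Sum>(u, w)\<in>cut E (cls f v). side wt w u) =
      (\<Sum>x\<in>lower f (f v). sum wt (desc x)) + (sum wt V - sum wt (desc (apex f v)))"
    by (simp add: sum_cut_cls[OF v])
  then show ?thesis using sum_desc_apex[OF cc v, of wt] sum_desc_le[of wt "apex f v"] by simp
qed

end

section \<open>Binary messages\<close>

fun val :: "bits \<Rightarrow> nat" where
  "val [] = 0"
| "val (b # bs) = of_bool b + 2 * val bs"

fun enc :: "nat \<Rightarrow> nat \<Rightarrow> bits" where
  "enc 0 n = []"
| "enc (Suc w) n = odd n # enc w (n div 2)"

lemma length_enc [simp]: "length (enc w n) = w"
  by (induction w arbitrary: n) auto

lemma val_enc [simp]: "val (enc w n) = n mod 2 ^ w"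
proof (induction w arbitrary: n)
  case (Suc w)
  have "n mod (2 * 2 ^ w) = 2 * (n div 2 mod 2 ^ w) + n mod 2" by (rule mod_mult2_eq)
  then show ?case using Suc by (simp add: mod_2_eq_odd)
qed simp

text \<open>The final bit makes the encoding injective.\<close>

definition num :: "bits \<Rightarrow> nat" where
  "num v = val (v @ [True])"

lemma num_simps: "num [] = 1" "num (b # bs) = of_bool b + 2 * num bs"
  by (simp_all add: num_def)

text \<open>Positivity lets 0 stand for a missing child and for the end of a list of light
  edges.\<close>

lemma num_pos: "0 < num v"
  by (induction v) (auto simp: num_simps)

lemma num_less: "num v < 2 ^ Suc (length v)"
  by (induction v) (auto simp: num_simps)

lemma num_inj: "num u = num v \<Longrightarrow> u = v"
proof (induction u arbitrary: v)
  case Nil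
  show ?case
  proof (cases v)
    case (Cons b v')
    then show ?thesis using Nil num_pos[of v'] by (simp add: num_simps)
  qed simp
next
  case (Cons a u)
  show ?case
  proof (cases v)
    case Nil
    then show ?thesis using Cons.prems num_pos[of u] by (auto simp: num_simps)
  next
    case (Cons b v')
    with Cons.prems have e: "of_bool a + 2 * num u = of_bool b + 2 * num v'" by (simp add: num_simps)
    have "a = b" using arg_cong[OF e, of even] by auto
    then show ?thesis using e Cons Cons.IH by simp
  qed
qed

lemma inj_num: "inj num" using num_inj by (rule injI)

text \<open>On operands of equal width this is addition modulo a power of two, independent of the
  order. On operands of different widths the length of the result is a maximum, which the
  preliminary round exploits.\<close>

definition sum_op :: "bits \<Rightarrow> bits \<Rightarrow> bits" where
  "sum_op x y = enc (max (length x) (length y)) (val x + val y)"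

text \<open>An algorithm has one aggregation operator for all rounds; the leading bit of the
  messages selects maximum or sum.\<close>

fun agg_op :: "bits \<Rightarrow> bits \<Rightarrow> bits" where
  "agg_op (True # x) (True # y) = True # (if val x \<le> val y then y else x)"
| "agg_op (False # x) (False # y) = False # sum_op x y"
| "agg_op _ _ = []"

lemma aggregation_operator_sum_op: "aggregation_operator B sum_op"
  by (simp add: aggregation_operator_def sum_op_def)

lemma aggregation_operator_agg_op: "aggregation_operator B agg_op"
proof -
  have "length (agg_op x y) \<le> max (length x) (length y)" for x y
    by (induction x y rule: agg_op.induct) (auto simp: sum_op_def)
  then show ?thesis unfolding aggregation_operator_def by (meson max.boundedI order_trans)
qed

lemma aggregates_sum_op_length:
  "aggregates sum_op M y \<Longrightarrow>
     length y \<in> length ` set_mset M \<and> (\<forall>x\<in>#M. length x \<le> length y)"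
proof (induction rule: aggregates.induct)
  case (combine M x N y)
  then show ?case by (auto simp: sum_op_def max_def)
qed simp

lemma aggregates_sum_op:
  "aggregates sum_op M y \<Longrightarrow> \<forall>x\<in>#M. length x = w \<Longrightarrow>
     length y = w \<and> val y = (\<Sum>x\<in>#M. val x) mod 2 ^ w"
proof (induction rule: aggregates.induct)
  case (single x)
  have "val x < 2 ^ length x" by (induction x) auto
  then show ?case using single by simp
next
  case (combine M x N y)
  then show ?case by (simp add: sum_op_def mod_add_eq)
qed

lemma aggregates_agg_op_sum:
  "aggregates agg_op M y \<Longrightarrow> \<forall>x\<in>#M. \<exists>a. x = False # a \<and> length a = w \<Longrightarrow>
     \<exists>b. y = False # b \<and> length b = w \<and> val b = (\<Sum>x\<in>#M. val (tl x)) mod 2 ^ w"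
proof (induction rule: aggregates.induct)
  case (single x)
  have "val x < 2 ^ length x" for x by (induction x) auto
  then show ?case using single by force
next
  case (combine M x N y)
  then obtain a b where "x = False # a" "length a = w" "val a = (\<Sum>x\<in>#M. val (tl x)) mod 2 ^ w"
    "y = False # b" "length b = w" "val b = (\<Sum>x\<in>#N. val (tl x)) mod 2 ^ w" by auto
  then show ?case by (simp add: sum_op_def mod_add_eq)
qed

lemma aggregates_agg_op_max:
  "aggregates agg_op M y \<Longrightarrow> \<forall>x\<in>#M. \<exists>a. x = True # a \<Longrightarrow>
     y \<in># M \<and> (\<forall>x\<in>#M. val (tl x) \<le> val (tl y))"
proof (induction rule: aggregates.induct)
  case (combine M x N y)
  then have IH: "x \<in># M" "\<forall>z\<in>#M. val (tl z) \<le> val (tl x)" "y \<in># N" "\<forall>z\<in>#N. val (tl z) \<le> val (tl y)"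
    by auto
  then obtain a b where "x = True # a" "y = True # b" using combine.prems by (metis union_iff)
  then show ?case using IH by auto
qed simp

section \<open>Staged algorithms\<close>

text \<open>After a first round, in which all nodes learn the maximal length \<open>l\<close> of an ID, an algorithm
  proceeds in stages of two rounds. In the first round of a stage nothing is contracted, and every
  node announces a number to its incident edges. In the second round, the edges decide from the
  announcements so far whether to be contracted and which numbers to deliver, and nodes learn the sum
  of the contributions in their supernode and the sum (or maximum) of the numbers delivered to it.\<close>

definition trunc :: "nat \<Rightarrow> (nat \<Rightarrow> nat) \<Rightarrow> nat \<Rightarrow> nat" where
  "trunc k f j = (if j < k then f j else 0)"

lemma trunc_less [simp]: "j < k \<Longrightarrow> trunc k f j = f j"
  by (simp add: trunc_def)

lemma trunc_cong: "(\<And>j. j < k \<Longrightarrow> f j = g j) \<Longrightarrow> trunc k f = trunc k g"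
  by (auto simp: trunc_def fun_eq_iff)

text \<open>Four digits to the base \<open>2 ^ (l + 1)\<close>. The largest aggregate packs a
  degree, a number of candidates and a sum of labels, where the sum takes up to two digits.\<close>

definition width :: "nat \<Rightarrow> nat" where
  "width l = 4 * (l + 1)"

text \<open>Round 0 is preliminary; stage \<open>j\<close> consists of round
  \<open>1 + 2 * j\<close>, with the announcement, and round \<open>2 + 2 * j\<close>.\<close>

definition heard_sum :: "(msg \<times> msg option) list \<Rightarrow> nat \<Rightarrow> nat" where
  "heard_sum h j = val (fst (h ! (2 + 2 * j)))"

definition agg_val :: "msg option \<Rightarrow> nat" where
  "agg_val z = (case z of None \<Rightarrow> 0 | Some m \<Rightarrow> val (tl m))"

definition heard_agg :: "(msg \<times> msg option) list \<Rightarrow> nat \<Rightarrow> nat" where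
  "heard_agg h j = agg_val (snd (h ! (2 + 2 * j)))"

definition heard_ann :: "msg option list \<Rightarrow> nat \<Rightarrow> nat" where
  "heard_ann h j = val (the (h ! (1 + 2 * j)))"

locale staged_program =
  fixes stages :: "nat \<Rightarrow> nat"
    and announce contrib :: "nat \<Rightarrow> nat \<Rightarrow> node \<Rightarrow> 'i \<Rightarrow> (nat \<Rightarrow> nat) \<Rightarrow> (nat \<Rightarrow> nat) \<Rightarrow> nat"
    and join :: "nat \<Rightarrow> nat \<Rightarrow> node \<Rightarrow> (nat \<Rightarrow> nat) \<Rightarrow> node \<Rightarrow> (nat \<Rightarrow> nat) \<Rightarrow> bool"
    and deliver :: "nat \<Rightarrow> nat \<Rightarrow> node \<Rightarrow> (nat \<Rightarrow> nat) \<Rightarrow> node \<Rightarrow> (nat \<Rightarrow> nat) \<Rightarrow> nat"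
    and max_stage :: "nat \<Rightarrow> nat \<Rightarrow> bool"
    and result :: "nat \<Rightarrow> node \<Rightarrow> 'i \<Rightarrow> (nat \<Rightarrow> nat) \<Rightarrow> (nat \<Rightarrow> nat) \<Rightarrow> 'o"
begin

text \<open>The length of the history is the number of the current round. In round 0 only the length
  of the message matters. \<open>trunc\<close> presents the history as a total function that reveals
  nothing beyond the stages completed.\<close>

definition node_msg :: "'i node_view \<Rightarrow> msg" where
  "node_msg = (\<lambda>(v, i, h).
     if h = [] then replicate (length v) False
     else let l = length (fst (h ! 0)); k = (length h - 1) div 2 in
       enc (width l) ((if odd (length h) then announce else contrib) l k v i
         (trunc k (heard_sum h)) (trunc k (heard_agg h))))"

text \<open>An empty history means round 0, where every edge is contracted. An edge therefore hears
  its first value in round 1 and recovers \<open>l\<close> from the length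
  \<open>4 * (l + 1)\<close> of that value.\<close>

definition edge_contract :: "edge_view \<Rightarrow> bool" where
  "edge_contract view \<longleftrightarrow> (\<exists>(u, h)\<in>view. \<exists>(w, h')\<in>view. u \<noteq> w \<and>
     (h = [] \<or> even (length h) \<and>
       (let l = length (the (h ! 1)) div 4 - 1; k = length h div 2 - 1 in
         join l k u (trunc (Suc k) (heard_ann h)) w (trunc (Suc k) (heard_ann h')))))"

text \<open>The consensus value of the current round is already part of the history, so round
  \<open>2 + 2 * k\<close> shows as length \<open>3 + 2 * k\<close>. The description operator
  extracts the two ends from the unordered view.\<close>

definition edge_msg :: "edge_view \<Rightarrow> node \<Rightarrow> msg" where
  "edge_msg view u = (THE m. \<exists>h w h'. (u, h) \<in> view \<and> (w, h') \<in> view \<and> w \<noteq> u \<and> m =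
     (if even (length h) \<or> length h = 1 then []
      else let l = length (the (h ! 1)) div 4 - 1; k = (length h - 3) div 2 in
        max_stage l k # enc (width l)
          (deliver l k u (trunc (Suc k) (heard_ann h)) w (trunc (Suc k) (heard_ann h')))))"

lemma edge_msg_pair:
  assumes "u \<noteq> w"
  shows "edge_msg {(u, h), (w, h')} u =
     (if even (length h) \<or> length h = 1 then []
      else let l = length (the (h ! 1)) div 4 - 1; k = (length h - 3) div 2 in
        max_stage l k # enc (width l)
          (deliver l k u (trunc (Suc k) (heard_ann h)) w (trunc (Suc k) (heard_ann h'))))"
  unfolding edge_msg_def by (rule the_equality) (use assms in blast)+

definition node_result :: "'i node_view \<Rightarrow> 'o option" where
  "node_result = (\<lambda>(v, i, h). let l = length (fst (h ! 0)) in
     if h \<noteq> [] \<and> length h = 1 + 2 * stages l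
     then Some (result l v i (trunc (stages l) (heard_sum h)) (trunc (stages l) (heard_agg h)))
     else None)"

definition algorithm :: "('i, 'o) ma_algorithm" where
  "algorithm = \<lparr>consensus_op = sum_op, aggregation_op = agg_op, contract = edge_contract,
     node_value = node_msg, edge_value = edge_msg, node_output = node_result\<rparr>"

end

section \<open>Knowledge of nodes and edges during an execution\<close>

locale staged_execution = staged_program stages announce contrib join deliver max_stage result +
    rooted_tree V E r
  for stages announce contrib join deliver max_stage
    and result :: "nat \<Rightarrow> node \<Rightarrow> 'i \<Rightarrow> (nat \<Rightarrow> nat) \<Rightarrow> (nat \<Rightarrow> nat) \<Rightarrow> 'o"
    and V E r +
  fixes inp :: "node \<Rightarrow> 'i" and c :: "nat \<Rightarrow> config"
  assumes exec: "execution algorithm V E inp c"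
begin

abbreviation "F t \<equiv> contracted algorithm E (c t)"

text \<open>\<open>ma_round\<close> only asserts that suitable values exist for each supernode;
  reading them back from the histories turns them into functions of round and node.\<close>

definition y :: "nat \<Rightarrow> node \<Rightarrow> msg" where "y t v = fst (node_hist (c (Suc t)) v ! t)"
definition z :: "nat \<Rightarrow> node \<Rightarrow> msg option" where "z t v = snd (node_hist (c (Suc t)) v ! t)"

lemma F_subset: "F t \<subseteq> E" by (auto simp: contracted_def)

lemma supernode_eq: assumes "u \<in> supernode X v" shows "supernode X u = supernode X v"
proof -
  let ?R = "{(a, b). {a, b} \<in> X}"
  have "sym (?R\<^sup>*)" by (rule sym_rtrancl, rule symI) (simp add: insert_commute)
  moreover have "(v, u) \<in> ?R\<^sup>*" using assms by (simp add: supernode_def)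
  ultimately have "(v, u) \<in> ?R\<^sup>*" "(u, v) \<in> ?R\<^sup>*" by (auto dest: symD)
  then show ?thesis unfolding supernode_def by (auto intro: rtrancl_trans)
qed

lemma history:
  "(\<forall>v\<in>V. node_hist (c t) v = map (\<lambda>j. (y j v, z j v)) [0..<t]) \<and>
   (\<forall>e\<in>E. \<forall>v\<in>e. edge_hist (c t) e v =
      map (\<lambda>j. if e \<in> minor_edges V E (F j) then Some (y j v) else None) [0..<t])"
proof (induction t)
  case 0
  then show ?case using exec by (simp add: execution_def init_config_def)
next
  case (Suc t)
  have "ma_round algorithm V E inp (c t) (c (Suc t))" using exec by (simp add: execution_def)
  then obtain y' z' where
    e: "\<forall>e\<in>E. \<forall>v\<in>e. edge_hist (c (Suc t)) e v = edge_hist (c t) e v @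
          [if e \<in> minor_edges V E (F t) then Some (y' (supernode (F t) v)) else None]" and
    n: "\<forall>v\<in>V. node_hist (c (Suc t)) v = node_hist (c t) v @
          [(y' (supernode (F t) v), z' (supernode (F t) v))]"
    unfolding ma_round_def Let_def by blast
  have yz: "y' (supernode (F t) v) = y t v \<and> z' (supernode (F t) v) = z t v" if "v \<in> V" for v
    using n that Suc by (simp add: y_def z_def nth_append)
  show ?case
  proof (intro conjI ballI)
    fix v assume "v \<in> V"
    then show "node_hist (c (Suc t)) v = map (\<lambda>j. (y j v, z j v)) [0..<Suc t]"
      using n Suc yz by simp
  next
    fix e v assume e_v: "e \<in> E" "v \<in> e"
    then have "v \<in> V" using edge_cases by blast
    then show "edge_hist (c (Suc t)) e v =
      map (\<lambda>j. if e \<in> minor_edges V E (F j) then Some (y j v) else None) [0..<Suc t]"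
      using e e_v Suc yz by simp
  qed
qed

lemmas node_history = history[THEN conjunct1, rule_format]
lemmas edge_history = history[THEN conjunct2, rule_format]

lemma round:
  assumes "v \<in> V"
  shows "aggregates sum_op
      (image_mset (\<lambda>u. node_msg (u, inp u, node_hist (c t) u)) (mset_set (supernode (F t) v))) (y t v)"
    and "aggregates_opt agg_op
      (image_mset (\<lambda>e. edge_msg (edge_view (c (Suc t)) e) (the_elem (e \<inter> supernode (F t) v)))
         (mset_set (incident_edges V E (F t) (supernode (F t) v)))) (z t v)"
proof -
  have "ma_round algorithm V E inp (c t) (c (Suc t))" using exec by (simp add: execution_def)
  then obtain y' z' where
    a: "\<forall>s\<in>supernodes V (F t). aggregates sum_op
             (image_mset (\<lambda>v. node_msg (v, inp v, node_hist (c t) v)) (mset_set s)) (y' s)" and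
    b: "\<forall>s\<in>supernodes V (F t). aggregates_opt agg_op
             (image_mset (\<lambda>e. edge_msg (edge_view (c (Suc t)) e) (the_elem (e \<inter> s)))
                (mset_set (incident_edges V E (F t) s))) (z' s)" and
    n: "\<forall>v\<in>V. node_hist (c (Suc t)) v = node_hist (c t) v @
          [(y' (supernode (F t) v), z' (supernode (F t) v))]"
    unfolding ma_round_def Let_def by (auto simp: algorithm_def node_view_def)
  have s: "supernode (F t) v \<in> supernodes V (F t)" using assms by (simp add: supernodes_def)
  have "y' (supernode (F t) v) = y t v \<and> z' (supernode (F t) v) = z t v"
    using n assms node_history[of v t] by (simp add: y_def z_def nth_append)
  then show "aggregates sum_op
      (image_mset (\<lambda>u. node_msg (u, inp u, node_hist (c t) u)) (mset_set (supernode (F t) v))) (y t v)"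
    "aggregates_opt agg_op
      (image_mset (\<lambda>e. edge_msg (edge_view (c (Suc t)) e) (the_elem (e \<inter> supernode (F t) v)))
         (mset_set (incident_edges V E (F t) (supernode (F t) v)))) (z t v)"
    using a[rule_format, OF s] b[rule_format, OF s] by simp_all
qed

lemma edge_view_eq: "edge_view (c t) {u, w} = {(u, edge_hist (c t) {u, w} u), (w, edge_hist (c t) {u, w} w)}"
  by (simp add: edge_view_def)

lemma F_iff:
  assumes "{u, w} \<in> E"
  shows "{u, w} \<in> F t \<longleftrightarrow> edge_contract {(u, edge_hist (c t) {u, w} u), (w, edge_hist (c t) {u, w} w)}"
  using assms by (simp add: contracted_def algorithm_def edge_view_eq)

lemma length_edge_hist [simp]: "e \<in> E \<Longrightarrow> v \<in> e \<Longrightarrow> length (edge_hist (c t) e v) = t"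
  by (simp add: edge_history)

lemma F_0: "F 0 = E"
proof -
  have "{u, w} \<in> F 0" if "{u, w} \<in> E" for u w
  proof -
    have "edge_hist (c 0) {u, w} u = []" using edge_history[OF that, of u 0] by simp
    moreover have "u \<noteq> w" using edge_nodes that by blast
    ultimately show ?thesis using F_iff[OF that] by (auto simp: edge_contract_def)
  qed
  then show ?thesis using F_subset[of 0] edge_cases by blast
qed

lemma F_odd: "odd t \<Longrightarrow> F t = {}"
proof (rule ccontr)
  assume t: "odd t" and "F t \<noteq> {}"
  then obtain u w where e: "{u, w} \<in> F t" "{u, w} \<in> E" using F_subset edge_cases by blast
  have "edge_hist (c t) {u, w} x \<noteq> []" if "x \<in> {u, w}" for x
    using length_edge_hist[OF e(2) that, of t] t by (cases t) auto
  then show False using e F_iff[OF e(2)] t by (auto simp: edge_contract_def Let_def)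
qed

lemma supernode_empty: "supernode {} v = {v}"
  by (simp add: supernode_def)

definition lv :: nat where "lv = Max (length ` V)"

text \<open>In round 0 all nodes form one supernode, and \<open>sum_op\<close> keeps the greatest
  length among its operands.\<close>

lemma length_y_0: "v \<in> V \<Longrightarrow> length (y 0 v) = lv"
proof -
  assume v: "v \<in> V"
  have cc: "connected_classes (\<lambda>_. ())" by (auto simp: connected_classes_def tops_def inj_on_def)
  have "inner E (\<lambda>_. ()) = E" by (auto simp: inner_def)
  then have s: "supernode (F 0) v = V" using supernode_inner[OF cc v] by (simp add: F_0 cls_def)
  let ?M = "image_mset (\<lambda>u. node_msg (u, inp u, node_hist (c 0) u)) (mset_set V)"
  have M: "?M = image_mset (\<lambda>u. replicate (length u) False) (mset_set V)"
    by (rule image_mset_cong) (use finite_V node_history[of _ 0] in \<open>auto simp: node_msg_def\<close>)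
  have "aggregates sum_op ?M (y 0 v)" using round(1)[OF v, of 0] s by simp
  from aggregates_sum_op_length[OF this[unfolded M]] have
    "length (y 0 v) \<in> length ` V" "\<forall>u\<in>V. length u \<le> length (y 0 v)"
    using finite_V by (auto simp: image_iff)
  then show ?thesis unfolding lv_def using finite_V by (intro Max_eqI[symmetric]) auto
qed

definition ys :: "node \<Rightarrow> nat \<Rightarrow> nat" where "ys v k = val (y (2 + 2 * k) v)"
definition zs :: "node \<Rightarrow> nat \<Rightarrow> nat" where "zs v k = agg_val (z (2 + 2 * k) v)"

definition ann :: "node \<Rightarrow> nat \<Rightarrow> nat" where
  "ann v k = announce lv k v (inp v) (trunc k (ys v)) (trunc k (zs v)) mod 2 ^ width lv"

lemma node_msg_eq:
  assumes "v \<in> V" "0 < t"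
  shows "node_msg (v, inp v, node_hist (c t) v) =
    enc (width lv) ((if odd t then announce else contrib) lv ((t - 1) div 2) v (inp v)
         (trunc ((t - 1) div 2) (ys v)) (trunc ((t - 1) div 2) (zs v)))"
proof -
  let ?h = "map (\<lambda>j. (y j v, z j v)) [0..<t]"
  have "trunc ((t - 1) div 2) (heard_sum ?h) = trunc ((t - 1) div 2) (ys v)"
    "trunc ((t - 1) div 2) (heard_agg ?h) = trunc ((t - 1) div 2) (zs v)"
    by (auto intro!: trunc_cong simp: heard_sum_def heard_agg_def ys_def zs_def)
  moreover have "length (fst (?h ! 0)) = lv" using assms length_y_0 by simp
  ultimately show ?thesis unfolding node_msg_def node_history[OF assms(1)] using assms by (simp add: Let_def)
qed

lemma y_odd: assumes "v \<in> V" shows "length (y (1 + 2 * k) v) = width lv" "val (y (1 + 2 * k) v) = ann v k"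
proof -
  have "aggregates sum_op {#node_msg (v, inp v, node_hist (c (1 + 2 * k)) v)#} (y (1 + 2 * k) v)"
    using round(1)[OF assms, of "1 + 2 * k"] F_odd[of "1 + 2 * k"] by (simp add: supernode_empty)
  from aggregates_sum_op[OF this, of "width lv"]
  show "length (y (1 + 2 * k) v) = width lv" "val (y (1 + 2 * k) v) = ann v k"
    using node_msg_eq[OF assms, of "1 + 2 * k"] by (simp_all add: ann_def)
qed

lemma minor_odd: "odd t \<Longrightarrow> minor_edges V E (F t) = E"
proof -
  assume "odd t"
  then have F: "F t = {}" by (rule F_odd)
  have "\<not> e \<subseteq> {v}" if "e \<in> E" for e v using edge_cases[OF that] by auto
  then show ?thesis unfolding F minor_edges_def supernodes_def supernode_empty by blast
qed

lemma edge_hist_odd: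
  assumes "e \<in> E" "v \<in> e" "1 + 2 * k < t"
  shows "edge_hist (c t) e v ! (1 + 2 * k) = Some (y (1 + 2 * k) v)"
  using assms minor_odd[of "1 + 2 * k"] by (simp add: edge_history)

lemma heard_ann_eq:
  assumes "e \<in> E" "v \<in> e" "2 * k < t"
  shows "trunc k (heard_ann (edge_hist (c t) e v)) = trunc k (ann v)"
proof (rule trunc_cong)
  fix j assume "j < k"
  moreover have "v \<in> V" using assms edge_cases by blast
  ultimately show "heard_ann (edge_hist (c t) e v) j = ann v j"
    using edge_hist_odd[OF assms(1,2), of j t] y_odd(2)[of v j] assms(3) by (simp add: heard_ann_def)
qed

lemma edge_level:
  assumes "e \<in> E" "v \<in> e" "1 < t"
  shows "length (the (edge_hist (c t) e v ! 1)) div 4 - 1 = lv"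
proof -
  have "v \<in> V" using assms edge_cases by blast
  then show ?thesis using edge_hist_odd[OF assms(1,2), of 0 t] y_odd(1)[of v 0] assms(3) by (simp add: width_def)
qed

definition joined :: "nat \<Rightarrow> edge set" where
  "joined k = {e \<in> E. \<exists>u w. e = {u, w} \<and>
     join lv k u (trunc (Suc k) (ann u)) w (trunc (Suc k) (ann w))}"

lemma F_even: "F (2 + 2 * k) = joined k"
proof (rule set_eqI)
  fix e
  show "e \<in> F (2 + 2 * k) \<longleftrightarrow> e \<in> joined k"
  proof (cases "e \<in> E")
    case True
    then obtain u w where e: "e = {u, w}" "u \<noteq> w" using edge_cases by blast
    let ?h = "edge_hist (c (2 + 2 * k)) e"
    have ne: "?h x \<noteq> []" if "x \<in> e" for x using length_edge_hist[OF True that, of "2 + 2 * k"] by auto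
    have tr: "trunc (Suc k) (heard_ann (?h x)) = trunc (Suc k) (ann x)"
      "length (the (?h x ! 1)) div 4 - 1 = lv" "length (?h x) = 2 + 2 * k" if "x \<in> e" for x
      subgoal proof -
        have "heard_ann (?h x) j = ann x j" if "j < Suc k" for j
          using edge_hist_odd[OF True \<open>x \<in> e\<close>, of j "2 + 2 * k"] y_odd(2)[of x j] that \<open>x \<in> e\<close> edge_cases[OF True]
          by (auto simp: heard_ann_def)
        then show ?thesis by (rule trunc_cong)
      qed
      using edge_level[OF True that, of "2 + 2 * k"] length_edge_hist[OF True that] by auto
    show ?thesis
      using F_iff[of u w "2 + 2 * k"] True e ne tr
      by (auto simp: edge_contract_def joined_def Let_def doubleton_eq_iff)
  qed (use F_subset in \<open>auto simp: joined_def\<close>)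
qed

lemma edge_msg_eq:
  assumes "{u, w} \<in> E" "even t" "0 < t"
  shows "edge_msg (edge_view (c (Suc t)) {u, w}) u =
    max_stage lv (t div 2 - 1) # enc (width lv) (deliver lv (t div 2 - 1) u
      (trunc (t div 2) (ann u)) w (trunc (t div 2) (ann w)))"
proof -
  obtain k where t: "t = 2 + 2 * k"
  proof -
    obtain j where "t = 2 * j" using assms(2) by (rule evenE)
    then have "t = 2 + 2 * (j - 1)" using assms(3) by simp
    then show ?thesis by (rule that)
  qed
  have uw: "u \<noteq> w" using edge_nodes assms by blast
  let ?h = "edge_hist (c (Suc t)) {u, w}"
  have tr: "trunc (Suc k) (heard_ann (?h x)) = trunc (Suc k) (ann x)" if "x \<in> {u, w}" for x
    using heard_ann_eq[OF assms(1) that, of "Suc k" "Suc t"] t by simp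
  have lev: "length (the (?h x ! 1)) div 4 - 1 = lv" if "x \<in> {u, w}" for x
    using edge_level[OF assms(1) that, of "Suc t"] t by simp
  have "length (?h u) = Suc t" using length_edge_hist[OF assms(1)] by simp
  then show ?thesis
    unfolding edge_view_eq edge_msg_pair[OF uw] using tr lev t by (simp add: Let_def)
qed

lemma edge_msg_odd:
  assumes "{u, w} \<in> E" "odd t \<or> t = 0"
  shows "edge_msg (edge_view (c (Suc t)) {u, w}) u = []"
proof -
  have uw: "u \<noteq> w" using edge_nodes assms by blast
  have "length (edge_hist (c (Suc t)) {u, w} u) = Suc t" using length_edge_hist[OF assms(1)] by simp
  then show ?thesis unfolding edge_view_eq edge_msg_pair[OF uw] using assms(2) by auto
qed

lemma ys_eq:
  assumes "v \<in> V"
  shows "ys v k = (\<Sum>u\<in>supernode (joined k) v.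
    contrib lv k u (inp u) (trunc k (ys u)) (trunc k (zs u))) mod 2 ^ width lv"
proof -
  let ?s = "supernode (joined k) v" and ?t = "2 + 2 * k"
  let ?g = "\<lambda>u. contrib lv k u (inp u) (trunc k (ys u)) (trunc k (zs u))"
  have sub: "?s \<subseteq> V" using supernode_subset[OF graph F_subset assms, of ?t] by (simp only: F_even)
  then have fin: "finite ?s" using finite_V finite_subset by blast
  have "aggregates sum_op (image_mset (\<lambda>u. node_msg (u, inp u, node_hist (c ?t) u)) (mset_set ?s)) (y ?t v)"
    using round(1)[OF assms, of ?t] by (simp only: F_even)
  moreover have "image_mset (\<lambda>u. node_msg (u, inp u, node_hist (c ?t) u)) (mset_set ?s) =
      image_mset (\<lambda>u. enc (width lv) (?g u)) (mset_set ?s)"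
    using fin sub node_msg_eq[of _ ?t] by (intro image_mset_cong) auto
  ultimately have "aggregates sum_op (image_mset (\<lambda>u. enc (width lv) (?g u)) (mset_set ?s)) (y ?t v)"
    by simp
  from aggregates_sum_op[OF this, of "width lv"]
  have "ys v k = (\<Sum>u\<in>?s. ?g u mod 2 ^ width lv) mod 2 ^ width lv"
    using fin by (simp add: ys_def sum_unfold_sum_mset image_mset.compositionality comp_def)
  then show ?thesis by (simp add: mod_sum_eq)
qed

text \<open>An edge of the minor has its ends in different supernodes, so exactly one end lies in
  the given one and the outward orientation is unambiguous.\<close>

lemma incident_cut:
  assumes "v \<in> V" "X \<subseteq> E"
  shows "bij_betw (\<lambda>(u, w). {u, w}) (cut E (supernode X v)) (incident_edges V E X (supernode X v))"
  unfolding bij_betw_def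
proof
  let ?s = "supernode X v"
  show "inj_on (\<lambda>(u, w). {u, w}) (cut E ?s)"
    by (auto simp: inj_on_def cut_def doubleton_eq_iff)
  show "(\<lambda>(u, w). {u, w}) ` cut E ?s = incident_edges V E X ?s"
  proof (intro set_eqI iffI)
    fix e assume "e \<in> (\<lambda>(u, w). {u, w}) ` cut E ?s"
    then obtain u w where e: "e = {u, w}" "u \<in> ?s" "w \<notin> ?s" "{u, w} \<in> E" by (auto simp: cut_def)
    have "\<not> e \<subseteq> s" if sV: "s \<in> supernodes V X" for s
    proof
      assume es: "e \<subseteq> s"
      obtain x where x: "s = supernode X x" using sV by (auto simp: supernodes_def)
      have "supernode X u = s" using supernode_eq[of u X x] es e x by blast
      moreover have "supernode X u = ?s" using e(2) by (rule supernode_eq)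
      ultimately show False using es e by simp
    qed
    then show "e \<in> incident_edges V E X ?s" using e by (auto simp: incident_edges_def minor_edges_def)
  next
    fix e assume "e \<in> incident_edges V E X ?s"
    then have e: "e \<in> E" "e \<inter> ?s \<noteq> {}" "\<not> e \<subseteq> ?s"
      using assms by (auto simp: incident_edges_def minor_edges_def supernodes_def)
    obtain a b where ab: "e = {a, b}" using edge_cases e by blast
    show "e \<in> (\<lambda>(u, w). {u, w}) ` cut E ?s"
    proof (cases "a \<in> ?s")
      case True
      then have "(a, b) \<in> cut E ?s" using e ab by (auto simp: cut_def)
      then show ?thesis unfolding ab by (intro image_eqI[of _ _ "(a, b)"]) simp_all
    next
      case False
      then have "(b, a) \<in> cut E ?s" using e ab by (auto simp: cut_def insert_commute)
      then show ?thesis unfolding ab by (intro image_eqI[of _ _ "(b, a)"]) (auto simp: doubleton_eq_iff)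
    qed
  qed
qed

abbreviation delivered :: "nat \<Rightarrow> node \<times> node \<Rightarrow> nat" where
  "delivered k \<equiv> \<lambda>(u, w). deliver lv k u (trunc (Suc k) (ann u)) w (trunc (Suc k) (ann w))"

lemma zs_aggregates:
  assumes "v \<in> V"
  shows "aggregates_opt agg_op (image_mset (\<lambda>p. max_stage lv k # enc (width lv) (delivered k p))
    (mset_set (cut E (supernode (joined k) v)))) (z (2 + 2 * k) v)"
proof -
  let ?s = "supernode (joined k) v" and ?t = "2 + 2 * k"
  let ?m = "\<lambda>e. edge_msg (edge_view (c (Suc ?t)) e) (the_elem (e \<inter> ?s))"
  have bij: "bij_betw (\<lambda>(u, w). {u, w}) (cut E ?s) (incident_edges V E (joined k) ?s)"
    using incident_cut[OF assms F_subset, of ?t] by (simp only: F_even)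
  have "image_mset ?m (mset_set (incident_edges V E (joined k) ?s)) =
      image_mset (\<lambda>p. ?m (case p of (u, w) \<Rightarrow> {u, w})) (mset_set (cut E ?s))"
  proof -
    have "mset_set (incident_edges V E (joined k) ?s) =
        image_mset (\<lambda>(u, w). {u, w}) (mset_set (cut E ?s))"
      using bij by (simp add: bij_betw_def image_mset_mset_set)
    then show ?thesis by (simp only: image_mset.compositionality comp_def)
  qed
  also have "\<dots> = image_mset (\<lambda>p. max_stage lv k # enc (width lv) (delivered k p)) (mset_set (cut E ?s))"
  proof (rule image_mset_cong)
    fix p assume "p \<in># mset_set (cut E ?s)"
    then obtain u w where p: "p = (u, w)" "u \<in> ?s" "w \<notin> ?s" "{u, w} \<in> E"
      using finite_cut by (auto simp: cut_def)
    then have "{u, w} \<inter> ?s = {u}" by auto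
    then show "?m (case p of (u, w) \<Rightarrow> {u, w}) = max_stage lv k # enc (width lv) (delivered k p)"
      using p edge_msg_eq[OF p(4), of ?t] by simp
  qed
  finally show ?thesis using round(2)[OF assms, of ?t] by (simp only: F_even)
qed

lemma zs_sum:
  assumes "v \<in> V" "\<not> max_stage lv k"
  shows "zs v k = (\<Sum>p\<in>cut E (supernode (joined k) v). delivered k p) mod 2 ^ width lv"
proof (cases "cut E (supernode (joined k) v) = {}")
  case True
  then show ?thesis using zs_aggregates[OF assms(1), of k] by (simp add: aggregates_opt_def zs_def agg_val_def)
next
  case False
  let ?C = "cut E (supernode (joined k) v)"
  let ?M = "image_mset (\<lambda>p. max_stage lv k # enc (width lv) (delivered k p)) (mset_set ?C)"
  have "?M \<noteq> {#}" using False finite_cut by (simp add: mset_set_empty_iff)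
  then obtain m where m: "z (2 + 2 * k) v = Some m" "aggregates agg_op ?M m"
    using zs_aggregates[OF assms(1), of k] by (auto simp: aggregates_opt_def)
  have "\<exists>b. m = False # b \<and> length b = width lv \<and> val b = (\<Sum>x\<in>#?M. val (tl x)) mod 2 ^ width lv"
    by (rule aggregates_agg_op_sum[OF m(2)]) (use assms(2) in auto)
  moreover have "(\<Sum>x\<in>#?M. val (tl x)) = (\<Sum>p\<in>?C. delivered k p mod 2 ^ width lv)"
    by (simp add: sum_unfold_sum_mset image_mset.compositionality comp_def)
  ultimately show ?thesis using m(1) by (auto simp: zs_def agg_val_def mod_sum_eq)
qed

text \<open>The inserted 0 is what \<open>agg_val\<close> assigns to a supernode without boundary
  edges.\<close>

lemma zs_max:
  assumes "v \<in> V" "max_stage lv k"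
  shows "zs v k = Max (insert 0 ((\<lambda>p. delivered k p mod 2 ^ width lv) ` cut E (supernode (joined k) v)))"
proof (cases "cut E (supernode (joined k) v) = {}")
  case True
  then show ?thesis using zs_aggregates[OF assms(1), of k] by (simp add: aggregates_opt_def zs_def agg_val_def)
next
  case False
  let ?C = "cut E (supernode (joined k) v)"
  let ?M = "image_mset (\<lambda>p. max_stage lv k # enc (width lv) (delivered k p)) (mset_set ?C)"
  have "?M \<noteq> {#}" using False finite_cut by (simp add: mset_set_empty_iff)
  then obtain m where m: "z (2 + 2 * k) v = Some m" "aggregates agg_op ?M m"
    using zs_aggregates[OF assms(1), of k] by (auto simp: aggregates_opt_def)
  have mm: "m \<in># ?M \<and> (\<forall>x\<in>#?M. val (tl x) \<le> val (tl m))"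
    by (rule aggregates_agg_op_max[OF m(2)]) (use assms(2) in auto)
  have "\<exists>p\<in>?C. m = max_stage lv k # enc (width lv) (delivered k p)"
    using mm by (simp add: image_iff finite_cut)
  then obtain p where p: "p \<in> ?C" "val (tl m) = delivered k p mod 2 ^ width lv" by force
  have "zs v k = val (tl m)" using m by (simp add: zs_def agg_val_def)
  moreover have "val (tl m) = Max (insert 0 ((\<lambda>p. delivered k p mod 2 ^ width lv) ` ?C))"
  proof (rule Max_eqI[symmetric])
    show "val (tl m) \<in> insert 0 ((\<lambda>p. delivered k p mod 2 ^ width lv) ` ?C)" using p by blast
    fix x assume "x \<in> insert 0 ((\<lambda>p. delivered k p mod 2 ^ width lv) ` ?C)"
    moreover have "delivered k q mod 2 ^ width lv \<le> val (tl m)" if "q \<in> ?C" for q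
    proof -
      have "max_stage lv k # enc (width lv) (delivered k q) \<in># ?M"
        using that finite_cut by (simp add: image_iff) blast
      then show ?thesis using mm by fastforce
    qed
    ultimately show "x \<le> val (tl m)" by auto
  qed (simp add: finite_cut)
  ultimately show ?thesis by simp
qed

lemma node_result_eq:
  assumes "v \<in> V"
  shows "node_result (v, inp v, node_hist (c (1 + 2 * stages lv)) v) =
    Some (result lv v (inp v) (trunc (stages lv) (ys v)) (trunc (stages lv) (zs v)))"
proof -
  let ?t = "1 + 2 * stages lv"
  let ?h = "map (\<lambda>j. (y j v, z j v)) [0..<?t]"
  have "trunc (stages lv) (heard_sum ?h) = trunc (stages lv) (ys v)"
    "trunc (stages lv) (heard_agg ?h) = trunc (stages lv) (zs v)"
    by (auto intro!: trunc_cong simp: heard_sum_def heard_agg_def ys_def zs_def simp del: upt_Suc)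
  moreover have "length (fst (?h ! 0)) = lv" using assms length_y_0 by (simp del: upt_Suc)
  moreover have "length ?h = ?t" "?h \<noteq> []" by auto
  ultimately show ?thesis unfolding node_result_def node_history[OF assms] prod.case Let_def by metis
qed

lemma node_result_None:
  assumes "v \<in> V" "t < 1 + 2 * stages lv"
  shows "node_result (v, inp v, node_hist (c t) v) = None"
  using assms length_y_0 by (cases "t = 0") (auto simp: node_result_def node_history Let_def)

text \<open>The additional bit is the one that selects the mode of \<open>agg_op\<close>.\<close>

lemma bandwidth: "within_bandwidth algorithm V E inp (1 + width lv) c t"
proof -
  have "length (node_msg (v, inp v, node_hist (c t) v)) \<le> 1 + width lv" if "v \<in> V" for v
  proof (cases "t = 0")
    case True
    then have "node_msg (v, inp v, node_hist (c t) v) = replicate (length v) False"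
      using node_history[OF that, of 0] by (simp add: node_msg_def)
    moreover have "length v \<le> lv" unfolding lv_def using that finite_V by simp
    ultimately show ?thesis by (simp add: width_def)
  qed (use node_msg_eq[OF that, of t] in simp)
  moreover have "length (edge_msg (edge_view (c (Suc t)) e) v) \<le> 1 + width lv" if ev: "e \<in> E" "v \<in> e" for e v
  proof -
    obtain w where "e = {v, w}" using ev edge_cases by blast
    then show ?thesis using ev edge_msg_eq[of v w t] edge_msg_odd[of v w t] by (cases "even t \<and> 0 < t") auto
  qed
  ultimately show ?thesis
    by (auto simp: within_bandwidth_def algorithm_def node_view_def minor_edges_def)
qed

end

section \<open>Merging clusters\<close>

text \<open>Absorbing labels have value \<open>b\<close> at bit \<open>i\<close> and absorbed labels do not, so that a merging
  step contracts disjoint stars. An absorbed cluster has at most two neighbours and exactly one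
  candidate among them.\<close>

definition candidate :: "nat \<Rightarrow> bool \<Rightarrow> (node \<Rightarrow> nat) \<Rightarrow> node \<times> node \<Rightarrow> bool" where
  "candidate i b f = (\<lambda>(u, w). bit (f u) i \<noteq> b \<and> bit (f w) i = b)"

text \<open>A charging argument: a member of \<open>K\<close> leaves or has a neighbour that leaves.
  At the moment of leaving there are at most two neighbours, and by \<open>persist\<close> every
  initial neighbour that survives to the end is among them. So a leaver accounts for itself and at
  most two survivors, whence the factor 3.\<close>

lemma sweep_absorbs:
  fixes A :: "nat \<Rightarrow> 'a set" and N :: "nat \<Rightarrow> 'a \<Rightarrow> 'a set"
  assumes fin: "finite (A 0)" and dec: "\<And>j. A (Suc j) \<subseteq> A j"
    and persist: "\<And>j c d. c \<in> A (Suc j) \<Longrightarrow> d \<in> A (Suc j) \<Longrightarrow> d \<in> N j c \<Longrightarrow> d \<in> N (Suc j) c"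
    and leave: "\<And>j c. c \<in> A j - A (Suc j) \<Longrightarrow> finite (N j c) \<and> card (N j c) \<le> 2"
    and sym: "\<And>c d. d \<in> N 0 c \<Longrightarrow> c \<in> N 0 d"
    and K: "K \<subseteq> A 0" and hit: "\<And>c. c \<in> K \<inter> A J \<Longrightarrow> \<exists>d\<in>N 0 c. d \<in> A 0 - A J"
  shows "card K \<le> 3 * card (A 0 - A J)"
proof -
  let ?X = "A 0 - A J"
  have mono: "A j \<subseteq> A i" if "i \<le> j" for i j using dec that by (rule lift_Suc_antimono_le)
  have pers: "d \<in> N j c" if "c \<in> A j" "d \<in> A j" "d \<in> N 0 c" for c d j
    using that
  proof (induction j)
    case (Suc j)
    then show ?case using persist dec by blast
  qed simp
  have two: "card (N 0 d \<inter> A J) \<le> 2" if "d \<in> ?X" for d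
  proof -
    have "\<exists>j<J. d \<in> A j \<and> d \<notin> A (Suc j)"
      using that
    proof (induction J)
      case (Suc J)
      then show ?case by (cases "d \<in> A J") (auto intro: less_SucI)
    qed simp
    then obtain j where j: "j < J" "d \<in> A j - A (Suc j)" by blast
    have "N 0 d \<inter> A J \<subseteq> N j d" using pers[of d j] j mono[of j J] by auto
    then show ?thesis using leave[OF j(2)] card_mono le_trans by blast
  qed
  have "K \<subseteq> ?X \<union> (\<Union>d\<in>?X. N 0 d \<inter> A J)" using K hit sym by blast
  moreover have "finite (?X \<union> (\<Union>d\<in>?X. N 0 d \<inter> A J))"
    using finite_subset[OF mono[of 0 J] fin] fin by auto
  ultimately have "card K \<le> card (?X \<union> (\<Union>d\<in>?X. N 0 d \<inter> A J))" by (rule card_mono[rotated])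
  also have "\<dots> \<le> card ?X + card (\<Union>d\<in>?X. N 0 d \<inter> A J)" by (rule card_Un_le)
  also have "card (\<Union>d\<in>?X. N 0 d \<inter> A J) \<le> (\<Sum>d\<in>?X. card (N 0 d \<inter> A J))"
    using fin by (intro card_UN_le) auto
  also have "\<dots> \<le> (\<Sum>d\<in>?X. 2)" by (rule sum_mono) (rule two)
  finally show ?thesis by simp
qed

context rooted_tree
begin

lemma top_inj: "connected_classes f \<Longrightarrow> x \<in> tops f \<Longrightarrow> y \<in> tops f \<Longrightarrow> f x = f y \<Longrightarrow> x = y"
  unfolding connected_classes_def by (rule inj_onD)

lemma mem_cut_cls: "(u, w) \<in> cut E (cls f v) \<longleftrightarrow> {u, w} \<in> E \<and> f u = f v \<and> f w \<noteq> f v"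
  using edge_nodes[of u w] unfolding cut_def cls_def by blast

definition candidates :: "nat \<Rightarrow> bool \<Rightarrow> (node \<Rightarrow> nat) \<Rightarrow> node \<Rightarrow> (node \<times> node) set" where
  "candidates i b f v = {p \<in> cut E (cls f v). candidate i b f p}"

definition absorbed :: "nat \<Rightarrow> bool \<Rightarrow> (node \<Rightarrow> nat) \<Rightarrow> node \<Rightarrow> bool" where
  "absorbed i b f v \<longleftrightarrow> card (cut E (cls f v)) \<le> 2 \<and> card (candidates i b f v) = 1"

text \<open>An absorbed class has a single candidate, so the sum is just its label; a sum is the
  form in which an aggregate delivers it.\<close>

definition merge :: "nat \<Rightarrow> bool \<Rightarrow> (node \<Rightarrow> nat) \<Rightarrow> node \<Rightarrow> nat" where
  "merge i b f v = (if absorbed i b f v then \<Sum>(u, w)\<in>candidates i b f v. f w else f v)"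

text \<open>Adjacency in the quotient by \<open>f\<close>, expressed by labels rather than classes
  so that it can be compared between merging steps.\<close>

definition nbs :: "(node \<Rightarrow> nat) \<Rightarrow> nat \<Rightarrow> nat set" where
  "nbs f a = {d. d \<noteq> a \<and> (\<exists>u w. {u, w} \<in> E \<and> f u = a \<and> f w = d)}"

lemma nbs_sym: "d \<in> nbs f a \<Longrightarrow> a \<in> nbs f d"
proof -
  assume "d \<in> nbs f a"
  then obtain u w where "{w, u} \<in> E" "f u = a" "f w = d" "d \<noteq> a" by (auto simp: nbs_def insert_commute)
  then show "a \<in> nbs f d" unfolding nbs_def by (intro CollectI conjI exI[of _ w] exI[of _ u]) simp_all
qed

lemma nbs_subset: "nbs f a \<subseteq> f ` V"
proof
  fix d assume "d \<in> nbs f a"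
  then obtain u w where "{u, w} \<in> E" "d = f w" by (auto simp: nbs_def)
  then show "d \<in> f ` V" using edge_nodes[of u w] by simp
qed

lemma merge_class:
  assumes "f u = f v"
  shows "absorbed i b f u = absorbed i b f v" "merge i b f u = merge i b f v"
proof -
  have "cls f u = cls f v" using assms by (simp add: cls_def)
  then show "absorbed i b f u = absorbed i b f v" "merge i b f u = merge i b f v"
    using assms by (auto simp: absorbed_def candidates_def merge_def)
qed

lemma absorbed_obtain:
  assumes "absorbed i b f v"
  obtains u w where "candidates i b f v = {(u, w)}" "u \<in> V" "w \<in> V" "{u, w} \<in> E" "f u = f v" "f w \<noteq> f v"
    "bit (f v) i \<noteq> b" "bit (f w) i = b" "merge i b f v = f w" "merge i b f w = f w" "\<not> absorbed i b f w"
proof -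
  obtain u w where uw: "candidates i b f v = {(u, w)}"
    using assms by (auto simp: absorbed_def card_1_singleton_iff)
  then have "(u, w) \<in> candidates i b f v" by simp
  then have *: "{u, w} \<in> E" "f u = f v" "u \<in> V" "w \<notin> cls f v" "bit (f u) i \<noteq> b" "bit (f w) i = b"
    by (auto simp: candidates_def cut_def cls_def candidate_def)
  then have w: "w \<in> V" "f w \<noteq> f v" using edge_nodes by (auto simp: cls_def)
  have "candidates i b f w = {}" using *(6) by (auto simp: candidates_def cut_def cls_def candidate_def)
  then have "\<not> absorbed i b f w" by (simp add: absorbed_def)
  then show ?thesis using that[OF uw] * w uw assms by (simp add: merge_def)
qed

lemma not_absorbed: "\<not> absorbed i b f v \<Longrightarrow> merge i b f v = f v"
  by (simp add: merge_def)

text \<open>If both ends were absorbed, equal new labels would mean a common absorbing class, and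
  the three classes would form a triangle. So \<open>w\<close> keeps its label, \<open>u\<close> is
  absorbed into the class of \<open>w\<close>, and the edge between them is a candidate.\<close>

lemma merged_edge:
  assumes cc: "connected_classes f" and e: "{u, w} \<in> E" and f: "f u \<noteq> f w"
    and m: "merge i b f u = merge i b f w" and a: "absorbed i b f u"
  shows "\<not> absorbed i b f w" "candidates i b f u = {(u, w)}"
proof -
  obtain u1 w1 where u1: "candidates i b f u = {(u1, w1)}" "{u1, w1} \<in> E" "f u1 = f u" "f w1 \<noteq> f u"
    "bit (f u) i \<noteq> b" "bit (f w1) i = b" "merge i b f u = f w1" using absorbed_obtain[OF a] by metis
  show na: "\<not> absorbed i b f w"
  proof
    assume "absorbed i b f w"
    then obtain u2 w2 where u2: "{u2, w2} \<in> E" "f u2 = f w" "f w2 \<noteq> f w" "merge i b f w = f w2"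
      using absorbed_obtain by metis
    then have "f w2 = f w1" using m u1 by simp
    then show False
      using no_triangle[OF cc e u2(1), of w1 u1] u1 u2 f by (metis insert_commute)
  qed
  then have w: "f w = f w1" using m u1 by (simp add: merge_def)
  have V: "u \<in> V" "w \<in> V" using edge_nodes[OF e] by auto
  have "(u, w) \<in> candidates i b f u"
    using e f u1(5,6) V unfolding candidates_def cut_def cls_def candidate_def w[symmetric] by simp
  then show "candidates i b f u = {(u, w)}" using u1 by simp
qed

text \<open>When a step is undone, an absorbed class thus has exactly one boundary edge whose sides
  are still unknown: the one along which it was absorbed.\<close>

lemma merged_cut:
  assumes cc: "connected_classes f" and e: "{u, w} \<in> E" and f: "f u \<noteq> f w"
    and m: "merge i b f u = merge i b f w" and a: "absorbed i b f u"
  shows "{(u', w') \<in> cut E (cls f u). merge i b f u' = merge i b f w'} = {(u, w)}"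
proof -
  have V: "u \<in> V" "w \<in> V" using edge_nodes[OF e] by auto
  have "(u', w') = (u, w)" if "(u', w') \<in> cut E (cls f u)" "merge i b f u' = merge i b f w'" for u' w'
  proof -
    have p: "{u', w'} \<in> E" "f u' = f u" "f w' \<noteq> f u" using that(1) by (simp_all add: mem_cut_cls)
    have "absorbed i b f u'" using a merge_class(1)[OF p(2)] by simp
    then have "candidates i b f u' = {(u', w')}" using merged_edge[OF cc p(1)] p that by simp
    moreover have "candidates i b f u' = candidates i b f u" using p by (simp add: candidates_def cls_def)
    ultimately show ?thesis using merged_edge[OF cc e f m a] by simp
  qed
  moreover have "(u, w) \<in> cut E (cls f u)" using e f by (simp add: mem_cut_cls)
  ultimately show ?thesis using m by blast
qed

lemma absorbed_iff_changed:
  "absorbed i b f v \<longleftrightarrow> merge i b f v \<noteq> f v"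
  using absorbed_obtain[of i b f v] not_absorbed by metis

text \<open>Merging creates no new tops, so tops of \<open>f\<close> are compared. A new class is a
  star around the absorbing class; at most one absorbed class lies above the centre, and its top, or
  else the top of the centre, is the only top.\<close>

lemma merge_connected:
  assumes cc: "connected_classes f"
  shows "connected_classes (merge i b f)"
  unfolding connected_classes_def
proof (rule inj_onI)
  let ?g = "merge i b f"
  fix x y assume x: "x \<in> tops ?g" and y: "y \<in> tops ?g" and g: "?g x = ?g y"
  have top: "x \<in> tops f" if "x \<in> tops ?g" for x
    using that merge_class(2)[of f "par x" x i b] by (auto simp: tops_def)
  have cl: "x = y" if "x \<in> tops ?g" "y \<in> tops ?g" "f x = f y" for x y
    using top_inj[OF cc top[OF that(1)] top[OF that(2)] that(3)] .
  text \<open>If \<open>x\<close> is absorbed into a class other than through its parent edge, then it contains the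
    parent of the top of that class.\<close>
  have link: "\<exists>p. p \<in> tops f \<and> p \<noteq> r \<and> f p = ?g x \<and> ?g p = ?g x \<and> f (par p) = f x \<and> ?g (par p) = ?g x"
    if x: "x \<in> tops ?g" and a: "absorbed i b f x" for x
  proof -
    obtain u w where uw: "{u, w} \<in> E" "u \<in> V" "w \<in> V" "f u = f x" "f w \<noteq> f x" "?g x = f w" "?g w = f w"
      using absorbed_obtain[OF a] by metis
    have gu: "?g u = ?g x" using merge_class(2)[OF uw(4)] .
    have "\<not> (u \<noteq> r \<and> w = par u)"
    proof
      assume u: "u \<noteq> r \<and> w = par u"
      then have "u \<in> tops f" using uw by (auto simp: tops_def)
      then have "u = x" using top_inj[OF cc _ top[OF x] uw(4)] by blast
      then show False using x u uw by (auto simp: tops_def)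
    qed
    then have "w \<noteq> r" "u = par w" using edge_par[OF uw(1)] by auto
    then show ?thesis using uw gu by (intro exI[of _ w]) (auto simp: tops_def)
  qed
  show "x = y"
  proof (cases "absorbed i b f x")
    case True
    then obtain p where p: "p \<in> tops f" "p \<noteq> r" "f p = ?g x" "?g p = ?g x" "f (par p) = f x" "?g (par p) = ?g x"
      using link[OF x] by blast
    show ?thesis
    proof (cases "absorbed i b f y")
      case True
      then obtain q where q: "q \<in> tops f" "f q = ?g y" "f (par q) = f y" using link[OF y] by blast
      then have "p = q" using top_inj[OF cc p(1) q(1)] p(3) g by simp
      then show ?thesis using cl[OF x y] p q by simp
    next
      case False
      then have "f y = f p" using p g not_absorbed by simp
      then have "y = p" using top_inj[OF cc top[OF y] p(1)] by blast
      then show ?thesis using y p(2,4,6) by (simp add: tops_def)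
    qed
  next
    case nx: False
    show ?thesis
    proof (cases "absorbed i b f y")
      case True
      then obtain p where p: "p \<in> tops f" "p \<noteq> r" "f p = ?g y" "?g p = ?g y" "f (par p) = f y" "?g (par p) = ?g y"
        using link[OF y] by blast
      then have "f x = f p" using nx g not_absorbed by simp
      then have "x = p" using top_inj[OF cc top[OF x] p(1)] by blast
      then show ?thesis using x p(2,4,6) by (simp add: tops_def)
    next
      case False
      then show ?thesis using nx g cl[OF x y] not_absorbed by simp
    qed
  qed
qed

lemma merge_image: "merge i b f ` V \<subseteq> f ` V"
proof
  fix a assume "a \<in> merge i b f ` V"
  then obtain v where v: "v \<in> V" "a = merge i b f v" by blast
  show "a \<in> f ` V"
    using v absorbed_obtain[of i b f v] not_absorbed[of i b f v] by (metis imageI)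
qed

text \<open>The label of an absorbed class does not have value \<open>b\<close> at bit
  \<open>i\<close>, so no other class can adopt it and it disappears for good.\<close>

lemma alive_iff:
  assumes "v \<in> V"
  shows "f v \<in> merge i b f ` V \<longleftrightarrow> \<not> absorbed i b f v"
proof
  assume "f v \<in> merge i b f ` V"
  then obtain u where u: "u \<in> V" "f v = merge i b f u" by blast
  show "\<not> absorbed i b f v"
  proof
    assume a: "absorbed i b f v"
    then have vb: "bit (f v) i \<noteq> b" using absorbed_obtain by metis
    show False
    proof (cases "absorbed i b f u")
      case True
      then show False using vb u absorbed_obtain by metis
    next
      case False
      then show False using u a merge_class(1)[of f u v i b] not_absorbed by simp
    qed
  qed
next
  assume "\<not> absorbed i b f v"
  then show "f v \<in> merge i b f ` V" using assms not_absorbed by (metis imageI)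
qed

lemma image_Collect_conj: "g ` {p \<in> A. P (g p)} = {d \<in> g ` A. P d}"
  by blast

lemma nbs_cut:
  assumes cc: "connected_classes f" and v: "v \<in> V"
  shows "bij_betw (\<lambda>(u, w). f w) (cut E (cls f v)) (nbs f (f v))"
  unfolding bij_betw_def
proof
  show "inj_on (\<lambda>(u, w). f w) (cut E (cls f v))"
  proof (rule inj_onI, clarify)
    fix u w u' w' assume "(u, w) \<in> cut E (cls f v)" "(u', w') \<in> cut E (cls f v)" and f: "f w = f w'"
    then have *: "{u, w} \<in> E" "{u', w'} \<in> E" "f u \<noteq> f w" "f u' = f u"
      unfolding mem_cut_cls by metis+
    show "u = u' \<and> w = w'" using cross_edge_unique[OF cc * f[symmetric]] by blast
  qed
  show "(\<lambda>(u, w). f w) ` cut E (cls f v) = nbs f (f v)"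
  proof (intro set_eqI iffI)
    fix d assume "d \<in> (\<lambda>(u, w). f w) ` cut E (cls f v)"
    then obtain u w where "d = f w" "{u, w} \<in> E" "f u = f v" "f w \<noteq> f v"
      by (auto simp: mem_cut_cls)
    then show "d \<in> nbs f (f v)" unfolding nbs_def by (intro CollectI conjI exI[of _ u] exI[of _ w]) simp_all
  next
    fix d assume "d \<in> nbs f (f v)"
    then obtain u w where uw: "d = f w" "{u, w} \<in> E" "f u = f v" "f w \<noteq> f v" by (auto simp: nbs_def)
    then have "(u, w) \<in> cut E (cls f v)" by (simp add: mem_cut_cls)
    then show "d \<in> (\<lambda>(u, w). f w) ` cut E (cls f v)" using uw(1) by (intro image_eqI[of _ _ "(u, w)"]) simp_all
  qed
qed

lemma card_nbs: "connected_classes f \<Longrightarrow> v \<in> V \<Longrightarrow> card (nbs f (f v)) = card (cut E (cls f v))"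
  using bij_betw_same_card[OF nbs_cut] by metis

lemma finite_nbs: "finite (nbs f a)"
proof (rule finite_subset)
  show "nbs f a \<subseteq> f ` V" by (rule nbs_subset)
qed (simp add: finite_V)

lemma card_candidates:
  assumes "connected_classes f" "v \<in> V" "bit (f v) i \<noteq> b"
  shows "card (candidates i b f v) = card {d \<in> nbs f (f v). bit d i = b}"
proof -
  have "bij_betw (\<lambda>(u, w). f w) (candidates i b f v) ((\<lambda>(u, w). f w) ` candidates i b f v)"
    using nbs_cut[OF assms(1,2)] by (intro bij_betw_subset[OF nbs_cut[OF assms(1,2)]]) (auto simp: candidates_def)
  moreover have "(\<lambda>(u, w). f w) ` candidates i b f v = {d \<in> nbs f (f v). bit d i = b}"
  proof -
    have "candidates i b f v = {p \<in> cut E (cls f v). bit ((\<lambda>(u, w). f w) p) i = b}"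
      using assms(3) by (auto simp: candidates_def candidate_def mem_cut_cls)
    moreover have "(\<lambda>(u, w). f w) ` cut E (cls f v) = nbs f (f v)"
      using nbs_cut[OF assms(1,2)] by (simp add: bij_betw_def)
    ultimately show ?thesis using image_Collect_conj[of "\<lambda>(u, w). f w" "cut E (cls f v)" "\<lambda>d. bit d i = b"] by simp
  qed
  ultimately show ?thesis using bij_betw_same_card by metis
qed

lemma nbs_persist:
  assumes "a \<in> merge i b f ` V" "d \<in> merge i b f ` V" "d \<in> nbs f a"
  shows "d \<in> nbs (merge i b f) a"
proof -
  obtain u w where uw: "{u, w} \<in> E" "f u = a" "f w = d" "d \<noteq> a" using assms(3) by (auto simp: nbs_def)
  then have "u \<in> V" "w \<in> V" using edge_nodes by auto
  then have "merge i b f u = a" "merge i b f w = d" using uw assms alive_iff not_absorbed by metis+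
  then show ?thesis using uw by (auto simp: nbs_def)
qed

text \<open>A new neighbour could only appear through a class absorbed into \<open>a\<close>, or
  through a class next to \<open>a\<close> changing its label; either would remove a neighbour of
  \<open>a\<close>.\<close>

lemma nbs_stable:
  assumes "a \<in> merge i b f ` V" "nbs f a \<subseteq> merge i b f ` V"
  shows "nbs (merge i b f) a = nbs f a"
proof
  let ?g = "merge i b f"
  show "nbs f a \<subseteq> nbs ?g a" using nbs_persist assms by blast
  show "nbs ?g a \<subseteq> nbs f a"
  proof
    fix d assume "d \<in> nbs ?g a"
    then obtain u w where uw: "{u, w} \<in> E" "?g u = a" "?g w = d" "d \<noteq> a" by (auto simp: nbs_def)
    then have V: "u \<in> V" "w \<in> V" using edge_nodes by auto
    have u: "f u = a"
    proof (rule ccontr)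
      assume "f u \<noteq> a"
      then have au: "absorbed i b f u" using uw not_absorbed by metis
      then obtain u1 w1 where "{u1, w1} \<in> E" "f u1 = f u" "f w1 \<noteq> f u" "?g u = f w1"
        using absorbed_obtain by metis
      then have "{w1, u1} \<in> E" "f w1 = a" "f u1 = f u" "f u \<noteq> a" using uw by (simp_all add: insert_commute)
      then have "f u \<in> nbs f a" unfolding nbs_def by blast
      then show False using assms(2) alive_iff[OF V(1)] au by blast
    qed
    have "f w = d"
    proof (cases "f w = a")
      case True
      then show ?thesis using assms(1) alive_iff[OF V(2), of f i b] not_absorbed[of i b f w] uw(3) by auto
    next
      case False
      then have "f w \<in> nbs f a" using uw u by (auto simp: nbs_def)
      then show ?thesis using assms(2) alive_iff[OF V(2), of f i b] not_absorbed[of i b f w] uw(3) by auto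
    qed
    then show "d \<in> nbs f a" using uw u by (auto simp: nbs_def)
  qed
qed

lemma image_tops: "f ` tops f = f ` V"
proof
  show "f ` V \<subseteq> f ` tops f"
  proof (rule image_subsetI)
    fix v assume "v \<in> V"
    then obtain x where "x \<in> tops f" "f v = f x" using apex_exists[of v f] by force
    then show "f v \<in> f ` tops f" by (rule rev_image_eqI)
  qed
qed (use tops_subset in blast)

text \<open>Handshaking in the quotient tree: its edges are the parent edges of the tops other than
  \<open>r\<close>, each counted once from below and once from above.\<close>

lemma sum_card_nbs:
  assumes cc: "connected_classes f"
  shows "(\<Sum>a\<in>f ` V. card (nbs f a)) + 2 = 2 * card (f ` V)"
proof -
  let ?S = "tops f - {r}"
  have "card (nbs f a) = (\<Sum>x\<in>{x \<in> ?S. f (par x) = a}. 1) + (\<Sum>x\<in>{x \<in> ?S. f x = a}. 1)"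
    if aV: "a \<in> f ` V" for a
  proof -
    obtain v where v: "v \<in> V" "a = f v" using aV by blast
    have "card (cut E (cls f v)) = (\<Sum>p\<in>cut E (cls f v). 1)" by simp
    then show ?thesis using v card_nbs[OF cc v(1)] sum_cut_cls[OF v(1), of "\<lambda>_. 1::nat" f]
      by (simp add: lower_def upper_def)
  qed
  then have "(\<Sum>a\<in>f ` V. card (nbs f a)) =
      (\<Sum>a\<in>f ` V. \<Sum>x\<in>{x \<in> ?S. f (par x) = a}. 1) + (\<Sum>a\<in>f ` V. \<Sum>x\<in>{x \<in> ?S. f x = a}. 1)"
    by (simp add: sum.distrib)
  also have "(\<Sum>a\<in>f ` V. \<Sum>x\<in>{x \<in> ?S. f (par x) = a}. 1::nat) = (\<Sum>x\<in>?S. 1)"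
    using finite_tops finite_V rp_snoc(2) by (intro sum.group) (auto simp: tops_def)
  also have "(\<Sum>a\<in>f ` V. \<Sum>x\<in>{x \<in> ?S. f x = a}. 1::nat) = (\<Sum>x\<in>?S. 1)"
    using finite_tops finite_V by (intro sum.group) (auto simp: tops_def)
  finally have "(\<Sum>a\<in>f ` V. card (nbs f a)) = 2 * (card (tops f) - 1)"
    using card_Diff_singleton[OF root_tops[of f]] by simp
  moreover have "card (tops f) = card (f ` V)"
    using cc card_image[of f "tops f"] by (simp add: connected_classes_def image_tops)
  moreover have "0 < card (tops f)" using root_tops finite_tops card_gt_0_iff by blast
  ultimately show ?thesis by simp
qed

lemma nbs_nonempty:
  assumes cc: "connected_classes f" and "2 \<le> card (f ` V)" and v: "v \<in> V"
  shows "nbs f (f v) \<noteq> {}"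
proof
  assume "nbs f (f v) = {}"
  then have "cut E (cls f v) = {}" using nbs_cut[OF cc v] by (simp add: bij_betw_def)
  then have "lower f (f v) = {}" "upper f (f v) = {}" unfolding cut_cls[OF v] by auto
  then have "V = cls f v" using upper_apex[OF cc v] desc_apex[OF cc v] desc_root by auto
  then have "f ` V \<subseteq> {f v}" by (auto simp: cls_def)
  then have "card (f ` V) \<le> 1" by (metis card.empty card_mono card_insert_disjoint empty_iff finite.emptyI finite.insertI One_nat_def)
  then show False using assms(2) by simp
qed

text \<open>The average degree is below two and no degree is zero, so fewer than half of the degrees
  can reach three.\<close>

lemma low_degree:
  assumes cc: "connected_classes f" and two: "2 \<le> card (f ` V)"
  shows "card (f ` V) \<le> 2 * card {a \<in> f ` V. card (nbs f a) \<le> 2}"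
proof -
  let ?A = "f ` V" let ?K = "{a \<in> ?A. card (nbs f a) \<le> 2}"
  have fin: "finite ?A" using finite_V by simp
  have "1 \<le> card (nbs f a)" if "a \<in> ?A" for a
    using that nbs_nonempty[OF cc two] finite_nbs by (metis One_nat_def Suc_leI card_gt_0_iff imageE)
  then have "(\<Sum>a\<in>?A. (if a \<in> ?K then 1 else 3)) \<le> (\<Sum>a\<in>?A. card (nbs f a))"
    by (intro sum_mono) (auto simp: not_le)
  moreover have "(\<Sum>a\<in>?A. (if a \<in> ?K then 1 else 3::nat)) = card ?K + 3 * card (?A - ?K)"
  proof -
    have "(\<Sum>a\<in>?A. (if a \<in> ?K then 1 else 3::nat)) =
      (\<Sum>a\<in>?A - ?K. (if a \<in> ?K then 1 else 3)) + (\<Sum>a\<in>?K. (if a \<in> ?K then 1 else 3))"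
      by (rule sum.subset_diff) (use fin in auto)
    moreover have "(\<Sum>a\<in>?K. (if a \<in> ?K then 1 else 3::nat)) = card ?K" by simp
    moreover have "(\<Sum>a\<in>?A - ?K. (if a \<in> ?K then 1 else 3::nat)) = (\<Sum>a\<in>?A - ?K. 3)"
      by (intro sum.cong) auto
    ultimately show ?thesis by simp
  qed
  moreover have "card (?A - ?K) = card ?A - card ?K" using fin by (intro card_Diff_subset) auto
  moreover have "card ?K \<le> card ?A" using fin by (intro card_mono) auto
  ultimately show ?thesis using sum_card_nbs[OF cc] by linarith
qed

end

section \<open>Geometric decrease of the number of clusters\<close>

lemma bit_differs:
  fixes m n :: nat
  assumes "m \<noteq> n" "m < 2 ^ k" "n < 2 ^ k"
  obtains i where "i < k" "bit m i \<noteq> bit n i"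
proof -
  obtain i where i: "bit m i \<noteq> bit n i" using assms(1) bit_eq_iff by blast
  have "\<not> bit x i" if "x < 2 ^ k" "k \<le> i" for x :: nat
  proof -
    have "x < 2 ^ i" using that by (meson less_le_trans one_le_numeral power_increasing)
    then show ?thesis by (simp add: bit_iff_odd)
  qed
  then have "i < k" using i assms(2,3) by (meson not_le)
  then show ?thesis using that i by blast
qed

text \<open>Steps \<open>2 * i\<close> and \<open>2 * i + 1\<close> of a sweep try bit
  \<open>i\<close> with the values 0 and 1, so a sweep has \<open>2 * (l + 1)\<close> steps.\<close>

locale cluster_merging = rooted_tree +
  fixes l :: nat and lab :: "nat \<Rightarrow> node \<Rightarrow> nat"
  assumes lab_cc: "connected_classes (lab 0)"
    and lab_Suc: "\<And>t v. v \<in> V \<Longrightarrow> lab (Suc t) v = merge ((t div 2) mod (l + 1)) (odd t) (lab t) v"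
    and lab_bound: "\<And>v. v \<in> V \<Longrightarrow> lab 0 v < 2 ^ (l + 1)"
    and card_V: "card V < 2 ^ (l + 1)"
begin

lemma tops_cong: "(\<And>v. v \<in> V \<Longrightarrow> f v = g v) \<Longrightarrow> tops f = tops g"
  using rp_snoc(2) by (auto simp: tops_def)

lemma connected_cong:
  assumes "\<And>v. v \<in> V \<Longrightarrow> f v = g v" "connected_classes g" shows "connected_classes f"
  using assms(2) tops_cong[OF assms(1)] tops_subset[of g] assms(1)
  by (auto simp: connected_classes_def inj_on_def subset_iff)

lemma nbs_cong: "(\<And>v. v \<in> V \<Longrightarrow> f v = g v) \<Longrightarrow> nbs f a = nbs g a"
  using edge_nodes unfolding nbs_def by (metis (no_types, lifting))

lemma image_lab_Suc: "lab (Suc t) ` V = merge ((t div 2) mod (l + 1)) (odd t) (lab t) ` V"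
  using lab_Suc by (rule image_cong[OF refl])

lemma lab_connected: "connected_classes (lab t)"
proof (induction t)
  case (Suc t)
  then show ?case using lab_Suc merge_connected connected_cong by blast
qed (rule lab_cc)

lemma lab_less: "v \<in> V \<Longrightarrow> lab t v < 2 ^ (l + 1)"
proof -
  have "lab t ` V \<subseteq> lab 0 ` V"
  proof (induction t)
    case (Suc t)
    have "lab (Suc t) ` V \<subseteq> lab t ` V" unfolding image_lab_Suc by (rule merge_image)
    then show ?case using Suc by (rule order_trans)
  qed simp
  moreover assume "v \<in> V"
  ultimately obtain u where "u \<in> V" "lab t v = lab 0 u" by blast
  then show "lab t v < 2 ^ (l + 1)" using lab_bound[of u] by simp
qed

lemma lab_mono: "u \<in> V \<Longrightarrow> v \<in> V \<Longrightarrow> lab t u = lab t v \<Longrightarrow> t \<le> s \<Longrightarrow> lab s u = lab s v"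
proof (induction s)
  case (Suc s)
  show ?case
  proof (cases "t = Suc s")
    case False
    then have "lab s u = lab s v" using Suc by simp
    then show ?thesis using Suc.prems(1,2) by (simp only: lab_Suc merge_class(2)[OF \<open>lab s u = lab s v\<close>])
  qed (use Suc.prems in simp)
qed simp

text \<open>Otherwise \<open>a\<close> and all its neighbours survive, and by
  \<open>nbs_stable\<close> the neighbourhood stays the same throughout the sweep. Some bit makes
  exactly one neighbour disagree with \<open>a\<close>: a bit separating \<open>a\<close> from its
  only neighbour, or one separating its two neighbours from each other. When this bit is tried with
  the value opposite to that of \<open>a\<close>, \<open>a\<close> is absorbed.\<close>

lemma survivor_hit:
  assumes start: "s = 2 * (l + 1) * q" and a: "a \<in> lab (s + 2 * (l + 1)) ` V"
    and d2: "card (nbs (lab s) a) \<le> 2" and ne: "nbs (lab s) a \<noteq> {}"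
  shows "\<exists>d\<in>nbs (lab s) a. d \<notin> lab (s + 2 * (l + 1)) ` V"
proof (rule ccontr)
  assume "\<not> ?thesis"
  then have sub: "nbs (lab s) a \<subseteq> lab (s + 2 * (l + 1)) ` V" by blast
  have dec: "lab (s + 2 * (l + 1)) ` V \<subseteq> lab t ` V" if "t \<le> s + 2 * (l + 1)" for t
    by (rule lift_Suc_antimono_le[of "\<lambda>t. lab t ` V", OF _ that])
      (use image_lab_Suc merge_image in blast)
  have same: "j \<le> 2 * (l + 1) \<Longrightarrow> nbs (lab (s + j)) a = nbs (lab s) a" for j
  proof (induction j)
    case (Suc j)
    let ?g = "merge (((s + j) div 2) mod (l + 1)) (odd (s + j)) (lab (s + j))"
    have "lab (s + 2 * (l + 1)) ` V \<subseteq> ?g ` V" using dec[of "Suc (s + j)"] Suc.prems image_lab_Suc[of "s + j"] by simp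
    then have "nbs ?g a = nbs (lab (s + j)) a"
      using a sub Suc by (intro nbs_stable) auto
    moreover have "nbs (lab (s + Suc j)) a = nbs ?g a" by (rule nbs_cong) (simp add: lab_Suc)
    ultimately show ?case using Suc by simp
  qed simp
  have a0: "a \<in> lab s ` V" using dec[of s] a by auto
  have lt: "d < 2 ^ (l + 1)" if "d \<in> lab s ` V" for d using that lab_less by blast
  have nb: "nbs (lab s) a \<subseteq> lab s ` V" "a \<notin> nbs (lab s) a" using nbs_subset by (auto simp: nbs_def)
  have "\<exists>i<l + 1. card {d \<in> nbs (lab s) a. bit d i = (\<not> bit a i)} = 1"
  proof (cases "card (nbs (lab s) a) = 1")
    case True
    then obtain d where d: "nbs (lab s) a = {d}" using card_1_singletonE by blast
    then have "d \<noteq> a" "d < 2 ^ (l + 1)" "a < 2 ^ (l + 1)" using nb lt a0 by auto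
    then obtain i where "i < l + 1" "bit d i \<noteq> bit a i" by (rule bit_differs)
    moreover have "{x \<in> nbs (lab s) a. bit x i = (\<not> bit a i)} = {d}" using d calculation by auto
    ultimately show ?thesis by (metis card_1_singleton_iff One_nat_def)
  next
    case False
    moreover have "card (nbs (lab s) a) \<noteq> 0" using ne finite_nbs by simp
    ultimately have "card (nbs (lab s) a) = 2" using d2 by linarith
    then obtain d d' where d: "nbs (lab s) a = {d, d'}" "d \<noteq> d'" by (meson card_2_iff)
    then have "d < 2 ^ (l + 1)" "d' < 2 ^ (l + 1)" using nb lt by auto
    with d(2) obtain i where i: "i < l + 1" "bit d i \<noteq> bit d' i" by (rule bit_differs)
    then have "{x \<in> nbs (lab s) a. bit x i = (\<not> bit a i)} = (if bit d i = bit a i then {d'} else {d})"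
      using d by auto
    then show ?thesis using i(1) by (metis (no_types, lifting) card_1_singleton_iff One_nat_def)
  qed
  then obtain i where i: "i < l + 1" "card {d \<in> nbs (lab s) a. bit d i = (\<not> bit a i)} = 1" by blast
  define b where "b = (\<not> bit a i)"
  \<comment> \<open>The offset within the sweep at which bit \<open>i\<close> is tried with value
    \<open>b\<close>.\<close>
  define j where "j = 2 * i + of_bool b"
  have j: "j < 2 * (l + 1)" using i(1) by (auto simp: j_def)
  have "odd (s + j) = b" by (simp add: start j_def)
  moreover have "(s + j) div 2 mod (l + 1) = i"
  proof -
    have "s + j = 2 * ((l + 1) * q + i) + of_bool b" by (simp add: start j_def algebra_simps)
    then have "(s + j) div 2 = (l + 1) * q + i" by (auto simp: of_bool_def)
    then show ?thesis using i(1) mod_mult_self2[of i "l + 1" q] by (simp add: add.commute)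
  qed
  ultimately have img: "lab (Suc (s + j)) ` V = merge i b (lab (s + j)) ` V" using image_lab_Suc by simp
  have "a \<in> lab (s + j) ` V" using dec[of "s + j"] a j by auto
  then obtain v where v: "v \<in> V" "a = lab (s + j) v" by blast
  have nbsj: "nbs (lab (s + j)) a = nbs (lab s) a" using same j by simp
  have "card (cut E (cls (lab (s + j)) v)) \<le> 2"
    using card_nbs[OF lab_connected v(1), of "s + j"] d2 nbsj v(2) by simp
  moreover have "card (candidates i b (lab (s + j)) v) = 1"
    using card_candidates[OF lab_connected v(1), of "s + j" i b] i(2) nbsj v(2) by (simp add: b_def)
  ultimately have "absorbed i b (lab (s + j)) v" by (simp add: absorbed_def)
  then have "a \<notin> lab (Suc (s + j)) ` V" using alive_iff[OF v(1)] img v(2) by simp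
  moreover have "a \<in> lab (Suc (s + j)) ` V" using dec[of "Suc (s + j)"] a j by auto
  ultimately show False by blast
qed

text \<open>At least half of the clusters have low degree, and at least a third of that number
  leave, which is one cluster in six.\<close>

lemma sweep_shrinks:
  assumes start: "s = 2 * (l + 1) * q" and two: "2 \<le> card (lab s ` V)"
  shows "6 * card (lab (s + 2 * (l + 1)) ` V) \<le> 5 * card (lab s ` V)"
proof -
  let ?J = "2 * (l + 1)" let ?A = "\<lambda>j. lab (s + j) ` V"
  let ?K = "{a \<in> lab s ` V. card (nbs (lab s) a) \<le> 2}"
  have dec: "?A (Suc j) \<subseteq> ?A j" for j using image_lab_Suc[of "s + j"] merge_image by simp
  have nbs_Suc: "nbs (lab (Suc t)) a = nbs (merge ((t div 2) mod (l + 1)) (odd t) (lab t)) a" for t a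
    by (rule nbs_cong) (simp add: lab_Suc)
  have "card ?K \<le> 3 * card (?A 0 - ?A ?J)"
  proof (rule sweep_absorbs[where N = "\<lambda>j. nbs (lab (s + j))"])
    show "finite (?A 0)" using finite_V by simp
    show "?A (Suc j) \<subseteq> ?A j" for j by (rule dec)
    show "d \<in> nbs (lab (s + Suc j)) a" if "a \<in> ?A (Suc j)" "d \<in> ?A (Suc j)" "d \<in> nbs (lab (s + j)) a" for j a d
      using nbs_persist[of a _ _ "lab (s + j)" d] that by (simp add: nbs_Suc image_lab_Suc)
    show "finite (nbs (lab (s + j)) a) \<and> card (nbs (lab (s + j)) a) \<le> 2" if aj: "a \<in> ?A j - ?A (Suc j)" for j a
    proof -
      obtain v where v: "v \<in> V" "a = lab (s + j) v" using aj by blast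
      then have "absorbed ((s + j) div 2 mod (l + 1)) (odd (s + j)) (lab (s + j)) v"
        using aj alive_iff[OF v(1), of "lab (s + j)"] image_lab_Suc[of "s + j"] by simp
      then show ?thesis using card_nbs[OF lab_connected v(1), of "s + j"] v finite_nbs by (simp add: absorbed_def)
    qed
    show "d \<in> nbs (lab (s + 0)) a \<Longrightarrow> a \<in> nbs (lab (s + 0)) d" for a d by (rule nbs_sym)
    show "?K \<subseteq> ?A 0" by auto
    show "\<exists>d\<in>nbs (lab (s + 0)) a. d \<in> ?A 0 - ?A ?J" if aK: "a \<in> ?K \<inter> ?A ?J" for a
    proof -
      have "nbs (lab s) a \<noteq> {}" using aK nbs_nonempty[OF lab_connected two] by auto
      then obtain d where d: "d \<in> nbs (lab s) a" "d \<notin> ?A ?J" using survivor_hit[OF start, of a] aK by auto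
      then have "d \<in> lab s ` V" using nbs_subset by blast
      then show ?thesis using d by auto
    qed
  qed
  moreover have "card (?A 0) \<le> 2 * card ?K" using low_degree[OF lab_connected two] by simp
  moreover have "card (?A 0 - ?A ?J) = card (?A 0) - card (?A ?J)" "card (?A ?J) \<le> card (?A 0)"
  proof -
    have "?A ?J \<subseteq> ?A 0" by (rule lift_Suc_antimono_le[of ?A, OF dec]) simp
    then show "card (?A 0 - ?A ?J) = card (?A 0) - card (?A ?J)" "card (?A ?J) \<le> card (?A 0)"
      using finite_V by (auto intro: card_Diff_subset card_mono finite_subset)
  qed
  ultimately show ?thesis by simp
qed

lemma card_sweeps:
  "card (lab (2 * (l + 1) * q) ` V) \<le> 1 \<or> 6 ^ q * card (lab (2 * (l + 1) * q) ` V) \<le> 5 ^ q * card V"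
proof (induction q)
  case 0
  then show ?case using card_image_le[OF finite_V, of "lab 0"] by simp
next
  case (Suc q)
  let ?s = "2 * (l + 1) * q"
  have e: "2 * (l + 1) * Suc q = ?s + 2 * (l + 1)" by simp
  have le: "card (lab (?s + 2 * (l + 1)) ` V) \<le> card (lab ?s ` V)"
  proof -
    have "lab (?s + 2 * (l + 1)) ` V \<subseteq> lab ?s ` V"
      by (rule lift_Suc_antimono_le[of "\<lambda>t. lab t ` V"]) (use image_lab_Suc merge_image in auto)
    then show ?thesis using finite_V by (intro card_mono) auto
  qed
  show ?case
  proof (cases "2 \<le> card (lab ?s ` V)")
    case True
    then have "6 ^ q * card (lab ?s ` V) \<le> 5 ^ q * card V" using Suc by simp
    moreover have "6 * card (lab (?s + 2 * (l + 1)) ` V) \<le> 5 * card (lab ?s ` V)"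
      using sweep_shrinks[OF refl True] .
    ultimately have "6 ^ q * (6 * card (lab (?s + 2 * (l + 1)) ` V)) \<le> 6 ^ q * (5 * card (lab ?s ` V))"
      "5 * (6 ^ q * card (lab ?s ` V)) \<le> 5 * (5 ^ q * card V)" by auto
    then have "6 ^ q * (6 * card (lab (?s + 2 * (l + 1)) ` V)) \<le> 5 * (5 ^ q * card V)" by linarith
    then show ?thesis unfolding e by simp
  next
    case False
    then show ?thesis unfolding e using le by simp
  qed
qed

lemma lab_final:
  assumes "u \<in> V" "v \<in> V"
  shows "lab (2 * (l + 1) * (4 * (l + 1))) u = lab (2 * (l + 1) * (4 * (l + 1))) v"
proof -
  let ?T = "2 * (l + 1) * (4 * (l + 1))" let ?m = "card (lab ?T ` V)"
  have "?m \<le> 1"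
  proof (rule ccontr)
    assume m: "\<not> ?m \<le> 1"
    \<comment> \<open>Since \<open>6 ^ 4 = 1296\<close> exceeds \<open>2 * 5 ^ 4 = 1250\<close>,
      four sweeps more than halve the number of clusters; this is the origin of the
      \<open>4 * (l + 1)\<close> sweeps.\<close>
    have "1250 ^ (l + 1) * ?m \<le> 1296 ^ (l + 1) * ?m" by (intro mult_right_mono power_mono) auto
    also have "\<dots> = 6 ^ (4 * (l + 1)) * ?m" by (subst power_mult) simp
    also have "\<dots> \<le> 5 ^ (4 * (l + 1)) * card V" using card_sweeps[of "4 * (l + 1)"] m by simp
    also have "\<dots> < 5 ^ (4 * (l + 1)) * 2 ^ (l + 1)" using card_V by simp
    also have "\<dots> = (625 ^ (l + 1)) * 2 ^ (l + 1)" by (subst power_mult) simp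
    also have "\<dots> = 1250 ^ (l + 1)" by (subst power_mult_distrib[symmetric]) simp
    finally show False using m by simp
  qed
  moreover have "lab ?T u \<in> lab ?T ` V" "lab ?T v \<in> lab ?T ` V" using assms by auto
  ultimately show ?thesis using card_le_Suc0_iff_eq[of "lab ?T ` V"] finite_V by (metis One_nat_def finite_imageI)
qed

end

section \<open>Heavy paths\<close>

text \<open>The larger numbers are sorted by the highest bit in which they differ from
  \<open>x\<close>: there \<open>x\<close> has 0, the larger number has 1, and all higher bits
  agree.\<close>

lemma card_greater_bits:
  fixes g :: "'a \<Rightarrow> nat"
  assumes "finite P"
  shows "card {w \<in> P. g w div 2 ^ k = x div 2 ^ k \<and> x < g w} =
    (\<Sum>i<k. if bit x i then 0 else card {w \<in> P. g w div 2 ^ Suc i = x div 2 ^ Suc i \<and> bit (g w) i})"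
proof (induction k)
  case (Suc k)
  let ?A = "{w \<in> P. g w div 2 ^ k = x div 2 ^ k \<and> x < g w}"
  let ?B = "{w \<in> P. \<not> bit x k \<and> g w div 2 ^ Suc k = x div 2 ^ Suc k \<and> bit (g w) k}"
  have key: "y div 2 ^ Suc k = x div 2 ^ Suc k \<and> x < y \<longleftrightarrow>
      (y div 2 ^ k = x div 2 ^ k \<and> x < y) \<or> (\<not> bit x k \<and> y div 2 ^ Suc k = x div 2 ^ Suc k \<and> bit y k)"
    and dis: "\<not> ((y div 2 ^ k = x div 2 ^ k) \<and> (\<not> bit x k \<and> bit y k))" for y :: nat
  proof -
    let ?y = "y div 2 ^ k" and ?x = "x div 2 ^ k"
    have d: "z div 2 ^ Suc k = (z div 2 ^ k) div 2" for z :: nat by (simp only: power_Suc2 div_mult2_eq)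
    have less: "?x < ?y \<Longrightarrow> x < y" "x < y \<Longrightarrow> ?x \<le> ?y"
      by (meson div_le_mono not_le) (simp add: div_le_mono)
    have b: "bit x k = odd ?x" "bit y k = odd ?y" by (simp_all add: bit_iff_odd)
    show "\<not> (?y = ?x \<and> (\<not> bit x k \<and> bit y k))" using b by simp
    have p1: "b = a \<or> (even b \<and> odd a)" if "a div 2 = b div 2" "b \<le> a" for a b :: nat
      using that by presburger
    have p2: "b < a" if "a div 2 = b div 2" "even b" "odd a" for a b :: nat
      using that by presburger
    note p = p1[of ?y ?x] p2[of ?y ?x]
    show "y div 2 ^ Suc k = x div 2 ^ Suc k \<and> x < y \<longleftrightarrow>
      (?y = ?x \<and> x < y) \<or> (\<not> bit x k \<and> y div 2 ^ Suc k = x div 2 ^ Suc k \<and> bit y k)"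
      unfolding d b using p less by metis
  qed
  have "{w \<in> P. g w div 2 ^ Suc k = x div 2 ^ Suc k \<and> x < g w} = ?A \<union> ?B" using key by blast
  moreover have "?A \<inter> ?B = {}" using dis by blast
  moreover have "finite ?A" "finite ?B" using assms by auto
  ultimately have "card {w \<in> P. g w div 2 ^ Suc k = x div 2 ^ Suc k \<and> x < g w} = card ?A + card ?B"
    by (simp only: card_Un_disjoint)
  then show ?case using Suc by simp
next
  case 0
  have "{w \<in> P. g w = x \<and> x < g w} = {}" by auto
  then show ?case by (simp only: power_0 div_by_1 lessThan_0 sum.empty card.empty)
qed

lemma zip_tl_snoc: "q \<noteq> [] \<Longrightarrow> zip (q @ [v]) (tl (q @ [v])) = zip q (tl q) @ [(last q, v)]"
proof (induction q)
  case (Cons a q)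
  then show ?case by (cases q) auto
qed simp

context rooted_tree
begin

lemma r_in_V: "r \<in> V" by (rule root)

definition S :: "node \<Rightarrow> nat" where "S v = card (desc v)"

lemma S_subtree_size: "S v = subtree_size V E r v"
  by (simp add: S_def subtree_size_def desc_def)

lemma desc_mono: "u \<in> set (rp v) \<Longrightarrow> desc v \<subseteq> desc u"
  using anc_trans by (auto simp: mem_desc)

lemma S_mono: "u \<in> set (rp v) \<Longrightarrow> S v \<le> S u"
  unfolding S_def by (intro card_mono desc_mono) auto

lemma self_desc: "v \<in> V \<Longrightarrow> v \<in> desc v"
  by (simp add: mem_desc self_in_rp)

lemma S_pos: "v \<in> V \<Longrightarrow> 0 < S v"
  unfolding S_def using self_desc card_gt_0_iff finite_desc by blast

lemma S_le: "S v \<le> card V"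
  unfolding S_def using finite_V desc_subset by (rule card_mono)

lemma par_in_rp: "v \<in> V \<Longrightarrow> v \<noteq> r \<Longrightarrow> par v \<in> set (rp v)"
  using set_rp_par[of v] self_in_rp[of "par v"] rp_snoc(2)[of v] by simp

lemma not_in_rp_par: "v \<in> V \<Longrightarrow> v \<noteq> r \<Longrightarrow> v \<notin> set (rp (par v))"
  using anc_dep[of "par v" v] dep_par[of v] rp_snoc(2)[of v] by fastforce

lemma anc_antisym: "u \<in> V \<Longrightarrow> v \<in> V \<Longrightarrow> u \<in> set (rp v) \<Longrightarrow> v \<in> set (rp u) \<Longrightarrow> u = v"
  using anc_dep[of u v] anc_dep[of v u] by force

lemma S_par: "v \<in> V \<Longrightarrow> v \<noteq> r \<Longrightarrow> S v < S (par v)"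
proof -
  assume v: "v \<in> V" "v \<noteq> r"
  have "desc v \<subset> desc (par v)"
    using desc_mono[OF par_in_rp[OF v]] self_desc[of "par v"] rp_snoc(2)[OF v] not_in_rp_par[OF v]
    by (auto simp: mem_desc)
  then show ?thesis unfolding S_def by (intro psubset_card_mono) auto
qed

lemma S_anc: "v \<in> V \<Longrightarrow> u \<in> set (rp v) \<Longrightarrow> u \<noteq> v \<Longrightarrow> S v < S u"
proof -
  assume v: "v \<in> V" "u \<in> set (rp v)" "u \<noteq> v"
  have "v \<noteq> r" using v by auto
  then have "u \<in> set (rp (par v))" using v by (simp add: set_rp_par)
  then have "S (par v) \<le> S u" by (rule S_mono)
  then show ?thesis using S_par[OF v(1) \<open>v \<noteq> r\<close>] by simp
qed

lemma child_towards:
  "w \<in> V \<Longrightarrow> u \<in> set (rp w) \<Longrightarrow> u \<noteq> w \<Longrightarrow> \<exists>x\<in>V. x \<noteq> r \<and> par x = u \<and> x \<in> set (rp w)"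
proof (induction rule: tree_induct)
  case (par w)
  then have u: "u \<in> set (rp (par w))" by (simp add: set_rp_par)
  show ?case
  proof (cases "u = par w")
    case True
    then show ?thesis using par self_in_rp by blast
  next
    case False
    then obtain x where "x \<in> V" "x \<noteq> r" "par x = u" "x \<in> set (rp (par w))" using par.IH u by blast
    then show ?thesis using par by (auto simp: set_rp_par)
  qed
qed auto

end

text \<open>\<open>hv v\<close> says that the parent edge of \<open>v\<close> is heavy; naming edges
  by their lower endpoints leaves the choice among children of equal size open.\<close>

locale heavy_tree = rooted_tree +
  fixes hv :: "node \<Rightarrow> bool"
  assumes hv_root: "\<not> hv r"
    and hv_child: "\<And>v. v \<in> V \<Longrightarrow> v \<noteq> r \<Longrightarrow> \<exists>w\<in>V. w \<noteq> r \<and> par w = par v \<and> hv w \<and>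
      (\<forall>x\<in>V. x \<noteq> r \<longrightarrow> par x = par v \<longrightarrow> S x \<le> S w \<and> (hv x \<longleftrightarrow> x = w))"
begin

definition heavy_edges :: "edge set" where
  "heavy_edges = {{v, par v} | v. v \<in> V \<and> v \<noteq> r \<and> hv v}"

text \<open>A root path ends in a run of nodes with heavy parent edges. The node just before the run
  is the upper end of the heavy path of \<open>v\<close>, and \<open>pos v\<close> is the length of
  the run.\<close>

definition head :: "node \<Rightarrow> node" where
  "head v = last (filter (\<lambda>x. \<not> hv x) (rp v))"

definition pos :: "node \<Rightarrow> nat" where
  "pos v = length (takeWhile hv (rev (rp v)))"

lemma head_root [simp]: "head r = r" by (simp add: head_def hv_root)
lemma pos_root [simp]: "pos r = 0" by (simp add: pos_def hv_root)

lemma head_par: "v \<in> V \<Longrightarrow> v \<noteq> r \<Longrightarrow> head v = (if hv v then head (par v) else v)"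
  by (simp add: head_def rp_snoc(1))

lemma pos_par: "v \<in> V \<Longrightarrow> v \<noteq> r \<Longrightarrow> pos v = (if hv v then Suc (pos (par v)) else 0)"
  by (simp add: pos_def rp_snoc(1))

lemma head_light: "v \<in> V \<Longrightarrow> \<not> hv v \<Longrightarrow> head v = v"
  using head_par by (cases "v = r") auto

lemma hv_unique: "v \<in> V \<Longrightarrow> v \<noteq> r \<Longrightarrow> w \<in> V \<Longrightarrow> w \<noteq> r \<Longrightarrow> par v = par w \<Longrightarrow> hv v \<Longrightarrow> hv w \<Longrightarrow> v = w"
proof -
  assume *: "v \<in> V" "v \<noteq> r" "w \<in> V" "w \<noteq> r" "par v = par w" "hv v" "hv w"
  obtain x where x: "\<forall>y\<in>V. y \<noteq> r \<longrightarrow> par y = par v \<longrightarrow> S y \<le> S x \<and> (hv y \<longleftrightarrow> y = x)"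
    using hv_child[OF *(1,2)] by blast
  have "v = x" using x *(1,2,6) by blast
  moreover have "w = x" using x *(3,4,5,7) by simp
  ultimately show "v = w" by simp
qed

lemma head_props: "v \<in> V \<Longrightarrow> head v \<in> set (rp v) \<and> head v \<in> V \<and> \<not> hv (head v)"
proof (induction rule: tree_induct)
  case root
  then show ?case by (simp add: r_in_V hv_root)
next
  case (par v)
  then show ?case by (auto simp: head_par set_rp_par)
qed

lemma heavy_edge_iff:
  assumes "v \<in> V" "v \<noteq> r"
  shows "{v, par v} \<in> heavy_edges \<longleftrightarrow> hv v"
proof
  assume "{v, par v} \<in> heavy_edges"
  then obtain x where "x \<in> V" "x \<noteq> r" "hv x" "{v, par v} = {x, par x}" unfolding heavy_edges_def by blast
  then show "hv v" using parent_edge_inj[OF assms] by simp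
next
  assume "hv v"
  then show "{v, par v} \<in> heavy_edges"
    unfolding heavy_edges_def using assms by (intro CollectI exI[of _ v] conjI) simp_all
qed

lemma heavy_light: "heavy_light V E r heavy_edges"
  unfolding heavy_light_def
proof (intro conjI ballI impI)
  show "heavy_edges \<subseteq> E" using rp_snoc(3) by (auto simp: heavy_edges_def)
  fix u assume u: "u \<in> V" "children V E r u \<noteq> {}"
  then obtain v where v: "v \<in> V" "v \<noteq> r" "par v = u" using children_eq by blast
  obtain w where w: "w \<in> V" "w \<noteq> r" "par w = u"
    "\<forall>x\<in>V. x \<noteq> r \<longrightarrow> par x = u \<longrightarrow> S x \<le> S w \<and> (hv x \<longleftrightarrow> x = w)"
    using hv_child[OF v(1,2)] v(3) by auto
  show "\<exists>v\<in>children V E r u. (\<forall>w\<in>children V E r u. subtree_size V E r w \<le> subtree_size V E r v) \<and>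
          (\<forall>w\<in>children V E r u. ({u, w} \<in> heavy_edges) = (w = v))"
  proof (intro bexI[of _ w] conjI ballI)
    fix x assume "x \<in> children V E r u"
    then have x: "x \<in> V" "x \<noteq> r" "par x = u" using children_eq[OF u(1)] by auto
    show "subtree_size V E r x \<le> subtree_size V E r w" using w x by (simp flip: S_subtree_size)
    show "({u, x} \<in> heavy_edges) = (x = w)"
      using heavy_edge_iff[OF x(1,2)] w(4) x by (simp add: insert_commute)
  next
    show "w \<in> children V E r u" unfolding children_eq[OF u(1)] using w(1-3) by simp
  qed
qed

lemma head_par_iff: "v \<in> V \<Longrightarrow> v \<noteq> r \<Longrightarrow> head (par v) = head v \<longleftrightarrow> hv v"
proof -
  assume v: "v \<in> V" "v \<noteq> r"
  have "head (par v) \<noteq> v" using head_props[of "par v"] not_in_rp_par[OF v] rp_snoc(2)[OF v] by auto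
  then show ?thesis using head_par[OF v] by auto
qed

lemma heavy_below_head:
  "w \<in> V \<Longrightarrow> x \<in> set (rp w) \<Longrightarrow> head w \<in> set (rp x) \<Longrightarrow> x \<noteq> head w \<Longrightarrow> hv x"
proof (induction rule: tree_induct)
  case (par w)
  show ?case
  proof (cases "hv w")
    case True
    then show ?thesis using par by (auto simp: head_par set_rp_par)
  next
    case False
    then have "head w = w" using par by (simp add: head_par)
    moreover have "x \<in> V" using par set_rp by blast
    ultimately show ?thesis using anc_antisym[of x w] par by auto
  qed
qed auto

text \<open>The child of \<open>u\<close> towards \<open>w\<close> lies strictly below the common
  head, so its parent edge is heavy, and \<open>u\<close> has only one such child.\<close>

lemma heavy_towards:
  assumes "w \<in> V" "u \<in> V" "head w = head u" "u \<in> set (rp w)" "u \<noteq> w" "v \<in> V" "v \<noteq> r" "par v = u" "hv v"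
  shows "v \<in> set (rp w)"
proof -
  obtain x where x: "x \<in> V" "x \<noteq> r" "par x = u" "x \<in> set (rp w)" using child_towards assms by blast
  have h: "head u \<in> set (rp u)" using head_props assms by blast
  then have "head w \<in> set (rp x)" using assms x by (simp add: set_rp_par)
  moreover have "x \<noteq> head w" using assms x not_in_rp_par[of x] h by auto
  ultimately have "hv x" using heavy_below_head[OF assms(1) x(4)] by blast
  then have "x = v" using hv_unique[of x v] x assms by simp
  then show ?thesis using x by simp
qed

lemma heavy_path_linear:
  "w \<in> V \<Longrightarrow> u \<in> V \<Longrightarrow> head w = head u \<Longrightarrow> w \<in> set (rp u) \<or> u \<in> set (rp w)"
proof (induction rule: tree_induct)
  case root
  then show ?case using head_props[of u] by simp
next
  case (par w)
  show ?case
  proof (cases "hv w")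
    case True
    then have h: "head (par w) = head u" using par by (simp add: head_par)
    show ?thesis
    proof (cases "par w \<in> set (rp u) \<and> par w \<noteq> u")
      case True
      then show ?thesis using heavy_towards[of u "par w" w] par h \<open>hv w\<close> by auto
    next
      case False
      then show ?thesis using par h by (auto simp: set_rp_par self_in_rp)
    qed
  next
    case False
    then show ?thesis using par head_props[of u] by (simp add: head_par)
  qed
qed

text \<open>Sizes strictly decrease down a heavy path, so the nodes of the path above
  \<open>v\<close> are exactly those of larger size. A position thereby becomes a plain
  count.\<close>

lemma card_above:
  "v \<in> V \<Longrightarrow> card {w \<in> V. head w = head v \<and> S v < S w} = pos v"
proof (induction rule: tree_induct)
  case root
  have "\<not> S r < S w" for w using S_le[of w] by (simp add: S_def[of r] desc_root)
  then have "{w \<in> V. head w = head r \<and> S r < S w} = {}" by blast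
  then show ?case by (simp only: card.empty pos_root)
next
  case (par v)
  show ?case
  proof (cases "hv v")
    case False
    then have "head v = v" using par by (simp add: head_light)
    then have "\<not> S v < S w" if "w \<in> V" "head w = head v" for w
      using S_mono[of v w] head_props[OF that(1)] that(2) by simp
    then have "{w \<in> V. head w = head v \<and> S v < S w} = {}" by blast
    moreover have "pos v = 0" using False par(1,2) by (simp add: pos_par)
    ultimately show ?thesis by (simp only: card.empty)
  next
    case True
    let ?u = "par v"
    have hu: "head ?u = head v" using True par(1,2) by (simp add: head_par_iff)
    have Su: "S v < S ?u" using S_par[OF par(1,2)] .
    have "{w \<in> V. head w = head v \<and> S v < S w} = insert ?u {w \<in> V. head w = head ?u \<and> S ?u < S w}"
      (is "?L = ?R")
    proof
      show "?R \<subseteq> ?L" using par(3) hu Su by auto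
      show "?L \<subseteq> ?R"
      proof
        fix w assume "w \<in> ?L"
        then have w: "w \<in> V" "head w = head ?u" "S v < S w" using hu by auto
        have "w = ?u \<or> S ?u < S w"
        proof (rule ccontr)
          assume n: "\<not> ?thesis"
          then have "w \<notin> set (rp ?u)" using S_anc[of ?u w] par by auto
          then have "?u \<in> set (rp w)" using heavy_path_linear[of w ?u] w par by blast
          then have "v \<in> set (rp w)" using heavy_towards[of w ?u v] w par n True by auto
          then show False using S_mono[of v w] w(3) by simp
        qed
        then show "w \<in> ?R" using w by auto
      qed
    qed
    moreover have "card (insert ?u {w \<in> V. head w = head ?u \<and> S ?u < S w}) =
        Suc (card {w \<in> V. head w = head ?u \<and> S ?u < S w})"
      by (rule card_insert_disjoint) (simp_all add: finite_V)
    moreover have "pos v = Suc (pos ?u)" using par(1,2) True by (simp add: pos_par)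
    ultimately show ?thesis using par.IH by (simp only:)
  qed
qed

text \<open>Apart from the test of the own bit, a summand depends on \<open>v\<close> only through
  \<open>(head v, S v div 2 ^ Suc i)\<close>, so one contraction serves all nodes sharing this
  pair.\<close>

lemma pos_bits:
  assumes "v \<in> V" "card V < 2 ^ k"
  shows "pos v = (\<Sum>i<k. if bit (S v) i then 0 else
    card {w \<in> V. (head w, S w div 2 ^ Suc i) = (head v, S v div 2 ^ Suc i) \<and> bit (S w) i})"
proof -
  let ?P = "{w \<in> V. head w = head v}"
  have z: "S w div 2 ^ k = 0" for w using S_le[of w] assms(2) by simp
  have "{w \<in> ?P. S w div 2 ^ k = S v div 2 ^ k \<and> S v < S w} = {w \<in> V. head w = head v \<and> S v < S w}"
    unfolding z by blast
  then have "pos v = card {w \<in> ?P. S w div 2 ^ k = S v div 2 ^ k \<and> S v < S w}"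
    using card_above[OF assms(1)] by (simp only:)
  also have "\<dots> = (\<Sum>i<k. if bit (S v) i then 0
      else card {w \<in> ?P. S w div 2 ^ Suc i = S v div 2 ^ Suc i \<and> bit (S w) i})"
    using finite_V by (intro card_greater_bits) simp
  finally have *: "pos v = (\<Sum>i<k. if bit (S v) i then 0
      else card {w \<in> ?P. S w div 2 ^ Suc i = S v div 2 ^ Suc i \<and> bit (S w) i})" .
  have "{w \<in> ?P. S w div 2 ^ Suc i = S v div 2 ^ Suc i \<and> bit (S w) i} =
      {w \<in> V. (head w, S w div 2 ^ Suc i) = (head v, S v div 2 ^ Suc i) \<and> bit (S w) i}" for i by blast
  then show ?thesis unfolding * by (simp only:)
qed

lemma head_connected: "connected_classes head"
proof -
  have "head x = x" if "x \<in> tops head" for x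
    using that head_par_iff[of x] head_light[of x] by (cases "x = r") (auto simp: tops_def)
  then show ?thesis unfolding connected_classes_def by (metis inj_onI)
qed

text \<open>Along a heavy path the sizes, and hence their quotients by \<open>k\<close>, are
  monotone, so nodes with equal quotient are consecutive on the path.\<close>

lemma head_prefix_connected: "connected_classes (\<lambda>v. (head v, S v div k))"
  unfolding connected_classes_def
proof (rule inj_onI)
  let ?f = "\<lambda>v. (head v, S v div k)"
  have key: "x = y" if x: "x \<in> tops ?f" and y: "y \<in> tops ?f" and f: "?f x = ?f y" and a: "x \<in> set (rp y)" for x y
  proof (rule ccontr)
    assume ne: "x \<noteq> y"
    have V: "x \<in> V" "y \<in> V" using x y by (auto simp: tops_def)
    have yr: "y \<noteq> r" using a ne by auto
    have "hv y"
    proof (rule ccontr)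
      assume "\<not> hv y"
      then have "head x = y" using head_light[OF V(2)] f by simp
      then have "y \<in> set (rp x)" using head_props[OF V(1)] by simp
      then show False using anc_antisym V a ne by blast
    qed
    then have h: "head (par y) = head y" using head_par_iff V yr by blast
    have "x \<in> set (rp (par y))" using a ne V yr by (simp add: set_rp_par)
    then have "S (par y) \<le> S x" by (rule S_mono)
    moreover have "S y \<le> S (par y)" using S_par[OF V(2) yr] by simp
    ultimately have "S y div k \<le> S (par y) div k" "S (par y) div k \<le> S x div k" by (auto intro: div_le_mono)
    then have "S (par y) div k = S y div k" using f by simp
    then show False using y yr h by (simp add: tops_def)
  qed
  fix x y assume x: "x \<in> tops ?f" and y: "y \<in> tops ?f" and f: "?f x = ?f y"
  have V: "x \<in> V" "y \<in> V" using x y by (auto simp: tops_def)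
  then have "x \<in> set (rp y) \<or> y \<in> set (rp x)" using heavy_path_linear f by simp
  then show "x = y" using key[OF x y f] key[OF y x f[symmetric]] by metis
qed

text \<open>The heavy sibling has a subtree at least as large as that of \<open>v\<close> and
  disjoint from it.\<close>

lemma light_S:
  assumes "v \<in> V" "v \<noteq> r" "\<not> hv v"
  shows "2 * S v \<le> S (par v)"
proof -
  obtain w where w: "w \<in> V" "w \<noteq> r" "par w = par v" "hv w" "S v \<le> S w" using hv_child[OF assms(1,2)] assms by auto
  have "v \<noteq> w" using w assms by blast
  have "desc v \<inter> desc w = {}"
  proof (rule ccontr)
    assume "desc v \<inter> desc w \<noteq> {}"
    then obtain x where "x \<in> V" "v \<in> set (rp x)" "w \<in> set (rp x)" by (auto simp: mem_desc)
    then have "v \<in> set (rp w) \<or> w \<in> set (rp v)" using anc_linear by blast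
    then have "v \<in> set (rp (par v)) \<or> w \<in> set (rp (par w))"
      using w assms \<open>v \<noteq> w\<close> by (auto simp: set_rp_par)
    then show False using not_in_rp_par w assms by blast
  qed
  then have "S v + S w = card (desc v \<union> desc w)" unfolding S_def by (simp add: card_Un_disjoint)
  also have "\<dots> \<le> S (par v)"
    unfolding S_def using desc_mono[OF par_in_rp[OF assms(1,2)]] desc_mono[OF par_in_rp[OF w(1,2)]] w(3)
    by (intro card_mono) auto
  finally show ?thesis using w by simp
qed

abbreviation info :: "node \<Rightarrow> hl_info" where "info v \<equiv> hl_info_of E r heavy_edges v"

lemma fst_info: "fst (info v) = dep v"
  by (simp add: hl_info_of_def Let_def dep_def)

lemma info_root: "info r = (0, [])"
  by (simp add: hl_info_of_def Let_def dep_root[unfolded dep_def] rp_root[unfolded rp_def])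

lemma info_par:
  assumes v: "v \<in> V" "v \<noteq> r"
  shows "info v = (Suc (dep (par v)), snd (info (par v)) @
    (if hv v then [] else [((dep (par v), par v), (Suc (dep (par v)), v))]))"
proof -
  have p: "par v \<in> V" "{par v, v} \<in> E" using rp_snoc[OF v] by (auto simp: insert_commute)
  have z: "zip (rp v) (tl (rp v)) = zip (rp (par v)) (tl (rp (par v))) @ [(par v, v)]"
    using zip_tl_snoc[of "rp (par v)" v] rp_nonempty[OF p(1)] rp_last[OF p(1)] rp_snoc(1)[OF v] by simp
  show ?thesis
    using heavy_edge_iff[OF v] dep_par[OF v] p
    by (simp add: hl_info_of_def Let_def rp_def[symmetric] dep_def[symmetric] z insert_commute)
qed

lemma info_head:
  "v \<in> V \<Longrightarrow> info v = (if head v = r then (pos v, []) else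
     (let a = par (head v) in
       (dep a + 1 + pos v, snd (info a) @ [((dep a, a), (dep a + 1, head v))])))"
proof (induction rule: tree_induct)
  case root
  then show ?case by (simp add: info_root)
next
  case (par v)
  show ?case
  proof (cases "hv v")
    case True
    then have "head v = head (par v)" "pos v = Suc (pos (par v))" using par by (auto simp: head_par pos_par)
    moreover have "info v = (Suc (fst (info (par v))), snd (info (par v)))"
      using info_par[OF par(1,2)] True by (simp add: fst_info)
    ultimately show ?thesis using par.IH by (simp add: Let_def split: if_splits)
  next
    case False
    then have "head v = v" "pos v = 0" using par by (auto simp: head_par pos_par)
    then show ?thesis using info_par[OF par(1,2)] False par(2) by (simp add: Let_def)
  qed
qed

text \<open>The light edges above \<open>v\<close> from the bottom upwards, each with the position
  of its upper endpoint. The tail is the list of that upper endpoint, which allows the lists to be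
  passed down one entry per stage.\<close>

function items :: "node \<Rightarrow> (nat \<times> node \<times> node) list" where
  "items v = (if v \<notin> V \<or> head v = r then []
     else (pos (par (head v)), par (head v), head v) # items (par (head v)))"
  by auto
termination
proof (relation "measure dep")
  fix v assume "\<not> (v \<notin> V \<or> head v = r)"
  then have v: "v \<in> V" "head v \<noteq> r" by auto
  then have "dep (head v) \<le> dep v" using anc_dep head_props by blast
  then show "(par (head v), v) \<in> measure dep" using dep_par[of "head v"] head_props[OF v(1)] v by simp
qed simp

declare items.simps [simp del]

lemma items_par_head:
  "v \<in> V \<Longrightarrow> head v \<noteq> r \<Longrightarrow> par (head v) \<in> V \<and> 2 * S v \<le> S (par (head v))"
proof -
  assume v: "v \<in> V" "head v \<noteq> r"
  have h: "head v \<in> V" "\<not> hv (head v)" "head v \<in> set (rp v)" using head_props[OF v(1)] by auto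
  have "S v \<le> S (head v)" using S_mono[OF h(3)] .
  then show ?thesis using light_S[OF h(1) v(2) h(2)] rp_snoc(2)[OF h(1) v(2)] by simp
qed

text \<open>Passing a light edge at least doubles the subtree size; this bounds the number of
  fetching stages by a logarithm.\<close>

lemma length_items: "v \<in> V \<Longrightarrow> 2 ^ length (items v) * S v \<le> card V"
proof (induction v rule: items.induct)
  case (1 v)
  show ?case
  proof (cases "head v = r")
    case True
    then show ?thesis using S_le by (simp add: items.simps)
  next
    case False
    note p = items_par_head[OF 1(2) False]
    have "2 ^ length (items v) * S v = 2 ^ length (items (par (head v))) * (2 * S v)"
      using False 1(2) by (simp add: items.simps[of v])
    also have "\<dots> \<le> 2 ^ length (items (par (head v))) * S (par (head v))" using p by simp
    also have "\<dots> \<le> card V" using 1 False p by simp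
    finally show ?thesis .
  qed
qed

end

text \<open>Depths are recovered from positions: a node is \<open>p\<close> levels below the head of
  its path, and the head is one level below the upper endpoint of its light edge.\<close>

fun assemble :: "nat \<Rightarrow> (nat \<times> node \<times> node) list \<Rightarrow> hl_info" where
  "assemble p [] = (p, [])"
| "assemble p ((q, a, b) # xs) = (let (d, ls) = assemble q xs in
     (d + 1 + p, ls @ [((d, a), (d + 1, b))]))"

lemma (in heavy_tree) assemble_items: "v \<in> V \<Longrightarrow> assemble (pos v) (items v) = info v"
proof (induction v rule: items.induct)
  case (1 v)
  show ?case
  proof (cases "head v = r")
    case True
    then show ?thesis using info_head[OF 1(2)] by (simp add: items.simps)
  next
    case False
    let ?a = "par (head v)"
    have "assemble (pos ?a) (items ?a) = info ?a" using 1 False items_par_head by blast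
    moreover have "info ?a = (dep ?a, snd (info ?a))" using fst_info by (metis prod.collapse)
    ultimately have "assemble (pos ?a) (items ?a) = (dep ?a, snd (info ?a))" by simp
    then show ?thesis using info_head[OF 1(2)] 1(2) False by (simp add: items.simps[of v] Let_def)
  qed
qed

section \<open>The algorithm\<close>

definition base :: "nat \<Rightarrow> nat" where
  "base l = 2 ^ Suc l"

text \<open>\<open>4 * (l + 1)\<close> sweeps of \<open>2 * (l + 1)\<close> steps each, as in
  \<open>lab_final\<close>.\<close>

definition merges :: "nat \<Rightarrow> nat" where
  "merges l = 2 * (l + 1) * (4 * (l + 1))"

text \<open>With \<open>T = merges l\<close>, the stages are:
  \<^item> stage \<open>0\<close> counts the nodes;
  \<^item> stages \<open>1 + t\<close> for \<open>t \<le> T\<close> compute the cluster labels after \<open>t + 1\<close> merging steps;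
  \<^item> stages \<open>2 * T + 1 - t\<close> for \<open>t < T\<close> undo the merging steps in reverse order; when step \<open>t\<close> is
    undone, the edges along which it merged learn the weight of the sides of the tree that they
    separate, where the root has an additional weight of \<open>base l\<close>;
  \<^item> stages \<open>2 * T + 2\<close> and \<open>2 * T + 3\<close> compute the subtree sizes and the heavy children;
  \<^item> stages \<open>2 * T + 4 + l - i\<close> for \<open>i \<le> l\<close> determine the positions on the heavy paths: since
    subtree sizes decrease along a heavy path, a position is a number of nodes of larger size, and the
    nodes whose size first differs in bit \<open>i\<close> are counted separately;
  \<^item> stages \<open>2 * T + 5 + l + j\<close> for \<open>j \<le> l\<close> fetch the \<open>j\<close>-th last light edge on the root path.\<close>

definition num_stages :: "nat \<Rightarrow> nat" where
  "num_stages l = 2 * merges l + 2 * l + 6"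

text \<open>The aggregate of a merging stage holds, from the lowest digit on, the degree, the number
  of candidates and the sum of their labels.\<close>

fun label :: "nat \<Rightarrow> nat \<Rightarrow> (nat \<Rightarrow> nat) \<Rightarrow> nat \<Rightarrow> nat" where
  "label l a Z 0 = a"
| "label l a Z (Suc t) =
     (let z = Z (1 + t) in
      if z mod base l \<le> 2 \<and> z div base l mod base l = 1 then z div base l div base l
      else label l a Z t)"

definition size_of :: "nat \<Rightarrow> (nat \<Rightarrow> nat) \<Rightarrow> nat" where
  "size_of l Z = 1 + Z (2 * merges l + 2)"

definition heavy_of :: "nat \<Rightarrow> (nat \<Rightarrow> nat) \<Rightarrow> nat" where
  "heavy_of l Z = Z (2 * merges l + 3) mod base l"

definition pos_of :: "nat \<Rightarrow> (nat \<Rightarrow> nat) \<Rightarrow> (nat \<Rightarrow> nat) \<Rightarrow> nat" where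
  "pos_of l Y Z = (\<Sum>i<Suc l. if bit (size_of l Z) i then 0 else Y (2 * merges l + 4 + l - i))"

text \<open>The number of nodes, learned in stage 0, accompanies the labels because
  \<open>edge_side\<close> needs the total weight. Stage \<open>merges l + 1\<close> announces the
  labels after all \<open>merges l\<close> steps.\<close>

definition announce :: "nat \<Rightarrow> nat \<Rightarrow> node \<Rightarrow> bool \<Rightarrow> (nat \<Rightarrow> nat) \<Rightarrow> (nat \<Rightarrow> nat) \<Rightarrow> nat" where
  "announce l k v i Y Z =
     (if k = 0 then 0
      else if k \<le> merges l + 1 then label l (num v) Z (k - 1) + base l * Y 0
      else if k \<le> 2 * merges l + 2 then Y (k - 1) + Z (k - 1)
      else if k = 2 * merges l + 3 then 0
      else if k \<le> 2 * merges l + 4 + l then heavy_of l Z + base l * size_of l Z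
      else if k = 2 * merges l + 5 + l then pos_of l Y Z
      else Z (k - 1))"

definition contrib :: "nat \<Rightarrow> nat \<Rightarrow> node \<Rightarrow> bool \<Rightarrow> (nat \<Rightarrow> nat) \<Rightarrow> (nat \<Rightarrow> nat) \<Rightarrow> nat" where
  "contrib l k v i Y Z =
     (if k = 0 then 1
      else if k \<le> merges l + 1 then 0
      else if k \<le> 2 * merges l + 1 then 1 + (if i then base l else 0)
      else if 2 * merges l + 4 \<le> k \<and> k \<le> 2 * merges l + 4 + l
        then of_bool (bit (size_of l Z) (2 * merges l + 4 + l - k))
      else 0)"

definition edge_label :: "nat \<Rightarrow> (nat \<Rightarrow> nat) \<Rightarrow> nat \<Rightarrow> nat" where
  "edge_label l a t = a (1 + t) mod base l"

text \<open>\<open>t\<close> is the step that merged the ends. If the class of the first end was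
  absorbed, its count is the weight of its side; otherwise the other class was absorbed, and its
  count is subtracted from the total weight, the number of nodes plus \<open>base l\<close>.\<close>

definition edge_side :: "nat \<Rightarrow> (nat \<Rightarrow> nat) \<Rightarrow> (nat \<Rightarrow> nat) \<Rightarrow> nat" where
  "edge_side l a b =
     (let t = (LEAST t. edge_label l a (Suc t) = edge_label l b (Suc t)) in
      if edge_label l a (Suc t) \<noteq> edge_label l a t then a (2 * merges l + 2 - t)
      else a 1 div base l + base l - b (2 * merges l + 2 - t))"

definition edge_heavy :: "nat \<Rightarrow> node \<Rightarrow> (nat \<Rightarrow> nat) \<Rightarrow> node \<Rightarrow> (nat \<Rightarrow> nat) \<Rightarrow> bool" where
  "edge_heavy l v a w b \<longleftrightarrow>
     a (2 * merges l + 4) mod base l = num w \<or> b (2 * merges l + 4) mod base l = num v"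

definition join :: "nat \<Rightarrow> nat \<Rightarrow> node \<Rightarrow> (nat \<Rightarrow> nat) \<Rightarrow> node \<Rightarrow> (nat \<Rightarrow> nat) \<Rightarrow> bool" where
  "join l k v a w b \<longleftrightarrow>
     (if k = 0 then True
      else if k \<le> merges l + 1 then edge_label l a (k - 1) = edge_label l b (k - 1)
      else if k \<le> 2 * merges l + 1
        then edge_label l a (2 * merges l + 1 - k) = edge_label l b (2 * merges l + 1 - k)
      else if k \<le> 2 * merges l + 3 then False
      else if k \<le> 2 * merges l + 4 + l
        then edge_heavy l v a w b \<and>
          a (2 * merges l + 4) div base l div 2 ^ Suc (2 * merges l + 4 + l - k) =
          b (2 * merges l + 4) div base l div 2 ^ Suc (2 * merges l + 4 + l - k)
      else edge_heavy l v a w b)"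

text \<open>The receiver is \<open>v\<close>. In the stages after the unmerging,
  \<open>edge_side l b a < base l\<close> tests that \<open>w\<close> is a child of
  \<open>v\<close>, and \<open>edge_side l a b < base l\<close> that \<open>w\<close> is its
  parent.\<close>

definition deliver :: "nat \<Rightarrow> nat \<Rightarrow> node \<Rightarrow> (nat \<Rightarrow> nat) \<Rightarrow> node \<Rightarrow> (nat \<Rightarrow> nat) \<Rightarrow> nat" where
  "deliver l k v a w b =
     (if k = 0 then 0
      else if k \<le> merges l + 1 then
        1 + (if bit (edge_label l a (k - 1)) ((k - 1) div 2 mod (l + 1)) \<noteq> odd (k - 1) \<and>
               bit (edge_label l b (k - 1)) ((k - 1) div 2 mod (l + 1)) = odd (k - 1)
             then base l * (1 + base l * edge_label l b (k - 1)) else 0)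
      else if k \<le> 2 * merges l + 1 then
        (if edge_label l a (2 * merges l + 2 - k) = edge_label l b (2 * merges l + 2 - k)
         then 0 else edge_side l b a)
      else if k = 2 * merges l + 2 then
        (if edge_side l b a < base l then edge_side l b a else 0)
      else if k = 2 * merges l + 3 then
        (if edge_side l b a < base l then num w + base l * edge_side l b a else 0)
      else if k \<le> 2 * merges l + 4 + l then 0
      else if \<not> edge_heavy l v a w b \<and> edge_side l a b < base l then
        (if k = 2 * merges l + 5 + l then b k + base l * (num w + base l * num v) else b k)
      else 0)"

definition max_stage :: "nat \<Rightarrow> nat \<Rightarrow> bool" where
  "max_stage l k \<longleftrightarrow> k = 2 * merges l + 3"

definition unpack :: "nat \<Rightarrow> nat \<Rightarrow> nat \<times> node \<times> node" where
  "unpack l x = (x mod base l, inv num (x div base l mod base l), inv num (x div base l div base l))"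

text \<open>A packed light edge is never 0, so the first 0 marks the end of the list.\<close>

definition result :: "nat \<Rightarrow> node \<Rightarrow> bool \<Rightarrow> (nat \<Rightarrow> nat) \<Rightarrow> (nat \<Rightarrow> nat) \<Rightarrow> hl_info" where
  "result l v i Y Z = assemble (pos_of l Y Z) (map (unpack l)
     (takeWhile (\<lambda>x. x \<noteq> 0) (map (\<lambda>j. Z (2 * merges l + 5 + l + j)) [0..<Suc l])))"

lemma label_trunc: "t < k \<Longrightarrow> label l a (trunc k Z) t = label l a Z t"
  by (induction t) (simp_all add: Let_def)

lemma digits:
  fixes M a b c :: nat
  assumes "a < M" "b < M"
  shows "(a + M * (b + M * c)) mod M = a" "(a + M * (b + M * c)) div M mod M = b"
    "(a + M * (b + M * c)) div M div M = c" "(a + M * b) mod M = a" "(a + M * b) div M = b"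
  using assms by (auto simp: div_mult2_eq)

section \<open>Message sizes and supernodes of the concrete stages\<close>

locale hl_execution =
  staged_execution num_stages announce contrib join deliver max_stage result V E r "\<lambda>v. v = r" c
  for V E r c
begin

abbreviation "M \<equiv> base lv"
abbreviation "T \<equiv> merges lv"

lemma power_width: "2 ^ width lv = M * (M * (M * M))"
proof -
  have "width lv = Suc lv + (Suc lv + (Suc lv + Suc lv))" by (simp add: width_def)
  then show ?thesis by (simp only: base_def power_add)
qed

lemma M_ge: "2 \<le> M" by (simp add: base_def)
lemma M_pos [simp]: "0 < M" "M \<noteq> 0" using M_ge by auto

lemma small: assumes "x < M * M * M" shows "x < 2 ^ width lv"
proof -
  have "x < (M * M * M) * 1" using assms by simp
  also have "\<dots> \<le> (M * M * M) * M" using M_ge by (intro mult_left_mono) simp_all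
  finally show ?thesis by (simp only: power_width mult.assoc)
qed

lemma small1: assumes "x < M * 4" shows "x < 2 ^ width lv"
proof -
  have "M * 4 \<le> M * (M * M)" using mult_mono[OF M_ge M_ge] by (intro mult_left_mono) simp_all
  then have "x < M * M * M" unfolding mult.assoc using assms by linarith
  then show ?thesis by (rule small)
qed

lemma num_lv: "v \<in> V \<Longrightarrow> num v < M"
proof -
  assume "v \<in> V"
  then have "length v \<le> lv" unfolding lv_def using finite_V by simp
  then have "(2::nat) ^ Suc (length v) \<le> M" unfolding base_def by (intro power_increasing) auto
  then show "num v < M" using num_less[of v] by (rule less_le_trans[rotated])
qed

text \<open>\<open>num\<close> maps the distinct IDs injectively into
  \<open>{1..<M}\<close>.\<close>

lemma card_V_less: "card V < M"
proof -
  have "num ` V \<subseteq> {1..<M}" using num_lv num_pos by (auto simp: Suc_le_eq)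
  then have "card (num ` V) \<le> card {1..<M}" by (intro card_mono) auto
  moreover have "card (num ` V) = card V" using inj_num by (intro card_image) (auto simp: inj_on_def inj_def)
  ultimately show ?thesis using M_ge by simp
qed

lemma joined_inner:
  assumes "\<And>u w. {u, w} \<in> E \<Longrightarrow> join lv k u (trunc (Suc k) (ann u)) w (trunc (Suc k) (ann w)) \<longleftrightarrow> f u = f w"
  shows "joined k = inner E f"
proof (rule set_eqI)
  fix e
  show "e \<in> joined k \<longleftrightarrow> e \<in> inner E f"
  proof (cases "e \<in> E")
    case True
    then obtain u w where e: "e = {u, w}" using edge_cases by blast
    have "e \<in> joined k \<longleftrightarrow> f u = f w"
    proof
      assume "e \<in> joined k"
      then obtain u' w' where "e = {u', w'}" "join lv k u' (trunc (Suc k) (ann u')) w' (trunc (Suc k) (ann w'))"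
        by (auto simp: joined_def)
      then have "{u', w'} = {u, w}" "f u' = f w'" using assms[of u' w'] True e by simp_all
      then show "f u = f w" by (auto simp: doubleton_eq_iff)
    next
      assume "f u = f w"
      then have "join lv k u (trunc (Suc k) (ann u)) w (trunc (Suc k) (ann w))" using assms[of u w] True e by simp
      then show "e \<in> joined k" using True e unfolding joined_def by blast
    qed
    moreover have "e \<in> inner E f \<longleftrightarrow> f u = f w" using True e by (auto simp: inner_def)
    ultimately show ?thesis by simp
  qed (simp add: joined_def inner_def)
qed

lemma ys_cls:
  assumes "connected_classes f" "v \<in> V"
    and "\<And>u w. {u, w} \<in> E \<Longrightarrow> join lv k u (trunc (Suc k) (ann u)) w (trunc (Suc k) (ann w)) \<longleftrightarrow> f u = f w"
  shows "ys v k = (\<Sum>u\<in>cls f v. contrib lv k u (u = r) (trunc k (ys u)) (trunc k (zs u))) mod 2 ^ width lv"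
proof -
  have "supernode (joined k) v = cls f v"
    using joined_inner[OF assms(3)] supernode_inner[OF assms(1,2)] by simp
  then show ?thesis using ys_eq[OF assms(2), of k] by simp
qed

lemma zs_cls:
  assumes "connected_classes f" "v \<in> V"
    and "\<And>u w. {u, w} \<in> E \<Longrightarrow> join lv k u (trunc (Suc k) (ann u)) w (trunc (Suc k) (ann w)) \<longleftrightarrow> f u = f w"
    and "k \<noteq> 2 * T + 3"
  shows "zs v k = (\<Sum>p\<in>cut E (cls f v). delivered k p) mod 2 ^ width lv"
proof -
  have "\<not> max_stage lv k" using assms(4) by (simp add: max_stage_def)
  moreover have "supernode (joined k) v = cls f v"
    using joined_inner[OF assms(3)] supernode_inner[OF assms(1,2)] by simp
  ultimately show ?thesis using zs_sum[OF assms(2), of k] by simp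
qed

lemma ys_0: assumes "v \<in> V" shows "ys v 0 = card V"
proof -
  have cc: "connected_classes (\<lambda>_. ())" by (auto simp: connected_classes_def tops_def inj_on_def)
  have "ys v 0 = (\<Sum>u\<in>V. 1) mod 2 ^ width lv"
    using ys_cls[OF cc assms, of 0] by (simp add: join_def contrib_def cls_def)
  then show ?thesis using small1[of "card V"] card_V_less by simp
qed

subsection \<open>Merging\<close>

primrec L :: "nat \<Rightarrow> node \<Rightarrow> nat" where
  "L 0 = num"
| "L (Suc t) = merge ((t div 2) mod (lv + 1)) (odd t) (L t)"

lemma inj_connected: "inj f \<Longrightarrow> connected_classes f"
  unfolding connected_classes_def by (rule inj_on_subset[of _ UNIV]) auto

sublocale merging: cluster_merging V E r lv L
proof
  show "connected_classes (L 0)" using inj_num by (simp add: inj_connected)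
  show "v \<in> V \<Longrightarrow> L 0 v < 2 ^ (lv + 1)" for v using num_lv by (simp add: base_def)
  show "card V < 2 ^ (lv + 1)" using card_V_less by (simp add: base_def)
qed simp

lemma L_less: "v \<in> V \<Longrightarrow> L t v < M"
  using merging.lab_less by (simp add: base_def)

lemma L_final: "u \<in> V \<Longrightarrow> v \<in> V \<Longrightarrow> L T u = L T v"
  unfolding merges_def by (rule merging.lab_final)

lemma card_cut_less: "v \<in> V \<Longrightarrow> card (cut E (cls (L t) v)) < M"
proof -
  assume v: "v \<in> V"
  have "card (cut E (cls (L t) v)) = card (nbs (L t) (L t v))"
    using card_nbs[OF merging.lab_connected v] by simp
  also have "\<dots> \<le> card (L t ` V)" using finite_V nbs_subset by (intro card_mono) auto
  also have "\<dots> \<le> card V" using finite_V by (rule card_image_le)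
  finally show ?thesis using card_V_less by simp
qed

lemma ann_up:
  assumes "v \<in> V" "t \<le> T" "label lv (num v) (zs v) t = L t v"
  shows "ann v (1 + t) = L t v + M * card V"
proof -
  have "announce lv (1 + t) v (v = r) (trunc (1 + t) (ys v)) (trunc (1 + t) (zs v)) = L t v + M * card V"
    using assms label_trunc[of t "1 + t" lv "num v" "zs v"] ys_0 by (simp add: announce_def)
  moreover have "L t v + M * card V < M * M * M"
  proof -
    have "L t v + M * card V < M + M * card V" using L_less[OF assms(1)] by simp
    also have "\<dots> = M * Suc (card V)" by simp
    also have "\<dots> \<le> M * M" using card_V_less by (intro mult_left_mono) (simp_all add: Suc_le_eq)
    also have "\<dots> \<le> M * M * M" using M_ge by simp
    finally show ?thesis .
  qed
  ultimately show ?thesis using small by (simp add: ann_def)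
qed

text \<open>Once the labels of a step are correct, the edges contract exactly its classes and
  recognise the candidates, so the aggregate determines the labels of the next step.\<close>

lemma label_eq: "t \<le> Suc T \<Longrightarrow> \<forall>v\<in>V. label lv (num v) (zs v) t = L t v"
proof (induction t rule: less_induct)
  case (less t)
  show ?case
  proof (cases t)
    case (Suc t')
    have t': "t' \<le> T" using Suc less.prems by simp
    have lab: "edge_label lv (trunc (Suc (Suc t')) (ann u)) t' = L t' u" if "u \<in> V" for u
    proof -
      have "ann u (1 + t') = L t' u + M * card V" using ann_up[OF that t'] less Suc that by simp
      then show ?thesis using L_less[OF that] by (simp add: edge_label_def)
    qed
    have jn: "join lv (Suc t') u (trunc (Suc (Suc t')) (ann u)) w (trunc (Suc (Suc t')) (ann w)) \<longleftrightarrow> L t' u = L t' w"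
      if "{u, w} \<in> E" for u w
      using edge_nodes[OF that] lab t' by (simp add: join_def)
    define i where "i = (t' div 2) mod (lv + 1)"
    define b where "b = odd t'"
    have LS: "L (Suc t') = merge i b (L t')" by (simp add: i_def b_def)
    have main: "label lv (num v) (zs v) (Suc t') = L (Suc t') v" if v: "v \<in> V" for v
    proof -
      let ?C = "cut E (cls (L t') v)" and ?D = "candidates i b (L t') v"
      have D: "?D = {p \<in> ?C. candidate i b (L t') p}" by (simp add: candidates_def)
      have fin: "finite ?C" "finite ?D" "?D \<subseteq> ?C" using finite_cut by (auto simp: D)
      have del: "delivered (Suc t') p = 1 + (if candidate i b (L t') p then M * (1 + M * L t' (snd p)) else 0)"
        if "p \<in> ?C" for p
      proof -
        obtain u w where p: "p = (u, w)" "{u, w} \<in> E" using \<open>p \<in> ?C\<close> by (auto simp: cut_def)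
        then show ?thesis using edge_nodes[OF p(2)] lab t' by (simp add: deliver_def candidate_def i_def b_def)
      qed
      have "(\<Sum>p\<in>?C. delivered (Suc t') p) =
          (\<Sum>p\<in>?C. 1 + (if candidate i b (L t') p then M * (1 + M * L t' (snd p)) else 0))"
        using del by (rule sum.cong[OF refl])
      also have "\<dots> = card ?C + (\<Sum>p\<in>?D. M * (1 + M * L t' (snd p)))"
        unfolding D sum.distrib sum.inter_filter[OF fin(1)] by simp
      also have "\<dots> = card ?C + M * (card ?D + M * (\<Sum>p\<in>?D. L t' (snd p)))"
        unfolding sum_distrib_left[symmetric] sum.distrib by simp
      finally have z: "(\<Sum>p\<in>?C. delivered (Suc t') p) = card ?C + M * (card ?D + M * (\<Sum>p\<in>?D. L t' (snd p)))" .
      have cC: "card ?C < M" and cD: "card ?D < M"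
        using card_cut_less[OF v] card_mono[OF fin(1,3)] by (simp_all add: le_less_trans)
      have "(\<Sum>p\<in>?D. L t' (snd p)) \<le> (\<Sum>p\<in>?D. M - 1)"
      proof (rule sum_mono)
        fix p assume "p \<in> ?D"
        then obtain u w where "p = (u, w)" "{u, w} \<in> E" using fin(3) by (auto simp: cut_def)
        then show "L t' (snd p) \<le> M - 1" using L_less[of w t'] edge_nodes[of u w] by simp
      qed
      also have "\<dots> = card ?D * (M - 1)" by simp
      also have "\<dots> \<le> (M - 1) * (M - 1)" using cD by (intro mult_right_mono) linarith+
      finally have s: "(\<Sum>p\<in>?D. L t' (snd p)) \<le> (M - 1) * (M - 1)" .
      \<comment> \<open>Fewer than \<open>M\<close> candidates with labels below \<open>M\<close>
        have a label sum below \<open>M * M\<close>. With the two lower fields, each below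
        \<open>M\<close>, this fits into four digits without overflow.\<close>
      have lt: "card ?C + M * (card ?D + M * (\<Sum>p\<in>?D. L t' (snd p))) < 2 ^ width lv"
      proof -
        have "Suc ((M - 1) * (M - 1)) \<le> M * M" using M_ge by (cases M) auto
        then have "Suc (\<Sum>p\<in>?D. L t' (snd p)) \<le> M * M" using s by linarith
        then have 1: "M * Suc (\<Sum>p\<in>?D. L t' (snd p)) \<le> M * (M * M)" by (rule mult_left_mono) simp
        have "Suc (card ?D + M * (\<Sum>p\<in>?D. L t' (snd p))) \<le> M * Suc (\<Sum>p\<in>?D. L t' (snd p))" using cD by simp
        then have "Suc (card ?D + M * (\<Sum>p\<in>?D. L t' (snd p))) \<le> M * (M * M)" using 1 by (rule order_trans)
        then have 2: "M * Suc (card ?D + M * (\<Sum>p\<in>?D. L t' (snd p))) \<le> M * (M * (M * M))" by (rule mult_left_mono) simp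
        have "card ?C + M * (card ?D + M * (\<Sum>p\<in>?D. L t' (snd p))) < M * Suc (card ?D + M * (\<Sum>p\<in>?D. L t' (snd p)))"
          using cC by simp
        then show ?thesis unfolding power_width using 2 by (rule less_le_trans)
      qed
      have zz: "zs v (Suc t') = card ?C + M * (card ?D + M * (\<Sum>p\<in>?D. L t' (snd p)))"
        using zs_cls[OF merging.lab_connected v, of "Suc t'", OF jn] t' z lt by simp
      have "(\<Sum>p\<in>?D. L t' (snd p)) = (\<Sum>(u, w)\<in>?D. L t' w)" by (simp add: case_prod_beta)
      moreover have "label lv (num v) (zs v) t' = L t' v" using less Suc v by simp
      moreover have "zs v (Suc t') mod M = card ?C" "zs v (Suc t') div M mod M = card ?D"
        "zs v (Suc t') div M div M = (\<Sum>p\<in>?D. L t' (snd p))"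
        unfolding zz by (rule digits(1-3)[OF cC cD])+
      ultimately show ?thesis by (simp add: Let_def LS merge_def absorbed_def del: L.simps)
    qed
    then show ?thesis using Suc by simp
  qed simp
qed

lemma edge_label_eq:
  assumes "v \<in> V" "t \<le> T" "1 + t < k"
  shows "edge_label lv (trunc k (ann v)) t = L t v"
  using ann_up[OF assms(1,2)] label_eq[of t] assms L_less[OF assms(1), of t] by (simp add: edge_label_def)

subsection \<open>Unmerging\<close>

definition wt :: "node \<Rightarrow> nat" where
  "wt v = 1 + (if v = r then M else 0)"

text \<open>For a class absorbed in step \<open>t\<close>, the only boundary edge counted as 0 is
  the one along which it was absorbed, so this is the weight of one side of that edge.\<close>

definition q :: "nat \<Rightarrow> node \<Rightarrow> nat" where
  "q t v = sum wt (cls (L t) v) +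
     (\<Sum>(u, w)\<in>cut E (cls (L t) v). if L (Suc t) u = L (Suc t) w then 0 else side wt w u)"

lemma sum_wt: "sum wt V = card V + M"
  unfolding wt_def sum.distrib using finite_V r_in_V by simp

lemma W_less: "sum wt V < 2 ^ width lv"
  using card_V_less by (intro small1) (simp add: sum_wt)

lemma q_bounds:
  assumes "v \<in> V"
  shows "sum wt (cls (L t) v) \<le> sum wt V"
    and "(\<Sum>(u, w)\<in>cut E (cls (L t) v). if L (Suc t) u = L (Suc t) w then 0 else side wt w u) \<le> sum wt V"
    and "q t v \<le> sum wt V"
proof -
  have "(\<Sum>(u, w)\<in>cut E (cls (L t) v). if L (Suc t) u = L (Suc t) w then 0 else side wt w u)
      \<le> (\<Sum>(u, w)\<in>cut E (cls (L t) v). side wt w u)"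
    by (intro sum_mono) auto
  then show "sum wt (cls (L t) v) \<le> sum wt V"
    "(\<Sum>(u, w)\<in>cut E (cls (L t) v). if L (Suc t) u = L (Suc t) w then 0 else side wt w u) \<le> sum wt V"
    "q t v \<le> sum wt V"
    using sum_side_cut[OF merging.lab_connected assms, of wt t] by (auto simp: q_def)
qed

lemma q_side:
  assumes e: "{u, w} \<in> E" and d: "L t u \<noteq> L t w" and m: "L (Suc t) u = L (Suc t) w"
    and a: "L (Suc t) u \<noteq> L t u"
  shows "q t u = side wt u w"
proof -
  let ?C = "cut E (cls (L t) u)"
  let ?D = "{(u', w') \<in> ?C. L (Suc t) u' = L (Suc t) w'}"
  have V: "u \<in> V" using edge_nodes[OF e] by blast
  have D: "?D = {(u, w)}"
    using merged_cut[OF merging.lab_connected e d, of "(t div 2) mod (lv + 1)" "odd t"] m a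
    by (simp add: absorbed_iff_changed)
  have "(\<Sum>(u', w')\<in>?C. side wt w' u') =
      (\<Sum>p\<in>?C. if L (Suc t) (fst p) = L (Suc t) (snd p) then side wt (snd p) (fst p) else 0) +
      (\<Sum>p\<in>?C. if L (Suc t) (fst p) = L (Suc t) (snd p) then 0 else side wt (snd p) (fst p))"
    unfolding sum.distrib[symmetric] by (intro sum.cong) auto
  also have "(\<Sum>p\<in>?C. if L (Suc t) (fst p) = L (Suc t) (snd p) then side wt (snd p) (fst p) else 0) =
      (\<Sum>p\<in>?D. side wt (snd p) (fst p))"
    unfolding sum.inter_filter[OF finite_cut, symmetric] by (intro sum.cong) auto
  also have "\<dots> = side wt w u" unfolding D by simp
  finally have "sum wt V = q t u + side wt w u"
    using sum_side_cut[OF merging.lab_connected V, of wt t] by (simp add: q_def case_prod_beta)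
  then show ?thesis using side_opposite[OF e, of wt] by simp
qed

text \<open>The step that merges the clusters joined by the edge; undoing this step reveals the two
  sides of the edge.\<close>

definition lev :: "node \<Rightarrow> node \<Rightarrow> nat" where
  "lev u w = (LEAST t. L (Suc t) u = L (Suc t) w)"

lemma T_pos: "0 < T" by (simp add: merges_def)

lemma lev:
  assumes e: "{u, w} \<in> E"
  shows "lev u w < T" "L (lev u w) u \<noteq> L (lev u w) w" "L (Suc (lev u w)) u = L (Suc (lev u w)) w"
    "\<And>t. t < lev u w \<Longrightarrow> L (Suc t) u \<noteq> L (Suc t) w"
proof -
  have V: "u \<in> V" "w \<in> V" "u \<noteq> w" using edge_nodes[OF e] by auto
  have T: "L (Suc (T - 1)) u = L (Suc (T - 1)) w" using L_final[OF V(1,2)] T_pos by simp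
  show s: "L (Suc (lev u w)) u = L (Suc (lev u w)) w" unfolding lev_def by (rule LeastI[of _ "T - 1"]) (rule T)
  have "lev u w \<le> T - 1" unfolding lev_def by (rule Least_le) (rule T)
  then show "lev u w < T" using T_pos by simp
  show n: "L (Suc t) u \<noteq> L (Suc t) w" if "t < lev u w" for t
    using that unfolding lev_def by (rule not_less_Least)
  show "L (lev u w) u \<noteq> L (lev u w) w"
  proof (cases "lev u w")
    case 0
    then show ?thesis using V num_inj by auto
  next
    case (Suc t)
    then show ?thesis using n[of t] by simp
  qed
qed

lemma edge_side_eq:
  assumes e: "{u, w} \<in> E" and k: "T + 1 < k" "2 * T + 2 - lev u w < k"
    and q: "ann u (2 * T + 2 - lev u w) = q (lev u w) u" "ann w (2 * T + 2 - lev u w) = q (lev u w) w"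
  shows "edge_side lv (trunc k (ann u)) (trunc k (ann w)) = side wt u w"
proof -
  let ?t = "lev u w"
  let ?a = "trunc k (ann u)" and ?b = "trunc k (ann w)"
  have V: "u \<in> V" "w \<in> V" using edge_nodes[OF e] by auto
  note l = lev[OF e]
  have lab: "edge_label lv ?a t = L t u" "edge_label lv ?b t = L t w" if "t \<le> T" for t
    using edge_label_eq[OF V(1) that, of k] edge_label_eq[OF V(2) that, of k] k that by simp_all
  have least: "(LEAST t. edge_label lv ?a (Suc t) = edge_label lv ?b (Suc t)) = ?t"
  proof (rule Least_equality)
    show "edge_label lv ?a (Suc ?t) = edge_label lv ?b (Suc ?t)" using lab[of "Suc ?t"] l by simp
    fix t assume t: "edge_label lv ?a (Suc t) = edge_label lv ?b (Suc t)"
    show "?t \<le> t"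
    proof (rule ccontr)
      assume "\<not> ?t \<le> t"
      then show False using lab[of "Suc t"] l(1) l(4)[of t] t by simp
    qed
  qed
  have a1: "?a 1 div M = card V"
    using ann_up[OF V(1), of 0] num_lv[OF V(1)] k(1) by simp
  have ab: "?a (2 * T + 2 - ?t) = q ?t u" "?b (2 * T + 2 - ?t) = q ?t w" using q k by simp_all
  show ?thesis
  proof (cases "L (Suc ?t) u = L ?t u")
    case False
    then show ?thesis
      using q_side[OF e l(2,3) False] ab lab[of "Suc ?t"] lab[of ?t] l(1) by (simp add: edge_side_def least)
  next
    case True
    then have "L (Suc ?t) w \<noteq> L ?t w" using l(2,3) by simp
    then have "q ?t w = side wt w u"
      using q_side[of w u ?t] e l(2,3) by (simp add: insert_commute)
    then have "edge_side lv ?a ?b = card V + M - side wt w u"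
      using True ab a1 lab[of "Suc ?t"] lab[of ?t] l(1) by (simp add: edge_side_def least del: One_nat_def)
    then show ?thesis using side_opposite[OF e, of wt] by (simp add: sum_wt)
  qed
qed

lemma ann_down:
  assumes "v \<in> V" "t < T" "ys v (2 * T + 1 - t) + zs v (2 * T + 1 - t) = q t v"
  shows "ann v (2 * T + 2 - t) = q t v"
proof -
  have k: "2 * T + 2 - t = Suc (2 * T + 1 - t)" "T + 1 < 2 * T + 2 - t" using assms(2) by simp_all
  have "announce lv (2 * T + 2 - t) v (v = r) (trunc (2 * T + 2 - t) (ys v)) (trunc (2 * T + 2 - t) (zs v)) = q t v"
    using assms(3) k unfolding announce_def by simp
  moreover have "q t v < 2 ^ width lv" using q_bounds(3)[OF assms(1)] W_less by (rule le_less_trans)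
  ultimately show ?thesis by (simp add: ann_def)
qed

lemma lev_ge:
  assumes "{u, w} \<in> E" "L (Suc t) u \<noteq> L (Suc t) w" shows "t < lev u w"
proof (rule ccontr)
  assume "\<not> t < lev u w"
  then have "Suc (lev u w) \<le> Suc t" by simp
  then show False using merging.lab_mono[OF _ _ lev(3)[OF assms(1)]] assms edge_nodes[OF assms(1)] by blast
qed

lemma lev_sym: "lev u w = lev w u"
  by (simp add: lev_def eq_commute)

text \<open>A boundary edge not merged in step \<open>t\<close> is merged in a later step, which has
  been undone before; hence the induction on \<open>T - t\<close>.\<close>

lemma down: "t < T \<Longrightarrow> \<forall>v\<in>V. ys v (2 * T + 1 - t) + zs v (2 * T + 1 - t) = q t v"
proof (induction "T - t" arbitrary: t rule: less_induct)
  case less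
  let ?k = "2 * T + 1 - t"
  have k: "T + 1 < ?k" "?k \<le> 2 * T + 1" "?k \<noteq> 0" "2 * T + 1 - ?k = t" "2 * T + 2 - ?k = Suc t"
    using less.prems by simp_all
  have lab: "edge_label lv (trunc (Suc ?k) (ann u)) s = L s u" if "u \<in> V" "s \<le> T" for u s
    using edge_label_eq[OF that] k that by simp
  have jn: "join lv ?k u (trunc (Suc ?k) (ann u)) w (trunc (Suc ?k) (ann w)) \<longleftrightarrow> L t u = L t w"
    if "{u, w} \<in> E" for u w
  proof -
    have "u \<in> V" "w \<in> V" using edge_nodes[OF that] by auto
    then show ?thesis using lab[of _ t] less.prems k unfolding join_def by simp
  qed
  have del: "delivered ?k (u, w) = (if L (Suc t) u = L (Suc t) w then 0 else side wt w u)"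
    if e: "{u, w} \<in> E" for u w
  proof -
    have V: "u \<in> V" "w \<in> V" using edge_nodes[OF e] by auto
    have e': "{w, u} \<in> E" using e by (simp add: insert_commute)
    have "delivered ?k (u, w) = (if L (Suc t) u = L (Suc t) w then 0
        else edge_side lv (trunc (Suc ?k) (ann w)) (trunc (Suc ?k) (ann u)))"
      using lab[of _ "Suc t"] V less.prems k unfolding deliver_def by simp
    moreover have "edge_side lv (trunc (Suc ?k) (ann w)) (trunc (Suc ?k) (ann u)) = side wt w u"
      if n: "L (Suc t) u \<noteq> L (Suc t) w"
    proof -
      have l: "t < lev w u" "lev w u < T" using lev_ge[OF e n] lev(1)[OF e'] by (simp_all add: lev_sym)
      then have "\<forall>v\<in>V. ann v (2 * T + 2 - lev w u) = q (lev w u) v"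
        using less.hyps[of "lev w u"] ann_down by simp
      then show ?thesis using edge_side_eq[OF e', of "Suc ?k"] V k l by simp
    qed
    ultimately show ?thesis by simp
  qed
  show ?case
  proof
    fix v assume v: "v \<in> V"
    have "ys v ?k = (\<Sum>u\<in>cls (L t) v. contrib lv ?k u (u = r) (trunc ?k (ys u)) (trunc ?k (zs u))) mod 2 ^ width lv"
      by (rule ys_cls[OF merging.lab_connected v jn])
    also have "(\<Sum>u\<in>cls (L t) v. contrib lv ?k u (u = r) (trunc ?k (ys u)) (trunc ?k (zs u))) = sum wt (cls (L t) v)"
      using k by (intro sum.cong) (auto simp: contrib_def wt_def)
    finally have y: "ys v ?k = sum wt (cls (L t) v)"
      using q_bounds(1)[OF v, of t] W_less by simp
    have "zs v ?k = (\<Sum>p\<in>cut E (cls (L t) v). delivered ?k p) mod 2 ^ width lv"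
      by (rule zs_cls[OF merging.lab_connected v jn]) (use k in auto)
    also have "(\<Sum>p\<in>cut E (cls (L t) v). delivered ?k p) =
        (\<Sum>(u, w)\<in>cut E (cls (L t) v). if L (Suc t) u = L (Suc t) w then 0 else side wt w u)"
    proof (rule sum.cong[OF refl])
      fix p assume "p \<in> cut E (cls (L t) v)"
      then obtain u w where "p = (u, w)" "{u, w} \<in> E" by (auto simp: cut_def)
      then show "delivered ?k p = (case p of (u, w) \<Rightarrow> if L (Suc t) u = L (Suc t) w then 0 else side wt w u)"
        using del[of u w] by simp
    qed
    finally have "zs v ?k = (\<Sum>(u, w)\<in>cut E (cls (L t) v). if L (Suc t) u = L (Suc t) w then 0 else side wt w u)"
      using q_bounds(2)[OF v, of t] W_less by simp
    then show "ys v ?k + zs v ?k = q t v" using y by (simp add: q_def)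
  qed
qed

lemma edge_side:
  assumes e: "{u, w} \<in> E" and k: "2 * T + 2 < k"
  shows "edge_side lv (trunc k (ann u)) (trunc k (ann w)) = side wt u w"
proof -
  have "u \<in> V" "w \<in> V" using edge_nodes[OF e] by auto
  then show ?thesis
    using edge_side_eq[OF e, of k] k ann_down down lev(1)[OF e] by simp
qed

lemma sum_wt_desc: "v \<in> V \<Longrightarrow> v \<noteq> r \<Longrightarrow> sum wt (desc v) = S v"
proof -
  assume v: "v \<in> V" "v \<noteq> r"
  have "r \<notin> desc v" using v by (simp add: mem_desc)
  then have "sum wt (desc v) = (\<Sum>x\<in>desc v. 1)" by (intro sum.cong) (auto simp: wt_def)
  then show ?thesis by (simp add: S_def)
qed

lemma S_less: "S v < M"
  using S_le[of v] card_V_less by simp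

text \<open>A side with the root weighs at least \<open>M\<close>, the extra weight of the root; a
  side without it weighs one per node, which is less than \<open>M\<close>.\<close>

lemma side_less_iff:
  assumes e: "{u, w} \<in> E"
  shows "side wt u w < M \<longleftrightarrow> u \<noteq> r \<and> par u = w" "u \<noteq> r \<Longrightarrow> par u = w \<Longrightarrow> side wt u w = S u"
proof -
  have V: "u \<in> V" "w \<in> V" using edge_nodes[OF e] by auto
  show s: "u \<noteq> r \<Longrightarrow> par u = w \<Longrightarrow> side wt u w = S u" using sum_wt_desc[OF V(1)] by (simp add: side_def)
  show "side wt u w < M \<longleftrightarrow> u \<noteq> r \<and> par u = w"
  proof (cases "u \<noteq> r \<and> par u = w")
    case True
    then show ?thesis using s S_less by simp
  next
    case False
    then have "w \<noteq> r" using edge_par[OF e] by auto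
    then have "side wt u w = card V + M - S w" using False sum_wt_desc[OF V(2)] by (auto simp: side_def sum_wt)
    moreover have "\<not> card V + M - S w < M" using S_le[of w] by linarith
    ultimately show ?thesis using False by simp
  qed
qed

end

context hl_execution
begin

subsection \<open>Subtree sizes and heavy children\<close>

definition kids :: "node \<Rightarrow> node set" where
  "kids v = {x \<in> V. x \<noteq> r \<and> par x = v}"

lemma id_connected: "connected_classes (\<lambda>v. v)"
  by (simp add: connected_classes_def)

lemma cls_id: "v \<in> V \<Longrightarrow> cls (\<lambda>v. v) v = {v}"
  by (auto simp: cls_def)

lemma lower_id: "lower (\<lambda>v. v) v = kids v"
  using par_ne by (auto simp: lower_def tops_def kids_def)

lemma finite_kids: "finite (kids v)"
  using finite_V by (simp add: kids_def)

lemma S_kids: assumes "v \<in> V" shows "S v = 1 + (\<Sum>x\<in>kids v. S x)"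
proof -
  have "v \<in> tops (\<lambda>v. v)" using assms par_ne[OF assms] by (auto simp: tops_def)
  then have "apex (\<lambda>v. v) v = v" using apex_unique[OF id_connected, of v v] by simp
  then show ?thesis
    using sum_desc_apex[OF id_connected assms, of "\<lambda>_. 1"] by (simp add: cls_id[OF assms] lower_id S_def)
qed

lemma join_none:
  assumes "k = 2 * T + 2 \<or> k = 2 * T + 3" "{u, w} \<in> E"
  shows "join lv k u a w b \<longleftrightarrow> u = w"
proof -
  have "T + 1 < k" "2 * T + 1 < k" "k \<le> 2 * T + 3" using assms(1) T_pos by auto
  then show ?thesis using edge_nodes[OF assms(2)] unfolding join_def by simp
qed

lemma deliver_kids:
  assumes "{u, w} \<in> E"
  shows "delivered (2 * T + 2) (u, w) = (if w \<noteq> r \<and> par w = u then S w else 0)"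
    and "delivered (2 * T + 3) (u, w) = (if w \<noteq> r \<and> par w = u then num w + M * S w else 0)"
proof -
  have e: "{w, u} \<in> E" using assms by (simp add: insert_commute)
  have n: "\<not> 2 * T + 2 \<le> T + 1" "\<not> 2 * T + 2 \<le> 2 * T + 1" "\<not> 2 * T + 3 \<le> T + 1" "\<not> 2 * T + 3 \<le> 2 * T + 1"
    using T_pos by auto
  show "delivered (2 * T + 2) (u, w) = (if w \<noteq> r \<and> par w = u then S w else 0)"
    using edge_side[OF e, of "Suc (2 * T + 2)"] side_less_iff[OF e] n unfolding deliver_def by auto
  show "delivered (2 * T + 3) (u, w) = (if w \<noteq> r \<and> par w = u then num w + M * S w else 0)"
    using edge_side[OF e, of "Suc (2 * T + 3)"] side_less_iff[OF e] n unfolding deliver_def by auto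
qed

lemma kid_edges:
  assumes "x \<in> V" "x \<noteq> r"
  shows "{par x, x} \<in> E" "{x, par x} \<in> E" "\<not> (par x \<noteq> r \<and> par (par x) = x)"
  using rp_snoc(3)[OF assms] par_par_ne[OF assms] by (auto simp: insert_commute)

lemma size_eq: assumes v: "v \<in> V" shows "1 + zs v (2 * T + 2) = S v"
proof -
  have "zs v (2 * T + 2) = (\<Sum>p\<in>cut E (cls (\<lambda>v. v) v). delivered (2 * T + 2) p) mod 2 ^ width lv"
    by (rule zs_cls[OF id_connected v join_none]) auto
  also have "(\<Sum>p\<in>cut E (cls (\<lambda>v. v) v). delivered (2 * T + 2) p) =
      (\<Sum>x\<in>lower (\<lambda>v. v) v. delivered (2 * T + 2) (par x, x)) +
      (\<Sum>x\<in>upper (\<lambda>v. v) v. delivered (2 * T + 2) (x, par x))"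
    by (rule sum_cut_cls[OF v])
  also have "(\<Sum>x\<in>lower (\<lambda>v. v) v. delivered (2 * T + 2) (par x, x)) = (\<Sum>x\<in>kids v. S x)"
    unfolding lower_id using deliver_kids(1)[OF kid_edges(1)] by (intro sum.cong) (auto simp: kids_def)
  also have "(\<Sum>x\<in>upper (\<lambda>v. v) v. delivered (2 * T + 2) (x, par x)) = 0"
  proof (rule sum.neutral, rule ballI)
    fix x assume "x \<in> upper (\<lambda>v. v) v"
    then have x: "x \<in> V" "x \<noteq> r" by (auto simp: upper_def tops_def)
    show "delivered (2 * T + 2) (x, par x) = 0"
      unfolding deliver_kids(1)[OF kid_edges(2)[OF x]] if_not_P[OF kid_edges(3)[OF x]] by simp
  qed
  finally have "zs v (2 * T + 2) = (\<Sum>x\<in>kids v. S x) mod 2 ^ width lv" by simp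
  moreover have "(\<Sum>x\<in>kids v. S x) < 2 ^ width lv"
    using S_kids[OF v] S_less[of v] by (intro small1) simp
  ultimately show ?thesis using S_kids[OF v] by simp
qed

lemma key_less: assumes "x \<in> V" shows "num x + M * S x < M * M"
proof -
  have "num x + M * S x < M * Suc (S x)" using num_lv[OF assms] by simp
  also have "\<dots> \<le> M * M" using S_less[of x] by (intro mult_left_mono) auto
  finally show ?thesis .
qed

lemma less_square: "x < M * M \<Longrightarrow> x < 2 ^ width lv"
proof (rule small)
  assume "x < M * M"
  also have "M * M \<le> M * M * M" using M_ge by simp
  finally show "x < M * M * M" .
qed

lemma heavy_eq: assumes v: "v \<in> V" shows "zs v (2 * T + 3) = Max (insert 0 ((\<lambda>x. num x + M * S x) ` kids v))"
proof -
  let ?k = "2 * T + 3" let ?g = "\<lambda>p. delivered ?k p mod 2 ^ width lv"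
  have "supernode (joined ?k) v = cls (\<lambda>v. v) v"
    using joined_inner[OF join_none, of ?k] supernode_inner[OF id_connected v] by simp
  then have "zs v ?k = Max (insert 0 (?g ` cut E (cls (\<lambda>v. v) v)))"
    using zs_max[OF v, of ?k] by (simp add: max_stage_def)
  also have "insert 0 (?g ` cut E (cls (\<lambda>v. v) v)) = insert 0 ((\<lambda>x. num x + M * S x) ` kids v)"
  proof -
    have "?g (par x, x) = num x + M * S x" if "x \<in> kids v" for x
    proof -
      have x: "x \<in> V" "x \<noteq> r" using that by (auto simp: kids_def)
      then show ?thesis using deliver_kids(2)[OF kid_edges(1)] less_square[OF key_less] by simp
    qed
    then have l: "(\<lambda>x. ?g (par x, x)) ` kids v = (\<lambda>x. num x + M * S x) ` kids v" by (rule image_cong[OF refl])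
    have "?g (x, par x) = 0" if "x \<in> upper (\<lambda>v. v) v" for x
    proof -
      have x: "x \<in> V" "x \<noteq> r" using that by (auto simp: upper_def tops_def)
      show ?thesis unfolding deliver_kids(2)[OF kid_edges(2)[OF x]] if_not_P[OF kid_edges(3)[OF x]] by simp
    qed
    then have u: "(\<lambda>x. ?g (x, par x)) ` upper (\<lambda>v. v) v \<subseteq> {0}" by (intro image_subsetI) simp
    have "?g ` cut E (cls (\<lambda>v. v) v) = (\<lambda>x. ?g (par x, x)) ` kids v \<union> (\<lambda>x. ?g (x, par x)) ` upper (\<lambda>v. v) v"
      unfolding cut_cls[OF v] lower_id image_Un image_image ..
    then show ?thesis using l u by auto
  qed
  finally show ?thesis .
qed

text \<open>The maximised key has the size as its upper digit and the encoded ID as its lower one: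
  size decides, the ID breaks ties, and the lower digit names the winner. A leaf gets 0, which
  encodes no ID.\<close>

definition hc :: "node \<Rightarrow> nat" where "hc v = zs v (2 * T + 3) mod M"

definition hvp :: "node \<Rightarrow> bool" where "hvp v \<longleftrightarrow> v \<noteq> r \<and> hc (par v) = num v"

lemma hc_kids:
  assumes v: "v \<in> V" and ne: "kids v \<noteq> {}"
  shows "\<exists>w\<in>kids v. hc v = num w \<and> (\<forall>x\<in>kids v. S x \<le> S w)"
proof -
  let ?K = "(\<lambda>x. num x + M * S x) ` kids v"
  have fin: "finite ?K" "?K \<noteq> {}" using finite_kids ne by auto
  then have "zs v (2 * T + 3) = Max ?K" using heavy_eq[OF v] by simp
  then have "zs v (2 * T + 3) \<in> ?K" and le: "\<forall>y\<in>?K. y \<le> zs v (2 * T + 3)" using fin by simp_all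
  then obtain w where w: "w \<in> kids v" "zs v (2 * T + 3) = num w + M * S w" by blast
  have nw: "num w < M" using w(1) num_lv by (simp add: kids_def)
  have "S x \<le> S w" if "x \<in> kids v" for x
  proof (rule ccontr)
    assume "\<not> S x \<le> S w"
    then have "M * Suc (S w) \<le> M * S x" by (intro mult_left_mono) auto
    moreover have "num x + M * S x \<le> num w + M * S w" using le w that by simp
    ultimately show False using nw by simp
  qed
  moreover have "hc v = num w" using w nw by (simp add: hc_def)
  ultimately show ?thesis using w by blast
qed

lemma hc_empty: "v \<in> V \<Longrightarrow> kids v = {} \<Longrightarrow> hc v = 0"
  using heavy_eq by (simp add: hc_def)

lemma hc_num: assumes "v \<in> V" "hc v = num w" shows "w \<in> kids v"
proof (cases "kids v = {}")
  case True
  then show ?thesis using hc_empty[OF assms(1)] assms(2) num_pos[of w] by simp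
next
  case False
  then show ?thesis using hc_kids[OF assms(1)] assms(2) num_inj by metis
qed

sublocale heavy: heavy_tree V E r hvp
proof
  show "\<not> hvp r" by (simp add: hvp_def)
  fix v assume v: "v \<in> V" "v \<noteq> r"
  have p: "par v \<in> V" using rp_snoc(2)[OF v] .
  have "kids (par v) \<noteq> {}" using v by (auto simp: kids_def)
  then obtain w where w: "w \<in> kids (par v)" "hc (par v) = num w" "\<forall>x\<in>kids (par v). S x \<le> S w"
    using hc_kids[OF p] by blast
  show "\<exists>w\<in>V. w \<noteq> r \<and> par w = par v \<and> hvp w \<and>
      (\<forall>x\<in>V. x \<noteq> r \<longrightarrow> par x = par v \<longrightarrow> S x \<le> S w \<and> hvp x = (x = w))"
  proof (intro bexI[of _ w] conjI ballI impI)
    show "w \<noteq> r" "par w = par v" "w \<in> V" using w by (auto simp: kids_def)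
    then show "hvp w" using w by (simp add: hvp_def)
    fix x assume x: "x \<in> V" "x \<noteq> r" "par x = par v"
    then show "S x \<le> S w" using w(3) by (simp add: kids_def)
    show "hvp x = (x = w)" using x w(2) num_inj[of w x] by (auto simp: hvp_def)
  qed
qed

subsection \<open>Positions on heavy paths\<close>

lemma trie_index:
  assumes "2 * T + 4 \<le> k" "k \<le> 2 * T + 4 + lv"
  shows "k \<noteq> 0" "\<not> k \<le> T + 1" "\<not> k \<le> 2 * T + 1" "\<not> k \<le> 2 * T + 2" "\<not> k \<le> 2 * T + 3" "k \<noteq> 2 * T + 2" "k \<noteq> 2 * T + 3"
  using assms T_pos by auto

lemma ann_trie:
  assumes v: "v \<in> V" and k: "2 * T + 4 \<le> k" "k \<le> 2 * T + 4 + lv"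
  shows "ann v k = hc v + M * S v"
proof -
  have "announce lv k v (v = r) (trunc k (ys v)) (trunc k (zs v)) = hc v + M * S v"
    using k trie_index[OF k] size_eq[OF v] by (simp add: announce_def heavy_of_def size_of_def hc_def)
  moreover have "hc v + M * S v < M * Suc (S v)" by (simp add: hc_def)
  moreover have "M * Suc (S v) \<le> M * M" using S_less[of v] by (intro mult_left_mono) auto
  ultimately show ?thesis using less_square[of "hc v + M * S v"] by (simp add: ann_def)
qed

lemma edge_heavy_iff:
  assumes e: "{u, w} \<in> E" and k: "2 * T + 4 < k"
  shows "edge_heavy lv u (trunc k (ann u)) w (trunc k (ann w)) \<longleftrightarrow> heavy.head u = heavy.head w"
proof -
  have V: "u \<in> V" "w \<in> V" using edge_nodes[OF e] by auto
  have "hc x < M" for x by (simp add: hc_def)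
  then have a: "trunc k (ann x) (2 * T + 4) mod M = hc x" if "x \<in> V" for x
    using ann_trie[OF that, of "2 * T + 4"] k by simp
  have key: "(hc x = num (par x) \<or> hc (par x) = num x) \<longleftrightarrow> heavy.head x = heavy.head (par x)"
    if x: "x \<in> V" "x \<noteq> r" for x
  proof -
    have "hc x \<noteq> num (par x)" using hc_num[OF x(1), of "par x"] par_par_ne[OF x] by (auto simp: kids_def)
    then show ?thesis using heavy.head_par_iff[OF x] x by (auto simp: hvp_def)
  qed
  have "(hc u = num w \<or> hc w = num u) \<longleftrightarrow> heavy.head u = heavy.head w"
    using edge_par[OF e] key[of u] key[of w] V by auto
  then show ?thesis using a V by (simp add: edge_heavy_def)
qed

lemma ys_trie:
  assumes v: "v \<in> V" and i: "i \<le> lv"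
  shows "ys v (2 * T + 4 + lv - i) =
    card {w \<in> V. (heavy.head w, S w div 2 ^ Suc i) = (heavy.head v, S v div 2 ^ Suc i) \<and> bit (S w) i}"
proof -
  let ?k = "2 * T + 4 + lv - i" and ?f = "\<lambda>v. (heavy.head v, S v div 2 ^ Suc i)"
  have k: "2 * T + 4 \<le> ?k" "?k \<le> 2 * T + 4 + lv" "2 * T + 4 + lv - ?k = i" using i by auto
  have jn: "join lv ?k u (trunc (Suc ?k) (ann u)) w (trunc (Suc ?k) (ann w)) \<longleftrightarrow> ?f u = ?f w"
    if e: "{u, w} \<in> E" for u w
  proof -
    have V: "u \<in> V" "w \<in> V" using edge_nodes[OF e] by auto
    have "hc x < M" for x by (simp add: hc_def)
    then have "trunc (Suc ?k) (ann x) (2 * T + 4) div M = S x" if "x \<in> V" for x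
      using ann_trie[OF that, of "2 * T + 4"] k by simp
    then show ?thesis
      using edge_heavy_iff[OF e, of "Suc ?k"] V k trie_index[OF k(1,2)] unfolding join_def by simp
  qed
  have "ys v ?k = (\<Sum>u\<in>cls ?f v. contrib lv ?k u (u = r) (trunc ?k (ys u)) (trunc ?k (zs u))) mod 2 ^ width lv"
    by (rule ys_cls[OF heavy.head_prefix_connected v jn])
  also have "(\<Sum>u\<in>cls ?f v. contrib lv ?k u (u = r) (trunc ?k (ys u)) (trunc ?k (zs u))) =
      (\<Sum>u\<in>cls ?f v. of_bool (bit (S u) i))"
  proof (rule sum.cong[OF refl])
    fix u assume "u \<in> cls ?f v"
    then have "u \<in> V" by (simp add: cls_def)
    then have "size_of lv (trunc ?k (zs u)) = S u" using size_eq k by (simp add: size_of_def)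
    then show "contrib lv ?k u (u = r) (trunc ?k (ys u)) (trunc ?k (zs u)) = of_bool (bit (S u) i)"
      using k trie_index[OF k(1,2)] unfolding contrib_def by simp
  qed
  also have "\<dots> = card {u \<in> cls ?f v. bit (S u) i}"
    by (simp add: sum_of_bool_eq Int_def)
  also have "{u \<in> cls ?f v. bit (S u) i} = {w \<in> V. ?f w = ?f v \<and> bit (S w) i}" unfolding cls_def by blast
  finally have "ys v ?k = card {w \<in> V. ?f w = ?f v \<and> bit (S w) i} mod 2 ^ width lv" .
  moreover have "card {w \<in> V. ?f w = ?f v \<and> bit (S w) i} \<le> card V" using finite_V by (intro card_mono) auto
  ultimately show ?thesis using small1[of "card {w \<in> V. ?f w = ?f v \<and> bit (S w) i}"] card_V_less by simp
qed

lemma pos_eq: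
  assumes v: "v \<in> V" and k: "2 * T + 5 + lv \<le> k"
  shows "pos_of lv (trunc k (ys v)) (trunc k (zs v)) = heavy.pos v"
proof -
  have s: "size_of lv (trunc k (zs v)) = S v" using size_eq[OF v] k by (simp add: size_of_def)
  have "pos_of lv (trunc k (ys v)) (trunc k (zs v)) = (\<Sum>i<Suc lv. if bit (S v) i then 0 else
      card {w \<in> V. (heavy.head w, S w div 2 ^ Suc i) = (heavy.head v, S v div 2 ^ Suc i) \<and> bit (S w) i})"
    unfolding pos_of_def s
  proof (rule sum.cong[OF refl])
    fix i assume "i \<in> {..<Suc lv}"
    then have i: "i \<le> lv" "2 * T + 4 + lv - i < k" using k by auto
    show "(if bit (S v) i then 0 else trunc k (ys v) (2 * T + 4 + lv - i)) = (if bit (S v) i then 0 else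
      card {w \<in> V. (heavy.head w, S w div 2 ^ Suc i) = (heavy.head v, S v div 2 ^ Suc i) \<and> bit (S w) i})"
      unfolding trunc_less[OF i(2)] ys_trie[OF v i(1)] ..
  qed
  also have "\<dots> = heavy.pos v"
    using card_V_less by (intro heavy.pos_bits[OF v, symmetric]) (simp only: base_def)
  finally show ?thesis .
qed

subsection \<open>Light edges\<close>

abbreviation "J \<equiv> 2 * T + 5 + lv"

lemma pos_less: "v \<in> V \<Longrightarrow> heavy.pos v < M"
proof -
  assume v: "v \<in> V"
  have "card {w \<in> V. heavy.head w = heavy.head v \<and> S v < S w} \<le> card V" using finite_V by (intro card_mono) auto
  then show ?thesis using heavy.card_above[OF v] card_V_less by simp
qed

definition pack :: "nat \<times> node \<times> node \<Rightarrow> nat" where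
  "pack = (\<lambda>(p, a, b). p + M * (num a + M * num b))"

lemma pack_less:
  assumes "a \<in> V" "b \<in> V" shows "pack (heavy.pos a, a, b) < 2 ^ width lv"
proof (rule small)
  have "Suc (num a + M * num b) \<le> M * Suc (num b)" using num_lv[OF assms(1)] by simp
  also have "\<dots> \<le> M * M" using num_lv[OF assms(2)] by (intro mult_left_mono) auto
  finally have "M * Suc (num a + M * num b) \<le> M * (M * M)" by (rule mult_left_mono) simp
  moreover have "pack (heavy.pos a, a, b) < M * Suc (num a + M * num b)"
    using pos_less[OF assms(1)] by (simp add: pack_def)
  ultimately show "pack (heavy.pos a, a, b) < M * M * M" unfolding mult.assoc by (rule less_le_trans[rotated])
qed

lemma unpack_pack:
  assumes "a \<in> V" "b \<in> V" shows "unpack lv (pack (heavy.pos a, a, b)) = (heavy.pos a, a, b)"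
  using digits(1-3)[OF pos_less[OF assms(1)] num_lv[OF assms(1)], of "num b"]
  by (simp add: unpack_def pack_def inv_f_f[OF inj_num])

lemma apex_head: "v \<in> V \<Longrightarrow> apex heavy.head v = heavy.head v"
proof -
  assume v: "v \<in> V"
  have h: "heavy.head v \<in> V" "\<not> hvp (heavy.head v)" using heavy.head_props[OF v] by auto
  have "heavy.head v \<in> tops heavy.head"
    using h heavy.head_par_iff[OF h(1)] by (auto simp: tops_def)
  then show ?thesis using apex_unique[OF heavy.head_connected] heavy.head_light[OF h] by blast
qed

text \<open>With heavy paths contracted, the edges to the children of a path deliver 0 to it, so the
  sum consists of what the parent edge of the head delivers, if there is one.\<close>

lemma zs_jump:
  assumes v: "v \<in> V" and k: "J \<le> k"
  shows "zs v k = (if heavy.head v = r then 0 else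
    (let h = heavy.head v; a = par h in
      if k = J then ann a k + M * (num a + M * num h) else ann a k)) mod 2 ^ width lv"
proof -
  have i: "k \<noteq> 0" "\<not> k \<le> T + 1" "\<not> k \<le> 2 * T + 1" "k \<noteq> 2 * T + 2" "k \<noteq> 2 * T + 3" "\<not> k \<le> 2 * T + 3"
    "\<not> k \<le> 2 * T + 4 + lv" "2 * T + 4 < Suc k" "2 * T + 2 < Suc k"
    using k T_pos by auto
  have jn: "join lv k u (trunc (Suc k) (ann u)) w (trunc (Suc k) (ann w)) \<longleftrightarrow> heavy.head u = heavy.head w"
    if "{u, w} \<in> E" for u w
    using edge_heavy_iff[OF that i(8)] i unfolding join_def by simp
  have del: "delivered k (u, w) = (if heavy.head u \<noteq> heavy.head w \<and> u \<noteq> r \<and> par u = w then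
      (if k = J then ann w k + M * (num w + M * num u) else ann w k) else 0)" if e: "{u, w} \<in> E" for u w
    using edge_heavy_iff[OF e i(8)] edge_side[OF e i(9)] side_less_iff(1)[OF e] i unfolding deliver_def by simp
  have "zs v k = (\<Sum>p\<in>cut E (cls heavy.head v). delivered k p) mod 2 ^ width lv"
    by (rule zs_cls[OF heavy.head_connected v jn]) (use i in auto)
  also have "(\<Sum>p\<in>cut E (cls heavy.head v). delivered k p) =
      (\<Sum>x\<in>lower heavy.head (heavy.head v). delivered k (par x, x)) +
      (\<Sum>x\<in>upper heavy.head (heavy.head v). delivered k (x, par x))"
    by (rule sum_cut_cls[OF v])
  also have "(\<Sum>x\<in>lower heavy.head (heavy.head v). delivered k (par x, x)) = 0"
  proof (rule sum.neutral, rule ballI)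
    fix x assume "x \<in> lower heavy.head (heavy.head v)"
    then have x: "x \<in> V" "x \<noteq> r" by (auto simp: lower_def tops_def)
    show "delivered k (par x, x) = 0" unfolding del[OF kid_edges(1)[OF x]] using kid_edges(3)[OF x] by (simp only: simp_thms if_False)
  qed
  also have "upper heavy.head (heavy.head v) = {heavy.head v} - {r}"
    using upper_apex[OF heavy.head_connected v] apex_head[OF v] by simp
  also have "(\<Sum>x\<in>{heavy.head v} - {r}. delivered k (x, par x)) = (if heavy.head v = r then 0 else
    (let h = heavy.head v; a = par h in
      if k = J then ann a k + M * (num a + M * num h) else ann a k))"
  proof (cases "heavy.head v = r")
    case False
    have h: "heavy.head v \<in> V" "\<not> hvp (heavy.head v)" using heavy.head_props[OF v] by auto
    have "heavy.head (heavy.head v) \<noteq> heavy.head (par (heavy.head v))"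
      using heavy.head_par_iff[OF h(1) False] h(2) by auto
    then have "delivered k (heavy.head v, par (heavy.head v)) =
        (let h = heavy.head v; a = par h in if k = J then ann a k + M * (num a + M * num h) else ann a k)"
      using del[OF kid_edges(2)[OF h(1) False]] False by (simp only: Let_def) simp
    moreover have "{heavy.head v} - {r} = {heavy.head v}" using False by auto
    ultimately show ?thesis using False by simp
  qed simp
  finally show ?thesis by simp
qed

lemma ann_J: assumes "v \<in> V" shows "ann v J = heavy.pos v"
proof -
  have "announce lv J v (v = r) (trunc J (ys v)) (trunc J (zs v)) = heavy.pos v"
    using pos_eq[OF assms, of J] T_pos unfolding announce_def by simp
  then show ?thesis using small1[of "heavy.pos v"] pos_less[OF assms] by (simp add: ann_def)
qed

lemma ann_jump: assumes "v \<in> V" shows "ann v (J + Suc j) = zs v (J + j)"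
proof -
  have "announce lv (J + Suc j) v (v = r) (trunc (J + Suc j) (ys v)) (trunc (J + Suc j) (zs v)) = zs v (J + j)"
    using T_pos unfolding announce_def by (simp add: ac_simps)
  moreover have "zs v (J + j) < 2 ^ width lv" using zs_jump[OF assms, of "J + j"] by simp
  ultimately show ?thesis by (simp add: ann_def)
qed

text \<open>Entry \<open>Suc j\<close> of the list of \<open>v\<close> is entry \<open>j\<close> of
  the list of the parent of \<open>head v\<close>. That parent received it in the previous stage and
  announces it in the present one.\<close>

lemma zs_items:
  "v \<in> V \<Longrightarrow> zs v (J + j) = (if j < length (heavy.items v) then pack (heavy.items v ! j) else 0)"
proof (induction j arbitrary: v)
  case 0
  show ?case
  proof (cases "heavy.head v = r")
    case True
    then show ?thesis using zs_jump[OF 0, of J] by (simp add: heavy.items.simps[of v])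
  next
    case False
    let ?a = "par (heavy.head v)"
    have h: "heavy.head v \<in> V" "?a \<in> V" using heavy.head_props[OF 0] rp_snoc(2)[OF _ False] by auto
    have "zs v J = pack (heavy.pos ?a, ?a, heavy.head v) mod 2 ^ width lv"
      using zs_jump[OF 0, of J] False ann_J[OF h(2)] by (simp add: Let_def pack_def)
    also have "\<dots> = pack (heavy.pos ?a, ?a, heavy.head v)" using pack_less[OF h(2,1)] by simp
    finally show ?thesis using False 0 by (simp add: heavy.items.simps[of v])
  qed
next
  case (Suc j)
  show ?case
  proof (cases "heavy.head v = r")
    case True
    then show ?thesis using zs_jump[OF Suc.prems, of "J + Suc j"] by (simp add: heavy.items.simps[of v])
  next
    case False
    let ?a = "par (heavy.head v)"
    have h: "?a \<in> V" using heavy.head_props[OF Suc.prems] rp_snoc(2)[OF _ False] by auto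
    have "zs v (J + Suc j) = ann ?a (J + Suc j) mod 2 ^ width lv"
      using zs_jump[OF Suc.prems, of "J + Suc j"] False by (simp add: Let_def)
    also have "\<dots> = ann ?a (J + Suc j)" by (simp add: ann_def)
    also have "\<dots> = zs ?a (J + j)" by (rule ann_jump[OF h])
    finally show ?thesis using Suc.IH[OF h] False Suc.prems by (simp add: heavy.items.simps[of v])
  qed
qed

lemma items_nodes: "v \<in> V \<Longrightarrow> (p, a, b) \<in> set (heavy.items v) \<Longrightarrow> p = heavy.pos a \<and> a \<in> V \<and> b \<in> V"
proof (induction v rule: heavy.items.induct)
  case (1 v)
  show ?case
  proof (cases "heavy.head v = r")
    case True
    then show ?thesis using 1 by (simp add: heavy.items.simps[of v])
  next
    case False
    then have h: "heavy.head v \<in> V" "par (heavy.head v) \<in> V"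
      using heavy.head_props[OF 1(2)] rp_snoc(2)[OF _ False] by auto
    have "(p, a, b) = (heavy.pos (par (heavy.head v)), par (heavy.head v), heavy.head v) \<or>
        (p, a, b) \<in> set (heavy.items (par (heavy.head v)))"
      using 1(3) False 1(2) by (simp add: heavy.items.simps[of v])
    then show ?thesis using 1(1)[OF _ h(2)] h 1(2) False by auto
  qed
qed

lemma result_eq:
  assumes v: "v \<in> V"
  shows "result lv v (v = r) (trunc (num_stages lv) (ys v)) (trunc (num_stages lv) (zs v)) =
    hl_info_of E r heavy.heavy_edges v"
proof -
  let ?n = "num_stages lv" and ?xs = "heavy.items v"
  have n: "?n = J + Suc lv" by (simp add: num_stages_def)
  have "2 ^ length ?xs * 1 \<le> 2 ^ length ?xs * S v" using S_pos[OF v] by (intro mult_left_mono) auto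
  also have "\<dots> < 2 ^ Suc lv" using heavy.length_items[OF v] card_V_less by (simp add: base_def)
  finally have len: "length ?xs < Suc lv" by (simp del: power_Suc)
  have "map (\<lambda>j. trunc ?n (zs v) (J + j)) [0..<Suc lv] =
      map (\<lambda>j. if j < length ?xs then pack (?xs ! j) else 0) [0..<Suc lv]"
    by (rule map_cong[OF refl]) (simp add: n zs_items[OF v] del: upt_Suc)
  also have "\<dots> = map (\<lambda>j. if j < length ?xs then pack (?xs ! j) else 0)
      ([0..<length ?xs] @ [length ?xs..<Suc lv])"
    using upt_add_eq_append[of 0 "length ?xs" "Suc lv - length ?xs"] len by (simp del: upt_Suc)
  also have "\<dots> = map pack ?xs @ map (\<lambda>_. 0) [length ?xs..<Suc lv]"
    unfolding map_append
  proof (rule arg_cong2[of _ _ _ _ append])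
    show "map (\<lambda>j. if j < length ?xs then pack (?xs ! j) else 0) [0..<length ?xs] = map pack ?xs"
      by (rule nth_equalityI) simp_all
  qed (simp del: upt_Suc)
  finally have m: "map (\<lambda>j. trunc ?n (zs v) (J + j)) [0..<Suc lv] =
      map pack ?xs @ map (\<lambda>_. 0) [length ?xs..<Suc lv]" .
  have nz: "pack x \<noteq> 0" for x using num_pos by (cases x) (simp add: pack_def)
  have "takeWhile (\<lambda>x. x \<noteq> 0) (map pack ?xs @ map (\<lambda>_. 0) [length ?xs..<Suc lv]) =
      map pack ?xs @ takeWhile (\<lambda>x. x \<noteq> 0) (map (\<lambda>_. 0::nat) [length ?xs..<Suc lv])"
    using nz by (intro takeWhile_append2) auto
  also have "takeWhile (\<lambda>x. x \<noteq> 0) (map (\<lambda>_. 0::nat) [length ?xs..<Suc lv]) = []"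
    by (cases "[length ?xs..<Suc lv]") (simp_all del: upt_Suc)
  finally have tw: "takeWhile (\<lambda>x. x \<noteq> 0) (map pack ?xs @ map (\<lambda>_. 0) [length ?xs..<Suc lv]) = map pack ?xs" by simp
  have "map (unpack lv) (map pack ?xs) = ?xs"
    unfolding map_map
  proof (rule map_idI)
    fix x assume x: "x \<in> set ?xs"
    obtain p a b where xe: "x = (p, a, b)" by (rule prod_cases3)
    have "p = heavy.pos a \<and> a \<in> V \<and> b \<in> V" using items_nodes[OF v, of p a b] x xe by blast
    then show "(unpack lv \<circ> pack) x = x" using unpack_pack[of a b] xe by simp
  qed
  moreover have "pos_of lv (trunc ?n (ys v)) (trunc ?n (zs v)) = heavy.pos v" using pos_eq[OF v] n by simp
  ultimately show ?thesis
    unfolding result_def using m tw heavy.assemble_items[OF v] by simp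
qed

lemma terminates:
  "\<exists>out. (\<forall>v\<in>V. node_output algorithm (node_view (\<lambda>v. v = r) (c (1 + 2 * num_stages lv)) v) = Some (out v)) \<and>
     (\<exists>H. heavy_light V E r H \<and> (\<forall>v\<in>V. out v = hl_info_of E r H v)) \<and>
     (\<forall>s<1 + 2 * num_stages lv.
        (\<forall>v\<in>V. node_output algorithm (node_view (\<lambda>v. v = r) (c s) v) = None) \<and>
        within_bandwidth algorithm V E (\<lambda>v. v = r) (1 + width lv) c s)"
proof (intro exI[of _ "hl_info_of E r heavy.heavy_edges"] conjI ballI allI impI)
  fix v assume v: "v \<in> V"
  show "node_output algorithm (node_view (\<lambda>v. v = r) (c (1 + 2 * num_stages lv)) v) =
      Some (hl_info_of E r heavy.heavy_edges v)"
    using node_result_eq[OF v] result_eq[OF v] by (simp add: algorithm_def node_view_def)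
next
  show "\<exists>H. heavy_light V E r H \<and> (\<forall>v\<in>V. hl_info_of E r heavy.heavy_edges v = hl_info_of E r H v)"
    using heavy.heavy_light by blast
next
  fix s v assume "s < 1 + 2 * num_stages lv" "v \<in> V"
  then show "node_output algorithm (node_view (\<lambda>v. v = r) (c s) v) = None"
    using node_result_None[of v s] by (simp add: algorithm_def node_view_def)
next
  fix s
  show "within_bandwidth algorithm V E (\<lambda>v. v = r) (1 + width lv) c s" by (rule bandwidth)
qed

end

section \<open>Polylogarithmic bounds\<close>

lemma soft_O1_const: "(\<lambda>_. k) \<in> soft_O1"
  unfolding soft_O1_def by (intro CollectI exI[of _ 0]) simp

lemma soft_O1_mult:
  assumes "f \<in> soft_O1" "g \<in> soft_O1" shows "(\<lambda>n. f n * g n) \<in> soft_O1"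
proof -
  obtain i j where "(\<lambda>n. real (f n)) \<in> O(\<lambda>n. ln (real n) ^ i)" "(\<lambda>n. real (g n)) \<in> O(\<lambda>n. ln (real n) ^ j)"
    using assms by (auto simp: soft_O1_def)
  then have "(\<lambda>n. real (f n) * real (g n)) \<in> O(\<lambda>n. ln (real n) ^ i * ln (real n) ^ j)"
    by (rule landau_o.big.mult)
  then show ?thesis unfolding soft_O1_def by (intro CollectI exI[of _ "i + j"]) (simp add: power_add)
qed

lemma soft_O1_add:
  assumes "f \<in> soft_O1" "g \<in> soft_O1" shows "(\<lambda>n. f n + g n) \<in> soft_O1"
proof -
  obtain i j where f: "(\<lambda>n. real (f n)) \<in> O(\<lambda>n. ln (real n) ^ i)" and g: "(\<lambda>n. real (g n)) \<in> O(\<lambda>n. ln (real n) ^ j)"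
    using assms by (auto simp: soft_O1_def)
  have mono: "(\<lambda>n. ln (real n) ^ k) \<in> O(\<lambda>n. ln (real n) ^ m)" if "k \<le> m" for k m
  proof (rule bigoI[of _ 1])
    \<comment> \<open>From 3, which exceeds \<open>exp 1\<close>, the logarithm is at least 1, so
      its powers grow with the exponent.\<close>
    have "\<forall>\<^sub>F n in sequentially. 3 \<le> n" by (rule eventually_ge_at_top)
    then show "\<forall>\<^sub>F n in sequentially. norm (ln (real n) ^ k) \<le> 1 * norm (ln (real n) ^ m)"
    proof eventually_elim
      case (elim n)
      have "exp 1 \<le> real n" using exp_le elim by linarith
      then have "1 \<le> ln (real n)" using elim by (subst ln_ge_iff) auto
      then show ?case using that by (simp add: power_increasing)
    qed
  qed
  have "(\<lambda>n. real (f n) + real (g n)) \<in> O(\<lambda>n. ln (real n) ^ max i j)"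
    by (intro sum_in_bigo landau_o.big_trans[OF f mono] landau_o.big_trans[OF g mono]) auto
  then show ?thesis unfolding soft_O1_def by (intro CollectI exI[of _ "max i j"]) simp
qed

interpretation hl: staged_program num_stages announce contrib join deliver max_stage result .

lemma num_stages_mono: "l \<le> l' \<Longrightarrow> num_stages l \<le> num_stages l'"
  unfolding num_stages_def merges_def by (intro add_mono mult_mono) auto

text \<open>The algorithm is chosen before the bound \<open>b\<close>: its round number and message
  width depend on the actual maximal ID length \<open>lv\<close>, and
  \<open>lv \<le> b (card V)\<close> turns them into polylogarithmic bounds.\<close>

theorem theoremA5:
  "\<exists>A :: (bool, hl_info) ma_algorithm.
     \<forall>b\<in>soft_O1. \<exists>B\<in>soft_O1. \<exists>R\<in>soft_O1.
       \<forall>V E r. tree V E \<and> r \<in> V \<and> (\<forall>v\<in>V. length v \<le> b (card V)) \<longrightarrow>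
         ma_solves A V E (\<lambda>v. v = r) (B (card V)) (R (card V))
           (\<lambda>out. \<exists>H. heavy_light V E r H \<and> (\<forall>v\<in>V. out v = hl_info_of E r H v))"
proof (intro exI[of _ hl.algorithm] ballI)
  fix b assume b: "b \<in> soft_O1"
  let ?B = "\<lambda>n. 1 + width (b n)" and ?R = "\<lambda>n. 1 + 2 * num_stages (b n)"
  have "?B \<in> soft_O1" "?R \<in> soft_O1"
    unfolding width_def num_stages_def merges_def
    by (intro soft_O1_add soft_O1_mult soft_O1_const b)+
  moreover have "ma_solves hl.algorithm V E (\<lambda>v. v = r) (?B (card V)) (?R (card V))
      (\<lambda>out. \<exists>H. heavy_light V E r H \<and> (\<forall>v\<in>V. out v = hl_info_of E r H v))"
    if "tree V E \<and> r \<in> V \<and> (\<forall>v\<in>V. length v \<le> b (card V))" for V E r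
    unfolding ma_solves_def
  proof (intro conjI allI impI)
    show "aggregation_operator (?B (card V)) (consensus_op hl.algorithm)"
      by (simp add: hl.algorithm_def aggregation_operator_sum_op)
    show "aggregation_operator (?B (card V)) (aggregation_op hl.algorithm)"
      by (simp add: hl.algorithm_def aggregation_operator_agg_op)
    fix c assume "execution hl.algorithm V E (\<lambda>v. v = r) c"
    then interpret hl_execution V E r c using that by unfold_locales auto
    have "lv \<le> b (card V)"
      unfolding lv_def using finite_V r_in_V that by (subst Max_le_iff) auto
    then have t: "1 + 2 * num_stages lv \<le> ?R (card V)" and w: "1 + width lv \<le> ?B (card V)"
      using num_stages_mono by (auto simp: width_def)
    have "within_bandwidth hl.algorithm V E (\<lambda>v. v = r) (?B (card V)) c s"
      if "within_bandwidth hl.algorithm V E (\<lambda>v. v = r) (1 + width lv) c s" for s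
      using that w unfolding within_bandwidth_def by (meson le_trans)
    then show "\<exists>t\<le>?R (card V). \<exists>out.
          (\<forall>v\<in>V. node_output hl.algorithm (node_view (\<lambda>v. v = r) (c t) v) = Some (out v)) \<and>
          (\<exists>H. heavy_light V E r H \<and> (\<forall>v\<in>V. out v = hl_info_of E r H v)) \<and>
          (\<forall>s<t. (\<forall>v\<in>V. node_output hl.algorithm (node_view (\<lambda>v. v = r) (c s) v) = None) \<and>
                 within_bandwidth hl.algorithm V E (\<lambda>v. v = r) (?B (card V)) c s)"
      using terminates t by blast
  qed
  ultimately show "\<exists>B\<in>soft_O1. \<exists>R\<in>soft_O1.
       \<forall>V E r. tree V E \<and> r \<in> V \<and> (\<forall>v\<in>V. length v \<le> b (card V)) \<longrightarrow>
         ma_solves hl.algorithm V E (\<lambda>v. v = r) (B (card V)) (R (card V))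
           (\<lambda>out. \<exists>H. heavy_light V E r H \<and> (\<forall>v\<in>V. out v = hl_info_of E r H v))"
    by (intro bexI[of _ ?B] bexI[of _ ?R] allI impI)
qed

end
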